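(* Let $\ell=2k+1\ge 5$ be prime. For $1\le m\le k-1$, specializing $s_{\ell,m}(\tau)$ to the cusp $0$ produces the value $$\lim_{\tau\rightarrow 0}s_{\ell,m}(\tau) = \prod_{j=1}^m \zeta_\ell^{-\frac{j}{2}}\,\frac{1-\zeta_\ell^{2j}}{1-\zeta_\ell^j},$$ which lies in the cyclotomic unit group of $\mathbb{Q}(\zeta_\ell)^+$. The rank of the subgroup generated by these cyclotomic units ($1\le m\le k-1$) is equal to $\mathrm{Rank}(U_\ell^R)$.
   Context: Let $q=e^{2\pi i\tau}$, $\tau$ in the upper half-plane. Here $\zeta_\ell^{x}:=e^{2\pi i x/\ell}$ for rational $x$, and $\mathbb{Q}(\zeta_\ell)^+$ is the maximal real subfield of $\mathbb{Q}(\zeta_\ell)$. For $0<a<1$ the Siegel function is $g_{(a,0)}(\tau) = -q^{\frac12(a^2-a+\frac16)}\prod_{n=1}^\infty(1-q^{n-1+a})(1-q^{n-a})$. For $1\le m\le k-1$ set $$s_{\ell,m}(\tau) = \prod_{j=1}^m \frac{g_{(2j/\ell,0)}(\ell\tau)}{g_{(j/\ell,0)}(\ell\tau)}$$ (this is the quotient $\Psi_1(m,\frac{\ell-1}{2}-m;\tau)$ of normalized Hall-Littlewood $q$-series of Griffin, Ono and Warnaar). The limit $\tau\to0$ is the value at the cusp $0$, i.e. the limit as $\tau$ approaches the cusp $0$ (for instance along the positive imaginary axis). $U_\ell^R := \langle s_{\ell,m}(\tau): 1\le m\le k-1\rangle$ is the multiplicative group of functions generated by the $s_{\ell,m}$;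 $\mathrm{Rank}$ denotes the rank as an abelian group. For $\ell$ prime the cyclotomic unit group of $\mathbb{Q}(\zeta_\ell)^+$ is $$\left\langle -1,\ \zeta_\ell^{\frac{1-v}{2}} \frac{1-\zeta_\ell^v}{1-\zeta_\ell} : 1 < v < \tfrac{\ell}{2} \right\rangle.$$ *)

theory Defs
  imports
    "HOL-Analysis.Analysis"
    "HOL-Algebra.FiniteProduct"
    "HOL-Algebra.Product_Groups"
    "HOL-Computational_Algebra.Primes"
    "HOL-Library.Extended_Nat"
begin

definition upper_half_plane :: "complex set" where
  "upper_half_plane = {\<tau>. Im \<tau> > 0}"

text \<open>The power \<open>q\<^sup>x\<close> with \<open>q = exp (2 \<pi> i \<tau>)\<close>; the branch is fixed by \<open>\<tau>\<close>.\<close>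

definition qpow :: "complex \<Rightarrow> real \<Rightarrow> complex" where
  "qpow \<tau> x = exp (2 * of_real pi * \<i> * \<tau> * of_real x)"

definition zeta_pow :: "nat \<Rightarrow> real \<Rightarrow> complex" where
  "zeta_pow l x = exp (2 * of_real pi * \<i> * of_real x / of_nat l)"

text \<open>The Siegel function \<open>g\<^bsub>(a,0)\<^esub>\<close>, meant for \<open>0 < a < 1\<close> and \<open>\<tau>\<close> in the upper half-plane.
  The product index is shifted: \<open>n \<ge> 1\<close> is written as \<open>Suc n\<close>.\<close>

definition siegel :: "real \<Rightarrow> complex \<Rightarrow> complex" where
  "siegel a \<tau> = - qpow \<tau> (1/2 * (a\<^sup>2 - a + 1/6)) *
     (\<Prod>n. (1 - qpow \<tau> (real (Suc n) - 1 + a)) * (1 - qpow \<tau> (real (Suc n) - a)))"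

definition s_fun :: "nat \<Rightarrow> nat \<Rightarrow> complex \<Rightarrow> complex" where
  "s_fun l m \<tau> = (\<Prod>j=1..m. siegel (2 * real j / real l) (of_nat l * \<tau>) /
                             siegel (real j / real l) (of_nat l * \<tau>))"

definition s_value :: "nat \<Rightarrow> nat \<Rightarrow> complex" where
  "s_value l m = (\<Prod>j=1..m. zeta_pow l (- real j / 2) *
     ((1 - zeta_pow l (2 * real j)) / (1 - zeta_pow l (real j))))"

text \<open>Approach to the cusp \<open>0\<close>: its neighbourhoods are the horoballs \<open>Im (-1/\<tau>) > C\<close>
  tangent to the real axis at \<open>0\<close>. For \<open>C \<ge> 0\<close> they lie in the upper half-plane, and
  they contain the points \<open>\<i> t\<close> for all small \<open>t > 0\<close>.\<close>

definition at_cusp_zero :: "complex filter" where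
  "at_cusp_zero = filtercomap (\<lambda>\<tau>. Im (- 1 / \<tau>)) at_top"

definition complex_mult_group :: "complex monoid" where
  "complex_mult_group = \<lparr>carrier = UNIV - {0}, monoid.mult = (*), one = 1\<rparr>"

text \<open>Nowhere vanishing functions on the upper half-plane under pointwise multiplication,
  with values outside the upper half-plane discarded.\<close>

definition function_group :: "(complex \<Rightarrow> complex) monoid" where
  "function_group = product_group upper_half_plane (\<lambda>_. complex_mult_group)"

definition U_R :: "nat \<Rightarrow> nat \<Rightarrow> (complex \<Rightarrow> complex) monoid" where
  "U_R l k = subgroup_generated function_group
     ((\<lambda>m. restrict (s_fun l m) upper_half_plane) ` {1..k - 1})"

definition cyclotomic_unit_group :: "nat \<Rightarrow> complex monoid" where
  "cyclotomic_unit_group l = subgroup_generated complex_mult_group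
     (insert (- 1)
       {zeta_pow l ((1 - real v) / 2) * ((1 - zeta_pow l (real v)) / (1 - zeta_pow l 1)) | v.
          1 < v \<and> real v < real l / 2})"

text \<open>The rank of an abelian group, i.e. the supremum of the cardinalities of finite
  \<open>\<int>\<close>-linearly independent subsets, possibly infinite.\<close>

definition int_independent :: "('a, 'b) monoid_scheme \<Rightarrow> 'a set \<Rightarrow> bool" where
  "int_independent G S \<longleftrightarrow>
     (\<forall>c :: 'a \<Rightarrow> int. (\<Otimes>\<^bsub>G\<^esub>x\<in>S. x [^]\<^bsub>G\<^esub> c x) = \<one>\<^bsub>G\<^esub> \<longrightarrow> (\<forall>x\<in>S. c x = 0))"

definition abelian_rank :: "('a, 'b) monoid_scheme \<Rightarrow> enat" where
  "abelian_rank G = (SUP S \<in> {S. finite S \<and> S \<subseteq> carrier G \<and> int_independent G S}. enat (card S))"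

lemma comm_group_complex_mult_group: "comm_group complex_mult_group"
proof (rule comm_groupI)
  fix x assume "x \<in> carrier complex_mult_group"
  then show "\<exists>y\<in>carrier complex_mult_group. y \<otimes>\<^bsub>complex_mult_group\<^esub> x = \<one>\<^bsub>complex_mult_group\<^esub>"
    by (intro bexI[of _ "inverse x"]) (auto simp: complex_mult_group_def)
qed (auto simp: complex_mult_group_def)

lemma comm_group_function_group: "comm_group function_group"
proof -
  interpret comm_group complex_mult_group by (rule comm_group_complex_mult_group)
  have "group function_group"
    unfolding function_group_def by (simp add: is_group)
  then show ?thesis
    by (rule group.group_comm_groupI)
       (auto simp: function_group_def fun_eq_iff PiE_iff intro!: m_comm)
qed

lemma siegel_nonzero:
  assumes a: "0 < a" "a < 1" and t: "Im \<tau> > 0"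
  shows "siegel a \<tau> \<noteq> 0"
proof -
  have nrm: "norm (qpow \<tau> x) = exp (- 2 * pi * Im \<tau> * x)" for x
    by (simp add: qpow_def)
  have nz: "1 - qpow \<tau> x \<noteq> 0" if "x > 0" for x
  proof
    assume "1 - qpow \<tau> x = 0"
    then have "norm (qpow \<tau> x) = 1" by simp
    then show False using that t by (simp add: nrm)
  qed
  define r where "r = exp (- 2 * pi * Im \<tau>)"
  have r: "0 < r" "r < 1" using t by (auto simp: r_def)
  have conv: "convergent_prod (\<lambda>n. 1 - qpow \<tau> (real n + b))" for b
  proof -
    have "norm (qpow \<tau> (real n + b)) = exp (- 2 * pi * Im \<tau> * b) * r ^ n" for n
      by (simp add: nrm r_def exp_of_nat_mult[symmetric] exp_add[symmetric] algebra_simps)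
    then have "summable (\<lambda>n. norm (qpow \<tau> (real n + b)))"
      using r by (simp add: summable_geometric summable_mult)
    then have "abs_convergent_prod (\<lambda>n. 1 - qpow \<tau> (real n + b))"
      by (simp add: abs_convergent_prod_conv_summable)
    then show ?thesis by (rule abs_convergent_prod_imp_convergent_prod)
  qed
  have "convergent_prod (\<lambda>n. (1 - qpow \<tau> (real n + a)) * (1 - qpow \<tau> (real n + (1 - a))))"
    by (intro convergent_prod_mult conv)
  then have "(\<Prod>n. (1 - qpow \<tau> (real n + a)) * (1 - qpow \<tau> (real n + (1 - a)))) \<noteq> 0"
    by (rule prodinf_nonzero) (use a nz in \<open>simp add: add_nonneg_pos\<close>)
  then show ?thesis
    by (simp add: siegel_def qpow_def algebra_simps)
qed

lemma s_fun_in_function_group: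
  assumes "2 * m < l"
  shows "restrict (s_fun l m) upper_half_plane \<in> carrier function_group"
proof -
  have "s_fun l m \<tau> \<noteq> 0" if "Im \<tau> > 0" for \<tau>
  proof -
    have "siegel (2 * real j / real l) (of_nat l * \<tau>) \<noteq> 0"
         "siegel (real j / real l) (of_nat l * \<tau>) \<noteq> 0" if "j \<in> {1..m}" for j
    proof -
      have "0 < j" "0 < l" "2 * real j < real l"
        using assms that by auto
      then show "siegel (2 * real j / real l) (of_nat l * \<tau>) \<noteq> 0"
         "siegel (real j / real l) (of_nat l * \<tau>) \<noteq> 0"
        using \<open>Im \<tau> > 0\<close> by - (rule siegel_nonzero; simp)+
    qed
    then show ?thesis by (simp add: s_fun_def)
  qed
  then show ?thesis
    by (auto simp: function_group_def complex_mult_group_def upper_half_plane_def)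
qed

end

theory Submission
  imports
    Defs
    "HOL-Complex_Analysis.Complex_Analysis"
    "HOL-Number_Theory.Number_Theory"
    "HOL-Real_Asymp.Real_Asymp"
begin

text \<open>
  The Siegel functions are values of the theta product
  \<open>\<Prod>n\<ge>0. (1 - q\<^sup>n e(z)) (1 - q\<^sup>n\<^sup>+\<^sup>1 e(-z))\<close>. By Liouville's theorem this product is
  determined up to a constant by its quasi-periods and its zero at \<open>0\<close>, which relates \<open>\<tau>\<close> to
  \<open>-1/\<tau>\<close>; the constant cancels in the quotients \<open>s\<^bsub>l,m\<^esub>\<close>, and the limit at the cusp \<open>0\<close> is
  read off as the constant term at \<open>-1/\<tau> \<rightarrow> \<i>\<infinity>\<close>.

  For the ranks it suffices that the \<open>s\<^bsub>l,m\<^esub>\<close> and their values satisfy the same multiplicative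
  relations. A relation between functions passes to the limit. Conversely, a relation between the
  values is a polynomial relation for \<open>\<zeta>\<^sub>l\<close> and hence (Eisenstein) holds for all conjugates, so
  that summing its logarithms against an even character \<open>\<psi>\<close> gives
  \<open>(\<Sum>j. b\<^sub>j (\<psi>(2j) - \<psi>(j))) * (\<Sum>a. \<psi>(a) ln \<bar>1 - \<zeta>\<^sub>l\<^sup>a\<bar>) = 0\<close> up to conjugation of
  \<open>\<psi>\<close>. For nontrivial \<open>\<psi>\<close> the second factor is a Gauss sum times \<open>- L(1, \<psi>)\<close>, up to
  conjugation, and does not vanish: for real \<open>\<psi>\<close> by Monsky's argument with the Lambert series
  \<open>\<Sum>n. \<psi>(n) x\<^sup>n / (1 - x\<^sup>n)\<close>, otherwise because the product of all \<open>L(s, \<psi>)\<close> is at least \<open>1\<close>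
  for \<open>s > 1\<close>. So the exponents of the Siegel functions cancel classwise in \<open>(\<int>/l)\<^sup>\<times>/{1,-1}\<close>,
  and \<open>g\<^bsub>(1-a,0)\<^esub> = g\<^bsub>(a,0)\<^esub>\<close> gives the relation between the functions.
\<close>

section \<open>Theta products\<close>

text \<open>The \<open>s_fun l m\<close> can be dependent. For \<open>l = 17\<close> the class of 2
  does not generate the cyclic group \<open>(\<int>/17)\<^sup>\<times>/{1,-1}\<close>, and the
  quotients \<open>g(2j)/g(j)\<close> of Siegel functions multiply to 1 over
  \<open>j = 3, 5, 6, 7\<close>. In general a nontrivial even \<open>\<psi>\<close> with
  \<open>\<psi>(2) = 1\<close> produces such a dependence. So independence cannot be the goal, and
  the relations are compared without computing either rank. Logarithms of absolute values see only
  even characters and forget roots of unity. Neither loss does harm: the Siegel functions are even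
  in the same sense, and the conclusion is that integer exponents cancel, which gives the relation
  between the functions exactly, with no root of unity left to determine.
  \<open>L(s, \<psi>)\<close> is used only for \<open>s > 1\<close> and, as a conditionally
  convergent series, at \<open>s = 1\<close>. Estimates linear in \<open>s - 1\<close> replace its
  analytic continuation.\<close>

definition ee :: "complex \<Rightarrow> complex" where
  "ee z = exp (2 * of_real pi * \<i> * z)"

lemma ee_add: "ee (x + y) = ee x * ee y"
  by (simp add: ee_def exp_add ring_distribs)

lemma ee_diff: "ee (x - y) = ee x / ee y"
  by (simp add: ee_def exp_diff ring_distribs)

lemma ee_minus: "ee (- x) = inverse (ee x)"
  by (simp add: ee_def exp_minus)

lemma ee_0 [simp]: "ee 0 = 1" and ee_nonzero [simp]: "ee z \<noteq> 0"
  by (simp_all add: ee_def)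

lemma ee_eq_1_iff: "ee z = 1 \<longleftrightarrow> z \<in> \<int>"
proof -
  have "ee z = 1 \<longleftrightarrow> Im z = 0 \<and> (\<exists>n::int. 2 * pi * Re z = 2 * pi * of_int n)"
    unfolding ee_def exp_eq_1 by (auto simp: mult_ac)
  also have "\<dots> \<longleftrightarrow> z \<in> \<int>"
    by (auto simp: Ints_def complex_eq_iff)
  finally show ?thesis .
qed

lemma ee_of_real_eq_1_iff: "ee (of_real x) = 1 \<longleftrightarrow> x \<in> \<int>"
  unfolding ee_eq_1_iff by (auto simp: Ints_def complex_eq_iff)

lemma ee_of_int [simp]: "ee (of_int n) = 1"
  by (simp add: ee_eq_1_iff)

lemma ee_of_nat [simp]: "ee (of_nat n) = 1"
  by (simp add: ee_eq_1_iff)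

lemma ee_1 [simp]: "ee 1 = 1"
  using ee_of_nat[of 1] by simp

lemma ee_half: "ee (1 / 2) = - 1"
  by (simp add: ee_def)

lemma norm_ee: "norm (ee z) = exp (- 2 * pi * Im z)"
  by (simp add: ee_def)

lemma ee_power: "ee z ^ n = ee (of_nat n * z)"
  by (induction n) (simp_all add: ee_add ring_distribs)

lemma holomorphic_ee [holomorphic_intros]: "f holomorphic_on A \<Longrightarrow> (\<lambda>z. ee (f z)) holomorphic_on A"
  unfolding ee_def by (intro holomorphic_intros)

lemma continuous_on_ee [continuous_intros]: "continuous_on A f \<Longrightarrow> continuous_on A (\<lambda>z. ee (f z))"
  unfolding ee_def by (intro continuous_intros)

text \<open>The infinite q-Pochhammer symbol \<open>(ee z; q)\<close> with
  \<open>q = ee t\<close>.\<close>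

definition half_theta :: "complex \<Rightarrow> complex \<Rightarrow> complex" where
  "half_theta t z = (\<Prod>n. 1 - ee (of_nat n * t + z))"

text \<open>By the Jacobi triple product this is the sum of
  \<open>(-1)^n q^(n(n-1)/2) ee (n z)\<close> over all integers \<open>n\<close>, divided by the
  product of the \<open>1 - q^n\<close>, which does not depend on \<open>z\<close>.\<close>

definition theta :: "complex \<Rightarrow> complex \<Rightarrow> complex" where
  "theta t z = half_theta t z * half_theta t (t - z)"

context
  fixes t :: complex
  assumes t: "Im t > 0"
begin

lemma norm_ee_of_nat_mult_add:
  "norm (ee (of_nat n * t + z)) = exp (- 2 * pi * Im z) * exp (- 2 * pi * Im t) ^ n"
  by (simp add: norm_ee exp_of_nat_mult[symmetric] exp_add[symmetric] algebra_simps)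

lemma summable_norm_ee: "summable (\<lambda>n. norm (ee (of_nat n * t + z)))"
  unfolding norm_ee_of_nat_mult_add using t
  by (intro summable_mult summable_geometric) simp

lemma convergent_prod_half_theta: "convergent_prod (\<lambda>n. 1 - ee (of_nat n * t + z))"
  using summable_norm_ee[of z]
  by (intro abs_convergent_prod_imp_convergent_prod) (simp add: abs_convergent_prod_conv_summable)

lemma half_theta_eq_0_iff: "half_theta t z = 0 \<longleftrightarrow> (\<exists>n. of_nat n * t + z \<in> \<int>)"
  using convergent_prod_half_theta[of z] convergent_prod_to_zero_iff
  unfolding half_theta_def
  using has_prod_eq_0_iff[OF convergent_prod_has_prod[OF convergent_prod_half_theta[of z]]]
  by (auto simp: ee_eq_1_iff)

lemma half_theta_add_1: "half_theta t (z + 1) = half_theta t z"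
  by (simp add: half_theta_def ee_add)

lemma half_theta_rec: "half_theta t z = (1 - ee z) * half_theta t (z + t)"
proof -
  define f where "f = (\<lambda>n. 1 - ee (of_nat n * t + z))"
  have f: "convergent_prod f"
    unfolding f_def by (rule convergent_prod_half_theta)
  have "prodinf f = f 0 * (\<Prod>n. f (Suc n))"
  \<comment> \<open>Splitting off the head of a convergent product supposes a nonzero head; for a
    zero head both sides vanish.\<close>
  proof (cases "f 0 = 0")
    case True
    then show ?thesis
      using has_prod_eq_0_iff[OF convergent_prod_has_prod[OF f]] by auto
  next
    case False
    then show ?thesis
      using prodinf_split_head[OF f] by auto
  qed
  then show ?thesis
    by (simp add: half_theta_def f_def ring_distribs add_ac)
qed

lemma half_theta_holomorphic_UNIV: "half_theta t holomorphic_on UNIV"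
proof (rule holomorphic_uniform_sequence)
  define P where "P = (\<lambda>N z. \<Prod>n<N. 1 - ee (of_nat n * t + z))"
  show "P N holomorphic_on UNIV" for N
    unfolding P_def by (intro holomorphic_intros)
  fix w :: complex
  \<comment> \<open>The geometric majorant is stated for discs about 0; this one contains the unit
    disc about \<open>w\<close>.\<close>
  define R where "R = norm w + 1"
  have "uniformly_convergent_on (cball 0 R) (\<lambda>N z. \<Sum>n<N. norm (1 - ee (of_nat n * t + z) - 1))"
  proof (rule Weierstrass_m_test'_ev)
    show "summable (\<lambda>n. exp (2 * pi * R) * exp (- 2 * pi * Im t) ^ n)"
      using t by (intro summable_mult summable_geometric) simp
    have "norm (ee (of_nat n * t + z)) \<le> exp (2 * pi * R) * exp (- 2 * pi * Im t) ^ n"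
      if "z \<in> cball 0 R" for z n
    proof -
      have "- Im z \<le> R"
        using that abs_Im_le_cmod[of z] by (auto simp: abs_le_iff)
      then have "2 * pi * (- Im z) \<le> 2 * pi * R"
        by (intro mult_left_mono) auto
      then show ?thesis
        unfolding norm_ee_of_nat_mult_add by (intro mult_right_mono) auto
    qed
    then show "\<forall>\<^sub>F n in sequentially. \<forall>x\<in>cball 0 R. norm (norm (1 - ee (of_nat n * t + x) - 1))
          \<le> exp (2 * pi * R) * exp (- 2 * pi * Im t) ^ n"
      by simp
  qed
  then have "uniformly_convergent_on (cball 0 R) P"
    unfolding P_def
    by (intro uniformly_convergent_on_prod') (auto intro!: continuous_intros)
  then obtain g where g: "uniform_limit (cball 0 R) P g sequentially"
    by (auto simp: uniformly_convergent_on_def)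
  have "g z = half_theta t z" if "z \<in> cball 0 R" for z
  proof -
    have "(\<lambda>N. P (Suc N) z) \<longlonglongrightarrow> g z"
      using tendsto_uniform_limitI[OF g that] by (rule LIMSEQ_Suc)
    moreover have "(\<lambda>N. P (Suc N) z) \<longlonglongrightarrow> half_theta t z"
      using convergent_prod_LIMSEQ[OF convergent_prod_half_theta[of z]]
      unfolding P_def lessThan_Suc_atMost half_theta_def .
    ultimately show ?thesis by (rule LIMSEQ_unique)
  qed
  then have "uniform_limit (cball 0 R) P (half_theta t) sequentially"
    using g by (metis (no_types, lifting) uniform_limit_cong')
  then have "uniform_limit (cball w 1) P (half_theta t) sequentially"
    by (rule uniform_limit_on_subset) (simp add: cball_subset_cball_iff R_def)
  then show "\<exists>d>0. cball w d \<subseteq> UNIV \<and> uniform_limit (cball w d) P (half_theta t) sequentially"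
    by (intro exI[of _ 1]) auto
qed auto

lemma half_theta_holomorphic:
  assumes "f holomorphic_on A"
  shows "(\<lambda>z. half_theta t (f z)) holomorphic_on A"
proof -
  have "(half_theta t \<circ> f) holomorphic_on A"
    by (rule holomorphic_on_compose_gen[OF assms half_theta_holomorphic_UNIV]) auto
  then show ?thesis by (simp add: o_def)
qed

lemma theta_holomorphic:
  assumes "f holomorphic_on A"
  shows "(\<lambda>z. theta t (f z)) holomorphic_on A"
  unfolding theta_def by (intro holomorphic_intros half_theta_holomorphic assms)

lemma theta_add_1: "theta t (z + 1) = theta t z"
  using half_theta_add_1[of z] half_theta_add_1[of "t - z - 1"]
  by (simp add: theta_def algebra_simps)

text \<open>Moving \<open>z\<close> by \<open>t\<close> removes the factor \<open>1 - ee z\<close>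
  from one half and adds \<open>1 - ee (- z)\<close> to the other; their quotient is
  \<open>- ee (- z)\<close>.\<close>

lemma theta_add_period: "theta t (z + t) = - ee (- z) * theta t z"
proof -
  have 1: "half_theta t z = (1 - ee z) * half_theta t (z + t)"
    by (rule half_theta_rec)
  have 2: "half_theta t (- z) = (1 - ee (- z)) * half_theta t (t - z)"
    using half_theta_rec[of "- z"] by (simp add: add_ac)
  have 3: "1 - ee (- z) = - ee (- z) * (1 - ee z)"
    by (simp add: ee_minus field_simps)
  show ?thesis
    unfolding theta_def 1 using 2 3 by simp
qed

section \<open>Zeros of theta and its determination by quasi-periods\<close>

definition period_lattice :: "complex set" where
  "period_lattice = {of_int m + of_int n * t | m n. True}"

lemma theta_eq_0_iff: "theta t z = 0 \<longleftrightarrow> z \<in> period_lattice"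
proof
  assume "theta t z = 0"
  then consider n m where "of_nat n * t + z = of_int m" | n m where "of_nat n * t + (t - z) = of_int m"
    by (auto simp: theta_def half_theta_eq_0_iff Ints_def)
  then show "z \<in> period_lattice"
  proof cases
    case 1
    then have "z = of_int m + of_int (- int n) * t" by (simp add: algebra_simps)
    then show ?thesis unfolding period_lattice_def by blast
  next
    case 2
    then have "z = of_int (- m) + of_int (int n + 1) * t" by (simp add: algebra_simps)
    then show ?thesis unfolding period_lattice_def by blast
  qed
next
  assume "z \<in> period_lattice"
  then obtain m n where z: "z = of_int m + of_int n * t" by (auto simp: period_lattice_def)
  show "theta t z = 0"
  proof (cases "n \<le> 0")
    case True
    then have "of_nat (nat (- n)) * t + z = of_int m"
      by (simp add: z)
    then show ?thesis unfolding theta_def mult_eq_0_iff half_theta_eq_0_iff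
      by (metis Ints_of_int)
  next
    case False
    then have "of_nat (nat (n - 1)) * t + (t - z) = of_int (- m)"
      by (simp add: z algebra_simps)
    then show ?thesis unfolding theta_def mult_eq_0_iff half_theta_eq_0_iff
      by (metis Ints_of_int)
  qed
qed

text \<open>The values of \<open>f\<close> may have any type: besides an elliptic function, the
  predicate \<open>F z = 0\<close> is inserted, which has both periods although \<open>F\<close> is
  only quasi-periodic.\<close>

lemma shift_invariant_period_lattice:
  assumes 1: "\<And>z. f (z + 1) = f z" and 2: "\<And>z. f (z + t) = f z"
  shows "f (z + (of_int m + of_int n * t)) = f z"
proof -
  have A: "f (z + of_int m) = f z" for z
  proof (induction m rule: int_induct[of _ 0])
    case (step1 i) then show ?case using 1[of "z + of_int i"] by (simp add: add_ac)
  next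
    case (step2 i) then show ?case using 1[of "z + of_int (i - 1)"] by (simp add: add_ac)
  qed auto
  have B: "f (z + of_int n * t) = f z" for z
  proof (induction n rule: int_induct[of _ 0])
    case (step1 i) then show ?case using 2[of "z + of_int i * t"] by (simp add: ring_distribs add_ac)
  next
    case (step2 i) then show ?case using 2[of "z + of_int (i - 1) * t"] by (simp add: algebra_simps)
  qed auto
  show ?thesis using A[of "z + of_int n * t"] B[of z] by (simp add: add_ac)
qed

text \<open>An entire function with the quasi-periods of \<open>theta\<close> that vanishes at \<open>0\<close> vanishes at all
  (simple) zeros of \<open>theta\<close>; the quotient is an entire elliptic function.\<close>

lemma quasi_periodic_eq_theta:
  assumes holF: "F holomorphic_on UNIV" and F0: "F 0 = 0"
    and F1: "\<And>z. F (z + 1) = F z" and Ft: "\<And>z. F (z + t) = - ee (- z) * F z"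
  obtains C where "\<And>z. F z = C * theta t z"
proof -
  \<comment> \<open>This is \<open>theta\<close> without the factor that vanishes at 0;
    \<open>H 0 \<noteq> 0\<close> says that the zero is simple.\<close>
  define H where "H = (\<lambda>z. half_theta t (z + t) * half_theta t (t - z))"
  have theta_H: "theta t z = (1 - ee z) * H z" for z
    unfolding theta_def H_def using half_theta_rec[of z] by simp
  have contH: "isCont H 0"
  proof -
    have "H holomorphic_on UNIV" unfolding H_def by (intro holomorphic_intros half_theta_holomorphic)
    then show ?thesis
      using holomorphic_on_imp_continuous_on continuous_on_eq_continuous_at open_UNIV by blast
  qed
  have H0: "H 0 \<noteq> 0"
  proof -
    have "of_nat n * t + t \<notin> \<int>" for n
    proof
      assume "of_nat n * t + t \<in> \<int>"
      then have "Im (of_nat n * t + t) = 0" by (metis Ints_cases complex_Im_of_int)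
      moreover have "Im (of_nat n * t + t) = (real n + 1) * Im t" by (simp add: algebra_simps)
      ultimately show False using t by simp
    qed
    then show ?thesis by (simp add: H_def half_theta_eq_0_iff)
  qed
  have quot: "((\<lambda>z. F z / theta t z) \<longlongrightarrow> deriv F 0 / (- (2 * of_real pi * \<i>)) / H 0) (at 0)"
  proof -
    have "(F has_field_derivative deriv F 0) (at 0)"
      using holF by (simp add: holomorphic_derivI)
    then have a: "((\<lambda>z. F z / z) \<longlongrightarrow> deriv F 0) (at 0)"
      by (simp add: has_field_derivative_iff F0)
    have "((\<lambda>z. 1 - ee z) has_field_derivative - (2 * of_real pi * \<i>)) (at 0)"
      unfolding ee_def by (auto intro!: derivative_eq_intros)
    then have b: "((\<lambda>z. (1 - ee z) / z) \<longlongrightarrow> - (2 * of_real pi * \<i>)) (at 0)"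
      by (simp add: has_field_derivative_iff)
    have "((\<lambda>z. (F z / z) / ((1 - ee z) / z) / H z) \<longlongrightarrow> deriv F 0 / (- (2 * of_real pi * \<i>)) / H 0) (at 0)"
      using contH H0 by (intro tendsto_divide a b) (auto simp: isCont_def)
    moreover have "\<forall>\<^sub>F z in at 0. (F z / z) / ((1 - ee z) / z) / H z = F z / theta t z"
      by (intro eventually_mono[OF eventually_neq_at_within]) (auto simp: theta_H)
    ultimately show ?thesis by (rule Lim_transform_eventually)
  qed
  define c where "c = deriv F 0 / (- (2 * of_real pi * \<i>)) / H 0"
  \<comment> \<open>\<open>c\<close> is the limit of the quotient at 0. By periodicity it is also
    the right value at all other lattice points, that is, at all zeros of
    \<open>theta\<close>.\<close>
  define R where "R = (\<lambda>z. if theta t z = 0 then c else F z / theta t z)"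
  have R1: "R (z + 1) = R z" for z
    by (simp add: R_def theta_add_1 F1)
  have Rt: "R (z + t) = R z" for z
    by (simp add: R_def theta_add_period Ft)
  have theta0: "\<forall>\<^sub>F z in at 0. theta t z \<noteq> 0"
  proof -
    have "\<forall>\<^sub>F z in at 0. H z \<noteq> 0"
      using contH H0 by (intro tendsto_imp_eventually_ne[of H "H 0"]) (auto simp: isCont_def)
    moreover have "\<forall>\<^sub>F z in at (0::complex). z \<in> ball 0 1 - {0}"
      by (auto simp: eventually_at intro!: exI[of _ 1])
    ultimately show ?thesis
    proof eventually_elim
      case (elim z)
      have "z \<notin> \<int>"
      proof
        assume "z \<in> \<int>"
        then obtain i where "z = of_int i" by (auto simp: Ints_def)
        with elim show False by auto
      qed
      then show ?case using elim by (simp add: theta_H ee_eq_1_iff)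
    qed
  qed
  then obtain S where S: "open S" "0 \<in> S" "\<And>z. z \<in> S \<Longrightarrow> z \<noteq> 0 \<Longrightarrow> theta t z \<noteq> 0"
    unfolding eventually_at_topological by blast
  have "R holomorphic_on S"
  proof (rule no_isolated_singularity'[of "{0}"])
    have "theta t 0 = 0"
      unfolding theta_eq_0_iff period_lattice_def by (auto intro!: exI[of _ 0])
    then have "R 0 = c" by (simp add: R_def)
    moreover have "\<forall>\<^sub>F z in at 0. F z / theta t z = R z"
      using theta0 by eventually_elim (simp add: R_def)
    ultimately have "(R \<longlongrightarrow> R 0) (at 0)"
      using Lim_transform_eventually[OF quot] by (simp add: c_def)
    then show "\<And>z. z \<in> {0} \<Longrightarrow> (R \<longlongrightarrow> R z) (at z within S)"
      using Lim_at_imp_Lim_at_within by blast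
    have "(\<lambda>z. F z / theta t z) holomorphic_on S - {0}"
      using S by (intro holomorphic_intros theta_holomorphic holomorphic_on_subset[OF holF]) auto
    then show "R holomorphic_on S - {0}"
      by (rule holomorphic_transform) (use S in \<open>auto simp: R_def\<close>)
  qed (use S in auto)
  then have R_diff_0: "R field_differentiable at 0"
    using S by (simp add: holomorphic_on_imp_differentiable_at)
  have cont_theta: "continuous_on UNIV (theta t)"
    using theta_holomorphic[of "\<lambda>z. z" UNIV] by (auto intro: holomorphic_on_imp_continuous_on)
  have "R field_differentiable at w" for w
  proof (cases "theta t w = 0")
    case True
    then obtain m n where w: "w = of_int m + of_int n * t"
      by (auto simp: theta_eq_0_iff period_lattice_def)
    have "R = R \<circ> (\<lambda>z. z - w)"
    proof
      fix z
      show "R z = (R \<circ> (\<lambda>z. z - w)) z"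
        using shift_invariant_period_lattice[of R "z - w" m n, OF R1 Rt] by (simp add: w)
    qed
    moreover have "(R \<circ> (\<lambda>z. z - w)) field_differentiable at w"
      using R_diff_0 by (intro field_differentiable_compose) (auto intro!: derivative_intros)
    ultimately show ?thesis by simp
  next
    case False
    define A where "A = {z. theta t z \<noteq> 0}"
    have "open A"
      unfolding A_def by (intro open_Collect_neq cont_theta continuous_intros)
    have "(\<lambda>z. F z / theta t z) holomorphic_on A"
      unfolding A_def by (intro holomorphic_intros theta_holomorphic holomorphic_on_subset[OF holF]) auto
    then have "R holomorphic_on A"
      by (rule holomorphic_transform) (auto simp: R_def A_def)
    then show ?thesis
      using \<open>open A\<close> False by (simp add: holomorphic_on_imp_differentiable_at A_def)
  qed
  then have holR: "R holomorphic_on UNIV"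
    by (simp add: holomorphic_on_def)
  have "bounded (range R)"
  proof -
    define K where "K = (\<lambda>(x, y). of_real x + of_real y * t) ` ({0..1} \<times> {0..1::real})"
    have "compact K"
      unfolding K_def
      by (intro compact_continuous_image compact_Times continuous_intros)
         (auto simp: case_prod_unfold intro!: continuous_intros)
    then have "bounded (R ` K)"
      using holR by (meson compact_continuous_image compact_imp_bounded holomorphic_on_imp_continuous_on
          holomorphic_on_subset subset_UNIV)
    moreover have "range R \<subseteq> R ` K"
    proof clarify
      fix z
      define y where "y = Im z / Im t"
      define x where "x = Re z - y * Re t"
      have z: "z = of_real x + of_real y * t"
        using t by (simp add: complex_eq_iff x_def y_def)
      have "z = (of_real (frac x) + of_real (frac y) * t) + (of_int \<lfloor>x\<rfloor> + of_int \<lfloor>y\<rfloor> * t)"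
        unfolding z frac_def by (simp add: algebra_simps)
      then have "R z = R (of_real (frac x) + of_real (frac y) * t)"
        using shift_invariant_period_lattice[of R _ "\<lfloor>x\<rfloor>" "\<lfloor>y\<rfloor>", OF R1 Rt] by simp
      moreover have "of_real (frac x) + of_real (frac y) * t \<in> K"
        unfolding K_def by (intro image_eqI[of _ _ "(frac x, frac y)"]) (auto simp: less_imp_le frac_lt_1)
      ultimately show "R z \<in> R ` K" by (metis imageI)
    qed
    ultimately show ?thesis by (rule bounded_subset)
  qed
  with holR have "R constant_on UNIV" by (rule Liouville_theorem)
  then obtain C where C: "\<And>z. R z = C" by (auto simp: constant_on_def)
  have eq: "F z = C * theta t z" if "theta t z \<noteq> 0" for z
    using C[of z] that by (simp add: R_def field_simps)
  have "F z = C * theta t z" if "theta t z = 0" for z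
  proof -
    obtain m n where z: "z = of_int m + of_int n * t"
      using \<open>theta t z = 0\<close> by (auto simp: theta_eq_0_iff period_lattice_def)
    \<comment> \<open>At a zero of \<open>theta\<close> the quotient says nothing about
      \<open>F\<close>, but \<open>F 0 = 0\<close> spreads over the lattice.\<close>
    have "(F (z + 1) = 0) = (F z = 0)" "(F (z + t) = 0) = (F z = 0)" for z
      by (simp_all add: F1 Ft)
    from shift_invariant_period_lattice[of "\<lambda>z. F z = 0" 0 m n, OF this] show ?thesis
      using F0 that by (simp add: z)
  qed
  with eq that show ?thesis by blast
qed

end

section \<open>The transformation from \<open>t\<close> to \<open>-1/t\<close>\<close>

lemma theta_transformation:
  assumes t: "Im t > 0"
  obtains C where "C \<noteq> 0"
    "\<And>z. ee (z / 2 - (z\<^sup>2 + z) / (2 * t)) * theta (- 1 / t) (z / t) = C * theta t z"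
proof -
  define s where "s = - 1 / t"
  have t0: "t \<noteq> 0" using t by auto
  have s: "Im s > 0"
    using t by (simp add: s_def Im_divide field_simps sum_power2_gt_zero_iff)
  \<comment> \<open>Passing from \<open>z\<close> to \<open>z / t\<close> exchanges the periods:
    \<open>z + 1\<close> becomes a shift by \<open>- s\<close>, and \<open>z + t\<close> a shift by
    1. The quadratic exponent absorbs the quasi-period of the first and supplies that of the
    second.\<close>
  define G where "G = (\<lambda>z. ee (z / 2 - (z\<^sup>2 + z) / (2 * t)))"
  define F where "F = (\<lambda>z. G z * theta s (z / t))"
  have "F holomorphic_on UNIV"
    unfolding F_def G_def using t0
    by (intro holomorphic_intros theta_holomorphic[OF s]) auto
  moreover have "theta s 0 = 0"
    unfolding theta_eq_0_iff[OF s] period_lattice_def[OF s] by (auto intro!: exI[of _ 0])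
  then have "F 0 = 0" by (simp add: F_def)
  moreover have "F (z + 1) = F z" for z
  proof -
    have "(z + 1) / t + s = z / t"
      by (simp add: s_def field_simps t0)
    then have "theta s (z / t) = - ee (- ((z + 1) / t)) * theta s ((z + 1) / t)"
      using theta_add_period[OF s, of "(z + 1) / t"] by simp
    moreover have "- G z * ee (- ((z + 1) / t)) = G (z + 1)"
    proof -
      have "G (z + 1) = ee (z / 2 - (z\<^sup>2 + z) / (2 * t) + - ((z + 1) / t) + 1 / 2)"
        unfolding G_def by (rule arg_cong[of _ _ ee]) (simp add: field_simps t0 power2_eq_square)
      then show ?thesis
        unfolding G_def ee_add ee_half by simp
    qed
    ultimately show ?thesis unfolding F_def by (metis mult.assoc mult_minus_left mult_minus_right)
  qed
  moreover have "F (z + t) = - ee (- z) * F z" for z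
  proof -
    have "(z + t) / t = z / t + 1"
      by (simp add: field_simps t0)
    then have "theta s ((z + t) / t) = theta s (z / t)"
      using theta_add_1[OF s, of "z / t"] by simp
    moreover have "G (z + t) = - ee (- z) * G z"
    proof -
      have "G (z + t) = ee (z / 2 - (z\<^sup>2 + z) / (2 * t) + - z - 1 / 2)"
        unfolding G_def by (rule arg_cong[of _ _ ee]) (simp add: field_simps t0 power2_eq_square)
      then show ?thesis
        unfolding G_def ee_diff ee_add ee_half by simp
    qed
    ultimately show ?thesis by (simp add: F_def)
  qed
  ultimately obtain C where C: "\<And>z. F z = C * theta t z"
    using quasi_periodic_eq_theta[OF t] by metis
  \<comment> \<open>A half period is not a zero, so \<open>F\<close> is not identically 0 and
    \<open>C \<noteq> 0\<close>.\<close>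
  have "F (1 / 2) \<noteq> 0"
  proof
    assume "F (1 / 2) = 0"
    then have "theta s (1 / 2 / t) = 0" by (simp add: F_def G_def)
    then obtain m n :: int where "1 / 2 / t = of_int m + of_int n * s"
      unfolding theta_eq_0_iff[OF s] period_lattice_def[OF s] by auto
    then have eq: "1 / 2 + of_int n = of_int m * t"
      using t0 by (simp add: s_def field_simps)
    then have "Im (1 / 2 + of_int n) = of_int m * Im t" by simp
    then have "m = 0" using t by simp
    with eq have "of_int (1 + 2 * n) = (0 :: complex)" by (simp add: field_simps)
    then have "1 + 2 * n = 0" by (simp only: of_int_eq_0_iff)
    then show False by presburger
  qed
  then have "C \<noteq> 0" by (auto simp: C)
  with C that show ?thesis by (auto simp: F_def G_def s_def)
qed

section \<open>The cusp 0 and cyclotomic units\<close>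

lemma qpow_conv_ee: "qpow t x = ee (t * of_real x)"
  by (simp add: qpow_def ee_def mult_ac)

lemma zeta_pow_conv_ee: "zeta_pow l x = ee (of_real (x / real l))"
  by (simp add: zeta_pow_def ee_def)

lemma siegel_conv_theta:
  assumes "Im t > 0"
  shows "siegel a t = - qpow t (1/2 * (a\<^sup>2 - a + 1/6)) * theta t (of_real a * t)"
proof -
  have "(\<Prod>n. (1 - qpow t (real (Suc n) - 1 + a)) * (1 - qpow t (real (Suc n) - a))) =
        (\<Prod>n. (1 - ee (of_nat n * t + of_real a * t)) * (1 - ee (of_nat n * t + (t - of_real a * t))))"
    by (simp add: qpow_conv_ee algebra_simps)
  also have "\<dots> = theta t (of_real a * t)"
    unfolding theta_def half_theta_def using assms
    by (intro prodinf_mult[symmetric] convergent_prod_half_theta)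
  finally show ?thesis by (simp add: siegel_def)
qed

text \<open>At \<open>z = a t\<close> the terms quadratic in \<open>a\<close> cancel against the
  power of \<open>q\<close> in the Siegel function; only \<open>ee (t / 12)\<close>, which comes
  from the \<open>1/6\<close>, and \<open>ee (- a / 2)\<close> remain. So \<open>C\<close> depends
  on \<open>t\<close> but not on \<open>a\<close> and drops out of quotients.\<close>

lemma siegel_transformation:
  assumes t: "Im t > 0"
  obtains C where "C \<noteq> 0" "\<And>a. siegel a t = C * (ee (- of_real a / 2) * theta (- 1 / t) (of_real a))"
proof -
  have t0: "t \<noteq> 0" using t by auto
  obtain C where C: "C \<noteq> 0"
    "\<And>z. ee (z / 2 - (z\<^sup>2 + z) / (2 * t)) * theta (- 1 / t) (z / t) = C * theta t z"
    using theta_transformation[OF t] by metis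
  have "siegel a t = - inverse C * ee (t / 12) * (ee (- of_real a / 2) * theta (- 1 / t) (of_real a))" for a
  proof -
    define z where "z = of_real a * t"
    have "theta t z = inverse C * (ee (z / 2 - (z\<^sup>2 + z) / (2 * t)) * theta (- 1 / t) (of_real a))"
      using C(2)[of z] C(1) t0 by (simp add: z_def field_simps)
    moreover have "qpow t (1/2 * (a\<^sup>2 - a + 1/6)) * ee (z / 2 - (z\<^sup>2 + z) / (2 * t)) =
        ee (t / 12) * ee (- of_real a / 2)"
      unfolding qpow_conv_ee z_def ee_add[symmetric]
      by (rule arg_cong[of _ _ ee]) (simp add: field_simps t0 power2_eq_square)
    moreover have "P * (i * (E * H)) = i * ((P * E) * H)" for P i E H :: complex
      by (simp add: mult_ac)
    ultimately show ?thesis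
      unfolding siegel_conv_theta[OF t] z_def[symmetric] by simp
  qed
  then show ?thesis
    using C(1) by (intro that[of "- inverse C * ee (t / 12)"]) auto
qed

text \<open>\<open>a\<close> and \<open>1 - a\<close> exchange the two halves of
  \<open>theta\<close> and give the same \<open>a\<^sup>2 - a\<close>. This evenness is why
  characters of \<open>(\<int>/l)\<^sup>\<times>/{1,-1}\<close> suffice for relations between Siegel
  functions.\<close>

lemma siegel_one_minus:
  assumes "Im t > 0"
  shows "siegel (1 - a) t = siegel a t"
  unfolding siegel_conv_theta[OF assms] theta_def
  by (simp add: algebra_simps power2_eq_square)

text \<open>The shift by \<open>t\<close> leaves out the factor \<open>1 - ee a\<close>, which does
  not move with \<open>t\<close>. All other factors tend to 1, and
  \<open>|prod (1 + f) - 1| \<le> exp (sum |f|) - 1\<close> bounds the error in terms of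
  \<open>Im t\<close> alone, as convergence along horoballs demands.\<close>

lemma norm_half_theta_minus_one_le:
  assumes t: "Im t > 0"
  defines "r \<equiv> exp (- 2 * pi * Im t)"
  shows "norm (half_theta t (t + of_real a) - 1) \<le> exp (r / (1 - r)) - 1"
proof -
  define f where "f = (\<lambda>n. - ee (of_nat n * t + (t + of_real a)))"
  have r: "0 < r" "r < 1" using t by (auto simp: r_def)
  have nf: "norm (f n) = r * r ^ n" for n
    unfolding f_def norm_minus_cancel norm_ee_of_nat_mult_add[OF t] by (simp add: r_def)
  have "(\<lambda>n. \<Prod>i\<le>n. 1 + f i) \<longlonglongrightarrow> half_theta t (t + of_real a)"
    using convergent_prod_LIMSEQ[OF convergent_prod_half_theta[OF t, of "t + of_real a"]]
    by (simp add: f_def half_theta_def)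
  then have "(\<lambda>n. norm ((\<Prod>i\<le>n. 1 + f i) - 1)) \<longlonglongrightarrow> norm (half_theta t (t + of_real a) - 1)"
    by (intro tendsto_intros)
  moreover have "norm ((\<Prod>i\<le>n. 1 + f i) - 1) \<le> exp (r / (1 - r)) - 1" for n
  proof -
    have "norm ((\<Prod>i\<le>n. 1 + f i) - 1) \<le> (\<Prod>i\<le>n. 1 + norm (f i)) - 1"
      by (rule norm_prod_minus1_le_prod_minus1)
    also have "(\<Prod>i\<le>n. 1 + norm (f i)) \<le> (\<Prod>i\<le>n. exp (norm (f i)))"
      by (intro prod_mono) (auto intro: add_nonneg_nonneg)
    also have "\<dots> = exp (\<Sum>i\<le>n. norm (f i))"
      by (simp add: exp_sum)
    also have "(\<Sum>i\<le>n. norm (f i)) \<le> (\<Sum>i. norm (f i))"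
      unfolding nf using r by (intro sum_le_suminf summable_mult summable_geometric) auto
    also have "(\<Sum>i. norm (f i)) = r / (1 - r)"
      unfolding nf using r by (simp add: suminf_mult suminf_geometric summable_geometric)
    finally show ?thesis by simp
  qed
  ultimately show ?thesis
    by (intro LIMSEQ_le_const2) auto
qed

lemma half_theta_tendsto_1:
  "((\<lambda>t. half_theta t (t + of_real a)) \<longlongrightarrow> 1) (filtercomap Im at_top)"
proof -
  have "((\<lambda>y. exp (exp (- 2 * pi * y) / (1 - exp (- 2 * pi * y))) - 1) \<longlongrightarrow> 0) at_top"
    by real_asymp
  then have "((\<lambda>t. exp (exp (- 2 * pi * Im t) / (1 - exp (- 2 * pi * Im t))) - 1) \<longlongrightarrow> 0) (filtercomap Im at_top)"
    by (rule filterlim_compose) (rule filterlim_filtercomap)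
  moreover have "\<forall>\<^sub>F t in filtercomap Im at_top.
      norm (half_theta t (t + of_real a) - 1) \<le> exp (exp (- 2 * pi * Im t) / (1 - exp (- 2 * pi * Im t))) - 1"
    by (rule eventually_mono[OF eventually_filtercomapI[OF eventually_gt_at_top[of 0]]])
       (rule norm_half_theta_minus_one_le)
  ultimately have "((\<lambda>t. half_theta t (t + of_real a) - 1) \<longlongrightarrow> 0) (filtercomap Im at_top)"
    by (rule Lim_null_comparison[rotated])
  then show ?thesis by (simp add: LIM_zero_iff)
qed

lemma theta_tendsto:
  "((\<lambda>t. theta t (of_real a)) \<longlongrightarrow> 1 - ee (of_real a)) (filtercomap Im at_top)"
proof -
  have "((\<lambda>t. (1 - ee (of_real a)) * half_theta t (t + of_real a) * half_theta t (t + of_real (- a))) \<longlongrightarrow>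
      (1 - ee (of_real a)) * 1 * 1) (filtercomap Im at_top)"
    by (intro tendsto_mult tendsto_const half_theta_tendsto_1)
  moreover have "\<forall>\<^sub>F t in filtercomap Im at_top.
      (1 - ee (of_real a)) * half_theta t (t + of_real a) * half_theta t (t + of_real (- a)) = theta t (of_real a)"
    by (rule eventually_mono[OF eventually_filtercomapI[OF eventually_gt_at_top[of 0]]])
       (simp add: theta_def half_theta_rec[of _ "of_real a"] add_ac)
  ultimately show ?thesis
    by (simp add: tendsto_cong)
qed

section \<open>Limits at the cusp 0\<close>

lemma Im_minus_inverse: "Im (- 1 / z) = Im z / (norm z)\<^sup>2"
  by (simp add: Im_divide cmod_power2)

lemma eventually_at_cusp_zero_Im_pos: "\<forall>\<^sub>F t in at_cusp_zero. Im t > 0"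
proof -
  have "\<forall>\<^sub>F t in at_cusp_zero. Im (- 1 / t) > 0"
    unfolding at_cusp_zero_def by (intro eventually_filtercomapI eventually_gt_at_top)
  then show ?thesis
    by (rule eventually_mono) (unfold Im_minus_inverse, auto simp: zero_less_divide_iff)
qed

text \<open>Makes limits at the cusp unique, so that a relation between functions passes to their
  values.\<close>

lemma at_cusp_zero_neq_bot: "at_cusp_zero \<noteq> bot"
proof -
  \<comment> \<open>For \<open>y = 0\<close> the witness is 0, and
    \<open>- 1 / 0 = 0\<close>.\<close>
  have "\<exists>t. y = Im (- 1 / t)" for y :: real
    by (rule exI[of _ "Complex 0 (1 / y)"]) (simp add: Im_divide power2_eq_square)
  then have "surj (\<lambda>t. Im (- 1 / t))"
    unfolding surj_def by blast
  then show ?thesis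
    unfolding at_cusp_zero_def by (rule filtercomap_neq_bot_surj[rotated]) simp
qed

lemma filterlim_cusp_scaled:
  assumes "l > 0"
  shows "filterlim (\<lambda>t. - 1 / (of_nat l * t)) (filtercomap Im at_top) at_cusp_zero"
proof -
  have eq: "Im (- 1 / (of_nat l * t)) = Im (- 1 / t) / real l" for t
    unfolding Im_minus_inverse using assms by (simp add: norm_mult power_mult_distrib power2_eq_square)
  have "filterlim (\<lambda>t. Im (- 1 / t)) at_top at_cusp_zero"
    unfolding at_cusp_zero_def by (rule filterlim_filtercomap)
  then have "filterlim (\<lambda>t. Im (- 1 / t) / real l) at_top at_cusp_zero"
    using assms filterlim_tendsto_pos_mult_at_top[OF tendsto_const, of "1 / real l" "\<lambda>t. Im (- 1 / t)" at_cusp_zero]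
    by simp
  then have "filterlim (\<lambda>t. Im (- 1 / (of_nat l * t))) at_top at_cusp_zero"
    by (simp only: eq)
  then show ?thesis
    by (simp add: filterlim_filtercomap_iff o_def)
qed

text \<open>The common constant cancels, and the phases \<open>ee (- a / 2)\<close> and
  \<open>ee (- b / 2)\<close> leave \<open>ee ((b - a) / 2)\<close>. For \<open>a = 2 j / l\<close>
  and \<open>b = j / l\<close> this is the power \<open>- j / 2\<close> of the root of unity. The
  condition on \<open>b\<close> keeps the limit of the denominator away from 0.\<close>

lemma siegel_quotient_tendsto:
  assumes "l > 0" and b: "b \<notin> \<int>"
  shows "((\<lambda>t. siegel a (of_nat l * t) / siegel b (of_nat l * t)) \<longlongrightarrow>
     ee (of_real ((b - a) / 2)) * ((1 - ee (of_real a)) / (1 - ee (of_real b)))) at_cusp_zero"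
proof -
  define s :: "complex \<Rightarrow> complex" where "s = (\<lambda>t. - 1 / (of_nat l * t))"
  have lim: "((\<lambda>t. theta (s t) (of_real x)) \<longlongrightarrow> 1 - ee (of_real x)) at_cusp_zero" for x
    unfolding s_def by (rule filterlim_compose[OF theta_tendsto filterlim_cusp_scaled[OF \<open>l > 0\<close>]])
  have "1 - ee (of_real b) \<noteq> 0"
    using b ee_of_real_eq_1_iff[of b] by auto
  then have "((\<lambda>t. ee (of_real ((b - a) / 2)) * (theta (s t) (of_real a) / theta (s t) (of_real b))) \<longlongrightarrow>
     ee (of_real ((b - a) / 2)) * ((1 - ee (of_real a)) / (1 - ee (of_real b)))) at_cusp_zero"
    by (intro tendsto_mult tendsto_const tendsto_divide lim)
  moreover have "\<forall>\<^sub>F t in at_cusp_zero. ee (of_real ((b - a) / 2)) * (theta (s t) (of_real a) / theta (s t) (of_real b))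
      = siegel a (of_nat l * t) / siegel b (of_nat l * t)"
    using eventually_at_cusp_zero_Im_pos
  proof eventually_elim
    case (elim t)
    then have "Im (of_nat l * t) > 0" using \<open>l > 0\<close> by simp
    then obtain C where C: "C \<noteq> 0"
      "\<And>a. siegel a (of_nat l * t) = C * (ee (- of_real a / 2) * theta (s t) (of_real a))"
      using siegel_transformation unfolding s_def by blast
    have "ee (of_real ((b - a) / 2)) = ee (- of_real a / 2) / ee (- of_real b / 2)"
      unfolding ee_diff[symmetric] by (rule arg_cong[of _ _ ee]) (simp add: field_simps)
    with C show ?case by simp
  qed
  ultimately show ?thesis by (rule Lim_transform_eventually)
qed

lemma of_nat_divide_notin_Ints:
  assumes "0 < j" "j < l"
  shows "real j / real l \<notin> \<int>"
proof
  assume "real j / real l \<in> \<int>"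
  then obtain i where i: "real j / real l = of_int i" by (auto simp: Ints_def)
  have "0 < real j / real l" "real j / real l < 1" using assms by auto
  then show False unfolding i by simp
qed

lemma zeta_pow_of_nat_neq_1:
  assumes "0 < j" "j < l"
  shows "zeta_pow l (real j) \<noteq> 1"
  using of_nat_divide_notin_Ints[OF assms]
  unfolding zeta_pow_conv_ee ee_of_real_eq_1_iff .

lemma s_fun_tendsto:
  assumes "m < l"
  shows "(s_fun l m \<longlongrightarrow> s_value l m) at_cusp_zero"
proof -
  have "((\<lambda>t. \<Prod>j=1..m. siegel (2 * real j / real l) (of_nat l * t) / siegel (real j / real l) (of_nat l * t)) \<longlongrightarrow>
    (\<Prod>j=1..m. ee (of_real ((real j / real l - 2 * real j / real l) / 2)) *
      ((1 - ee (of_real (2 * real j / real l))) / (1 - ee (of_real (real j / real l)))))) at_cusp_zero"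
    using assms by (intro tendsto_prod siegel_quotient_tendsto of_nat_divide_notin_Ints) auto
  also have "(\<lambda>t. \<Prod>j=1..m. siegel (2 * real j / real l) (of_nat l * t) / siegel (real j / real l) (of_nat l * t)) = s_fun l m"
    by (simp add: s_fun_def fun_eq_iff)
  also have "(\<Prod>j=1..m. ee (of_real ((real j / real l - 2 * real j / real l) / 2)) *
      ((1 - ee (of_real (2 * real j / real l))) / (1 - ee (of_real (real j / real l))))) = s_value l m"
    unfolding s_value_def zeta_pow_conv_ee by (intro prod.cong refl) (simp add: field_simps)
  finally show ?thesis .
qed

section \<open>Membership in the cyclotomic unit group\<close>

lemma zeta_pow_add: "zeta_pow l (x + y) = zeta_pow l x * zeta_pow l y"
  by (simp add: zeta_pow_conv_ee add_divide_distrib ee_add)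

lemma zeta_pow_nonzero [simp]: "zeta_pow l x \<noteq> 0"
  by (simp add: zeta_pow_conv_ee)

lemma zeta_pow_self: "l > 0 \<Longrightarrow> zeta_pow l (real l) = 1"
  by (simp add: zeta_pow_conv_ee)

lemma zeta_pow_half: "l > 0 \<Longrightarrow> zeta_pow l (real l / 2) = - 1"
  using ee_half by (simp add: zeta_pow_conv_ee)

lemma
  assumes "x \<in> carrier (cyclotomic_unit_group l)" "y \<in> carrier (cyclotomic_unit_group l)"
  shows cyclotomic_unit_group_mult: "x * y \<in> carrier (cyclotomic_unit_group l)"
    and cyclotomic_unit_group_divide: "x / y \<in> carrier (cyclotomic_unit_group l)"
proof -
  interpret comm_group complex_mult_group by (rule comm_group_complex_mult_group)
  interpret U: group "cyclotomic_unit_group l"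
    unfolding cyclotomic_unit_group_def by (rule group_subgroup_generated)
  have mult: "a * b = a \<otimes>\<^bsub>cyclotomic_unit_group l\<^esub> b" for a b
    by (simp add: cyclotomic_unit_group_def complex_mult_group_def)
  show "x * y \<in> carrier (cyclotomic_unit_group l)"
    unfolding mult using assms by (rule U.m_closed)
  have "y * inv\<^bsub>cyclotomic_unit_group l\<^esub> y = 1"
    using U.r_inv[OF assms(2)] unfolding mult[symmetric]
    by (simp add: cyclotomic_unit_group_def complex_mult_group_def)
  then have "x / y = x * inv\<^bsub>cyclotomic_unit_group l\<^esub> y"
    by (metis divide_inverse inverse_unique)
  also have "\<dots> \<in> carrier (cyclotomic_unit_group l)"
    unfolding mult using assms by (intro U.m_closed U.inv_closed)
  finally show "x / y \<in> carrier (cyclotomic_unit_group l)" .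
qed

lemma one_in_cyclotomic_unit_group: "1 \<in> carrier (cyclotomic_unit_group l)"
  by (auto simp: cyclotomic_unit_group_def carrier_subgroup_generated complex_mult_group_def
      intro: generate.one[of complex_mult_group, unfolded complex_mult_group_def, simplified])

lemma cyclotomic_unit_group_prod:
  "(\<And>i. i \<in> I \<Longrightarrow> f i \<in> carrier (cyclotomic_unit_group l)) \<Longrightarrow> prod f I \<in> carrier (cyclotomic_unit_group l)"
  by (induction I rule: infinite_finite_induct)
     (auto intro: one_in_cyclotomic_unit_group cyclotomic_unit_group_mult)

text \<open>The number is \<open>sin (pi v / l) / sin (pi / l)\<close>. Hence it is 1 for
  \<open>v = 1\<close> and does not change when \<open>v\<close> becomes \<open>l - v\<close>, which
  reduces every case to a generator.\<close>

lemma cyclotomic_unit_in_group: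
  assumes "odd l" "0 < v" "v < l"
  shows "zeta_pow l ((1 - real v) / 2) * ((1 - zeta_pow l (real v)) / (1 - zeta_pow l 1))
    \<in> carrier (cyclotomic_unit_group l)" (is "?u v \<in> _")
proof -
  have l: "l > 1" using assms by (cases "l = 1") auto
  have z1: "zeta_pow l 1 \<noteq> 1"
    using zeta_pow_of_nat_neq_1[of 1 l] l by simp
  have small: "?u v \<in> carrier (cyclotomic_unit_group l)" if "0 < v" "2 * v < l" for v
  proof (cases "v = 1")
    case True
    then show ?thesis
      using one_in_cyclotomic_unit_group z1 by (simp add: zeta_pow_conv_ee)
  next
    case False
    have "?u v \<in> carrier complex_mult_group"
      using zeta_pow_of_nat_neq_1[of v l] that z1 by (auto simp: complex_mult_group_def)
    moreover have "1 < v" "real v < real l / 2" using that False by auto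
    ultimately show ?thesis
      unfolding cyclotomic_unit_group_def carrier_subgroup_generated
      by (intro generate.incl) blast
  qed
  show ?thesis
  proof (cases "2 * v < l")
    case True
    then show ?thesis using small assms by blast
  next
    case False
    define w where "w = l - v"
    have w: "0 < w" "2 * w < l" using assms False by (auto simp: w_def) presburger
    have v: "real v = real l - real w" using assms by (simp add: w_def)
    have 1: "zeta_pow l (real v) * zeta_pow l (real w) = 1"
      unfolding zeta_pow_add[symmetric] v using l by (simp add: zeta_pow_self)
    have 2: "zeta_pow l ((1 - real v) / 2) * zeta_pow l (real l / 2) = zeta_pow l ((1 - real w) / 2) * zeta_pow l (real w)"
      unfolding zeta_pow_add[symmetric] v by (simp add: field_simps)
    have 3: "1 - zeta_pow l (real v) = - zeta_pow l (real v) * (1 - zeta_pow l (real w))"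
      using 1 by (simp add: algebra_simps)
    have "zeta_pow l ((1 - real v) / 2) * - zeta_pow l (real v) =
        zeta_pow l ((1 - real w) / 2) * (zeta_pow l (real v) * zeta_pow l (real w))"
    proof -
      have "a * - v = b * (v * w)" if "a * - 1 = b * w" for a b v w :: complex
      proof -
        have "a * - v = (a * - 1) * v" by simp
        then show ?thesis unfolding that by (simp add: mult_ac)
      qed
      then show ?thesis using 2 l by (simp add: zeta_pow_half)
    qed
    then have 4: "zeta_pow l ((1 - real v) / 2) * - zeta_pow l (real v) = zeta_pow l ((1 - real w) / 2)"
      unfolding 1 by simp
    have "?u v = (zeta_pow l ((1 - real v) / 2) * - zeta_pow l (real v)) *
        ((1 - zeta_pow l (real w)) / (1 - zeta_pow l 1))"
      unfolding 3 by simp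
    then have "?u v = ?u w"
      unfolding 4 .
    with small[OF w] show ?thesis by (simp only:)
  qed
qed

text \<open>Each factor is a quotient of the units belonging to \<open>2 * j\<close> and
  \<open>j\<close>, the half-integral exponents matching. As \<open>2 * j\<close> can exceed
  \<open>l / 2\<close>, units with index beyond the generators occur.\<close>

lemma s_value_in_cyclotomic_unit_group:
  assumes "odd l" "2 * m < l"
  shows "s_value l m \<in> carrier (cyclotomic_unit_group l)"
  unfolding s_value_def
proof (rule cyclotomic_unit_group_prod)
  fix j assume j: "j \<in> {1..m}"
  define u where "u = (\<lambda>v. zeta_pow l ((1 - real v) / 2) * ((1 - zeta_pow l (real v)) / (1 - zeta_pow l 1)))"
  have nz: "zeta_pow l (real j) \<noteq> 1" "zeta_pow l 1 \<noteq> 1"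
    using zeta_pow_of_nat_neq_1[of 1 l] zeta_pow_of_nat_neq_1[of j l] assms j by auto
  have *: "zeta_pow l (- real j / 2) * zeta_pow l ((1 - real j) / 2) = zeta_pow l ((1 - real (2 * j)) / 2)"
    unfolding zeta_pow_add[symmetric] by (simp add: add_divide_distrib diff_divide_distrib)
  have "zeta_pow l (- real j / 2) * ((1 - zeta_pow l (2 * real j)) / (1 - zeta_pow l (real j))) = u (2 * j) / u j"
  proof -
    have "p * (x / y) = (q * (x / z)) / (b * (y / z))" if "b \<noteq> 0" "z \<noteq> 0" "p * b = q" for p q b x y z :: complex
      using that by auto
    from this[of "zeta_pow l ((1 - real j) / 2)" "1 - zeta_pow l 1", OF _ _ *] show ?thesis
      unfolding u_def using nz by (simp del: times_divide_eq_right times_divide_eq_left)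
  qed
  moreover have "u (2 * j) / u j \<in> carrier (cyclotomic_unit_group l)"
    unfolding u_def using assms j by (intro cyclotomic_unit_group_divide cyclotomic_unit_in_group) auto
  ultimately show "zeta_pow l (- real j / 2) * ((1 - zeta_pow l (2 * real j)) / (1 - zeta_pow l (real j)))
    \<in> carrier (cyclotomic_unit_group l)" by simp
qed

section \<open>Conjugates of roots of unity\<close>

lemma eisenstein:
  fixes A B :: "int poly" and p :: int
  assumes p: "prime p" and lead: "\<not> p dvd lead_coeff (A * B)"
    and low: "\<And>i. i < degree (A * B) \<Longrightarrow> p dvd Polynomial.coeff (A * B) i" and const: "\<not> p\<^sup>2 dvd Polynomial.coeff (A * B) 0"
  shows "degree A = 0 \<or> degree B = 0"
proof (rule ccontr)
  assume "\<not> ?thesis"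
  then have deg: "degree A > 0" "degree B > 0" by auto
  \<comment> \<open>The lowest coefficient of \<open>A\<close> not divisible by \<open>p\<close>, at
    index \<open>i\<close>, forces \<open>p\<close> to divide \<open>coeff A i * coeff B 0\<close>.
    Since \<open>B\<close> is not constant, \<open>i\<close> stays below the degree of the
    product.\<close>
  have aux: False
    if AB: "\<not> p dvd lead_coeff (A * B)" "\<And>i. i < degree (A * B) \<Longrightarrow> p dvd Polynomial.coeff (A * B) i"
      and A0: "p dvd Polynomial.coeff A 0" and B0: "\<not> p dvd Polynomial.coeff B 0" and B: "degree B > 0" for A B :: "int poly"
  proof -
    have "\<not> p dvd Polynomial.coeff A (degree A)"
      using AB(1) by (auto simp: lead_coeff_mult)
    define i where "i = (LEAST i. \<not> p dvd Polynomial.coeff A i)"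
    have i: "\<not> p dvd Polynomial.coeff A i"
      unfolding i_def by (rule LeastI) fact
    have i_min: "p dvd Polynomial.coeff A j" if "j < i" for j
      using not_less_Least that unfolding i_def by blast
    have "i \<le> degree A"
      unfolding i_def by (rule Least_le) fact
    moreover have "A \<noteq> 0" "B \<noteq> 0" using AB(1) by auto
    ultimately have "p dvd Polynomial.coeff (A * B) i"
      using B by (intro AB(2)) (simp add: degree_mult_eq)
    also have "Polynomial.coeff (A * B) i = (\<Sum>j<i. Polynomial.coeff A j * Polynomial.coeff B (i - j)) + Polynomial.coeff A i * Polynomial.coeff B 0"
      by (simp add: coeff_mult lessThan_Suc_atMost[symmetric])
    finally have "p dvd Polynomial.coeff A i * Polynomial.coeff B 0"
      by (subst (asm) dvd_add_right_iff) (auto intro!: dvd_sum dvd_mult2 i_min)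
    then show False
      using p i B0 by (simp add: prime_dvd_mult_iff)
  qed
  have "p dvd Polynomial.coeff A 0 * Polynomial.coeff B 0"
    using low[of 0] deg const by (cases "A * B = 0") (auto simp: degree_mult_eq coeff_mult)
  moreover have "\<not> (p dvd Polynomial.coeff A 0 \<and> p dvd Polynomial.coeff B 0)"
    using const by (auto simp: power2_eq_square coeff_mult intro: mult_dvd_mono)
  ultimately consider "p dvd Polynomial.coeff A 0" "\<not> p dvd Polynomial.coeff B 0" | "p dvd Polynomial.coeff B 0" "\<not> p dvd Polynomial.coeff A 0"
    using p by (auto simp: prime_dvd_mult_iff)
  then show False
  proof cases
    case 1
    then show False using aux[OF lead low] deg by blast
  next
    case 2
    then show False using aux[of B A] lead low deg by (simp add: mult.commute)
  qed
qed

section \<open>Integer polynomials at complex points\<close>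

definition eval_int_poly :: "complex \<Rightarrow> int poly \<Rightarrow> complex" where
  "eval_int_poly z P = poly (map_poly of_int P) z"

lemma eval_int_poly_0 [simp]: "eval_int_poly z 0 = 0"
  by (simp add: eval_int_poly_def)

lemma eval_int_poly_pCons [simp]: "eval_int_poly z (pCons a P) = of_int a + z * eval_int_poly z P"
  by (simp add: eval_int_poly_def map_poly_pCons)

lemma eval_int_poly_1 [simp]: "eval_int_poly z 1 = 1"
  by (simp add: one_pCons)

lemma eval_int_poly_add [simp]: "eval_int_poly z (P + Q) = eval_int_poly z P + eval_int_poly z Q"
  by (induction P Q rule: poly_induct2) (simp_all add: algebra_simps)

lemma eval_int_poly_uminus [simp]: "eval_int_poly z (- P) = - eval_int_poly z P"
  by (induction P) (simp_all add: algebra_simps)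

lemma eval_int_poly_diff [simp]: "eval_int_poly z (P - Q) = eval_int_poly z P - eval_int_poly z Q"
  using eval_int_poly_add[of z P "- Q"] by (simp del: eval_int_poly_add)

lemma eval_int_poly_smult [simp]: "eval_int_poly z (Polynomial.smult c P) = of_int c * eval_int_poly z P"
  by (induction P) (simp_all add: algebra_simps)

lemma eval_int_poly_mult [simp]: "eval_int_poly z (P * Q) = eval_int_poly z P * eval_int_poly z Q"
  by (induction P) (simp_all add: algebra_simps)

lemma eval_int_poly_power [simp]: "eval_int_poly z (P ^ n) = eval_int_poly z P ^ n"
  by (induction n) simp_all

lemma eval_int_poly_prod [simp]: "eval_int_poly z (prod f I) = (\<Prod>i\<in>I. eval_int_poly z (f i))"
  by (induction I rule: infinite_finite_induct) simp_all

lemma eval_int_poly_sum [simp]: "eval_int_poly z (sum f I) = (\<Sum>i\<in>I. eval_int_poly z (f i))"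
  by (induction I rule: infinite_finite_induct) simp_all

lemma eval_int_poly_monom [simp]: "eval_int_poly z (Polynomial.monom c n) = of_int c * z ^ n"
  by (induction n) (simp_all add: monom_0 monom_Suc)

lemma eval_int_poly_pcompose [simp]: "eval_int_poly z (pcompose P Q) = eval_int_poly (eval_int_poly z Q) P"
  by (induction P) (simp_all add: pcompose_pCons)

text \<open>A nonzero integer polynomial \<open>M\<close> of least degree with root \<open>z\<close>
  acts as minimal polynomial: by pseudo-division it divides a multiple of every polynomial that
  vanishes at \<open>z\<close>. Gauss's lemma on primitive parts turns \<open>c F = M Q\<close> into
  a factorisation of \<open>F\<close> itself, so \<open>Q\<close> is constant and \<open>w\<close>
  is a root of \<open>M\<close>.\<close>

lemma conjugate_root_of_irreducible:
  assumes irred: "\<And>A B. F = A * B \<Longrightarrow> degree A = 0 \<or> degree B = 0" and F: "F \<noteq> 0"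
    and roots: "eval_int_poly z F = 0" "eval_int_poly w F = 0" and P: "eval_int_poly z P = 0"
  shows "eval_int_poly w P = 0"
proof -
  define root where "root = (\<lambda>M. M \<noteq> 0 \<and> eval_int_poly z M = 0)"
  have "root F" using F roots by (simp add: root_def)
  define M where "M = arg_min degree root"
  have M: "root M"
    unfolding M_def by (rule arg_min_natI) fact
  have min: "degree M \<le> degree N" if "root N" for N
    unfolding M_def using that by (rule arg_min_nat_le)
  have dvd: "\<exists>c Q. c \<noteq> 0 \<and> Polynomial.smult c N = M * Q" if "eval_int_poly z N = 0" for N
  proof -
    obtain Q R where QR: "pseudo_divmod N M = (Q, R)" by force
    define c where "c = Polynomial.coeff M (degree M) ^ (Suc (degree N) - degree M)"
    have *: "Polynomial.smult c N = M * Q + R" "R = 0 \<or> degree R < degree M"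
      using pseudo_divmod[OF _ QR] M by (auto simp: c_def root_def)
    have "eval_int_poly z (Polynomial.smult c N) = eval_int_poly z (M * Q + R)"
      unfolding *(1) ..
    then have "eval_int_poly z R = 0"
      using M that by (simp add: root_def)
    with *(2) have "R = 0"
      using min[of R] by (fastforce simp: root_def)
    moreover have "c \<noteq> 0"
      using M by (simp add: c_def root_def)
    ultimately show ?thesis using * by auto
  qed
  obtain c Q where cQ: "c \<noteq> 0" "Polynomial.smult c F = M * Q"
    using dvd roots by blast
  have "primitive_part (Polynomial.smult c F) = primitive_part M * primitive_part Q"
    unfolding cQ by (rule primitive_part_mult)
  then have "[:unit_factor c:] * primitive_part F = primitive_part M * primitive_part Q"
    by (simp add: primitive_part_smult)
  then have "Polynomial.smult (unit_factor c * unit_factor c) (primitive_part F) =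
      Polynomial.smult (unit_factor c) (primitive_part M * primitive_part Q)"
    by (metis mult_smult_left smult_smult smult_1_left mult.commute mult_pCons_left add.right_neutral pCons_0_0 mult_zero_left)
  moreover have "unit_factor c * unit_factor c = 1"
    using cQ(1) by (cases "c > 0") auto
  ultimately have "primitive_part F = Polynomial.smult (unit_factor c) (primitive_part M * primitive_part Q)"
    by simp
  then have "F = Polynomial.smult (content F * unit_factor c) (primitive_part M) * primitive_part Q"
    by (metis content_times_primitive_part smult_smult mult_smult_left)
  from irred[OF this] have "degree M = 0 \<or> degree Q = 0"
    using cQ(1) F by (auto simp: sgn_0_0 split: if_splits)
  moreover have "degree M \<noteq> 0"
  proof
    assume "degree M = 0"
    then obtain m where "M = [:m:]" by (rule degree_eq_zeroE)
    then show False using M by (simp add: root_def)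
  qed
  ultimately obtain q where q: "Q = [:q:]" by (meson degree_eq_zeroE)
  have "eval_int_poly w (Polynomial.smult c F) = eval_int_poly w (M * Q)"
    unfolding cQ ..
  moreover have "q \<noteq> 0" using cQ F q by auto
  ultimately have Mw: "eval_int_poly w M = 0"
    using roots by (simp add: q)
  obtain d N where d: "d \<noteq> 0" "Polynomial.smult d P = M * N"
    using dvd P by blast
  have "eval_int_poly w (Polynomial.smult d P) = eval_int_poly w (M * N)"
    unfolding d ..
  then show ?thesis using Mw d(1) by simp
qed

lemma conjugate_root_of_unity:
  assumes l: "prime l" and z: "z ^ l = 1" "z \<noteq> 1" and w: "w ^ l = 1" "w \<noteq> 1"
    and P: "eval_int_poly z P = 0"
  shows "eval_int_poly w P = 0"
proof -
  \<comment> \<open>This is \<open>((X + 1)^l - 1) / X\<close>, the cyclotomic polynomial at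
    \<open>X + 1\<close>; the shift puts it in Eisenstein form with constant coefficient
    \<open>l\<close>.\<close>
  define F :: "int poly" where "F = (\<Sum>i<l. Polynomial.monom (int (l choose Suc i)) i)"
  have l1: "l > 1" using l by (rule prime_gt_1_nat)
  have coeff: "Polynomial.coeff F i = (if i < l then int (l choose Suc i) else 0)" for i
    by (simp add: F_def coeff_sum sum.delta)
  have deg: "degree F = l - 1"
    using l1 by (intro order_antisym degree_le le_degree) (auto simp: coeff)
  have root: "eval_int_poly (x - 1) F = 0" if "x ^ l = 1" "x \<noteq> 1" for x
  proof -
    have "(x - 1) * eval_int_poly (x - 1) F = (\<Sum>i<l. of_nat (l choose Suc i) * (x - 1) ^ Suc i)"
      by (simp add: F_def sum_distrib_left mult_ac)
    also have "\<dots> = (\<Sum>i\<le>l. of_nat (l choose i) * (x - 1) ^ i) - 1"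
      by (simp add: sum.lessThan_Suc_shift lessThan_Suc_atMost[symmetric] del: sum.lessThan_Suc)
    also have "(\<Sum>i\<le>l. of_nat (l choose i) * (x - 1) ^ i) = ((x - 1) + 1) ^ l"
      by (subst binomial_ring) simp
    finally show ?thesis using that by simp
  qed
  have "degree A = 0 \<or> degree B = 0" if "F = A * B" for A B
  proof (rule eisenstein[of "int l"], unfold that[symmetric])
    show "prime (int l)" using l by simp
    show "\<not> int l dvd lead_coeff F" using l1 by (simp add: deg coeff)
    show "int l dvd Polynomial.coeff F i" if "i < degree F" for i
      using that l l1 dvd_choose_prime[of "Suc i" l] by (simp add: deg coeff)
    show "\<not> (int l)\<^sup>2 dvd Polynomial.coeff F 0"
    proof
      assume "(int l)\<^sup>2 dvd Polynomial.coeff F 0"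
      then have "int (l * l) dvd int (l * 1)" using l1 by (simp add: coeff power2_eq_square)
      then have "l * l dvd l * 1" by (simp only: int_dvd_int_iff)
      then have "l * l \<le> l" using l1 by (auto dest!: dvd_imp_le)
      then show False using l1 by simp
    qed
  qed
  moreover have "F \<noteq> 0" using deg l1 by auto
  ultimately have "eval_int_poly (w - 1) (pcompose P [:1, 1:]) = 0"
    using conjugate_root_of_irreducible[OF _ _ root[OF z] root[OF w], of "pcompose P [:1, 1:]"] P by simp
  then show ?thesis by simp
qed

section \<open>Dirichlet characters modulo a prime\<close>

lemma sum_mult_by_parts:
  fixes a :: "nat \<Rightarrow> complex" and b :: "nat \<Rightarrow> real"
  shows "(\<Sum>n<N. a n * of_real (b n)) =
    (\<Sum>n<N. sum a {..<Suc n} * of_real (b n - b (Suc n))) + sum a {..<N} * of_real (b N)"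
  by (induction N) (simp_all add: algebra_simps)

lemma norm_sum_mult_le_Abel:
  fixes a :: "nat \<Rightarrow> complex" and b :: "nat \<Rightarrow> real"
  assumes A: "\<And>N. norm (sum a {..<N}) \<le> C" and dec: "decseq b" and pos: "\<And>n. b n \<ge> 0"
  shows "norm (\<Sum>n<N. a n * of_real (b n)) \<le> C * b 0"
proof -
  have C: "C \<ge> 0" using A[of 0] by simp
  have "norm (\<Sum>n<N. a n * of_real (b n)) \<le>
      (\<Sum>n<N. norm (sum a {..<Suc n} * of_real (b n - b (Suc n)))) + norm (sum a {..<N} * of_real (b N))"
    by (subst sum_mult_by_parts) (intro norm_triangle_le add_right_mono norm_sum)
  also have "\<dots> \<le> (\<Sum>n<N. C * (b n - b (Suc n))) + C * b N"
    unfolding norm_mult norm_of_real using dec pos A C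
    by (intro add_mono sum_mono mult_mono) (auto simp: decseq_Suc_iff simp del: sum.lessThan_Suc)
  also have "\<dots> = C * b 0"
    unfolding sum_distrib_left[symmetric] sum_lessThan_telescope' by (simp add: algebra_simps)
  finally show ?thesis .
qed

lemma
  fixes a :: "nat \<Rightarrow> complex" and b :: "nat \<Rightarrow> real"
  assumes A: "\<And>N. norm (sum a {..<N}) \<le> C" and dec: "decseq b" and lim: "b \<longlonglongrightarrow> 0"
  shows Dirichlet_summable: "summable (\<lambda>n. a n * of_real (b n))"
    and Dirichlet_tail: "norm ((\<Sum>n. a n * of_real (b n)) - (\<Sum>n<M. a n * of_real (b n))) \<le> 2 * C * b M"
proof -
  have pos: "b n \<ge> 0" for n
    using decseq_ge[OF dec lim] .
  have C: "C \<ge> 0" using A[of 0] by simp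
  have tail: "norm (sum (\<lambda>n. a n * of_real (b n)) {M..<M + N}) \<le> 2 * C * b M" for M N
  proof -
    have shift: "sum f {M..<M + N} = (\<Sum>n<N. f (n + M))" for f :: "nat \<Rightarrow> complex" and N
      using sum.shift_bounds_nat_ivl[of f 0 M N] by (simp add: add.commute atLeast0LessThan)
    have "norm (\<Sum>n<N. a (n + M) * of_real (b (n + M))) \<le> 2 * C * b (0 + M)"
    proof (rule norm_sum_mult_le_Abel)
      \<comment> \<open>A block is the difference of two initial sums, hence the factor 2.\<close>
      show "norm (\<Sum>n<N. a (n + M)) \<le> 2 * C" for N
      proof -
        have "sum a {..<M + N} = sum a {..<M} + sum a {M..<M + N}"
          by (simp add: atLeast0LessThan[symmetric] sum.atLeastLessThan_concat)
        then have "norm (sum a {M..<M + N}) \<le> norm (sum a {..<M + N}) + norm (sum a {..<M})"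
          by (metis add_diff_cancel_left' norm_triangle_ineq4)
        also have "\<dots> \<le> C + C" by (intro add_mono A)
        finally show ?thesis by (simp add: shift)
      qed
      show "decseq (\<lambda>n. b (n + M))"
        using dec by (auto simp: decseq_Suc_iff)
    qed (rule pos)
    then show ?thesis by (simp add: shift)
  qed
  show summable: "summable (\<lambda>n. a n * of_real (b n))"
    unfolding summable_Cauchy
  proof safe
    fix e :: real assume "e > 0"
    then have "\<forall>\<^sub>F M in sequentially. b M < e / (2 * C + 1)"
      using C lim by (intro order_tendstoD(2)[OF lim]) auto
    then obtain K where K: "\<And>M. M \<ge> K \<Longrightarrow> b M < e / (2 * C + 1)"
      by (auto simp: eventually_sequentially)
    have "norm (sum (\<lambda>n. a n * of_real (b n)) {M..<N}) < e" if "M \<ge> K" for M N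
    proof (cases "M \<le> N")
      case True
      then have "norm (sum (\<lambda>n. a n * of_real (b n)) {M..<N}) \<le> 2 * C * b M"
        using tail[of M "N - M"] by simp
      also have "\<dots> \<le> 2 * C * (e / (2 * C + 1))"
        using K[OF that] C by (intro mult_left_mono) auto
      also have "\<dots> < e"
        using C \<open>e > 0\<close> by (simp add: field_simps)
      finally show ?thesis .
    qed (use \<open>e > 0\<close> in auto)
    then show "\<exists>K. \<forall>M\<ge>K. \<forall>N. norm (sum (\<lambda>n. a n * of_real (b n)) {M..<N}) < e" by blast
  qed
  have "(\<lambda>N. norm ((\<Sum>n<N. a n * of_real (b n)) - (\<Sum>n<M. a n * of_real (b n)))) \<longlonglongrightarrow>
      norm ((\<Sum>n. a n * of_real (b n)) - (\<Sum>n<M. a n * of_real (b n)))"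
    by (intro tendsto_intros summable_LIMSEQ summable)
  moreover have "norm ((\<Sum>n<N. a n * of_real (b n)) - (\<Sum>n<M. a n * of_real (b n))) \<le> 2 * C * b M" if "N \<ge> M" for N
    using tail[of M "N - M"] that
    by (simp add: atLeast0LessThan[symmetric] sum_diff_nat_ivl)
  ultimately show "norm ((\<Sum>n. a n * of_real (b n)) - (\<Sum>n<M. a n * of_real (b n))) \<le> 2 * C * b M"
    by (intro LIMSEQ_le_const2) auto
qed

section \<open>Characters and the value at \<open>s = 1\<close>\<close>

locale dirichlet_char =
  fixes l :: nat and \<psi> :: "nat \<Rightarrow> complex"
  assumes prime_l: "prime l" and mult: "\<psi> (m * n) = \<psi> m * \<psi> n"
    and periodic: "\<psi> (n + l) = \<psi> n" and eq_0_iff: "\<psi> n = 0 \<longleftrightarrow> l dvd n"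
begin

lemma l_gt_1: "l > 1"
  using prime_l by (rule prime_gt_1_nat)

lemma chi_1 [simp]: "\<psi> (Suc 0) = 1"
  using mult[of 1 1] eq_0_iff[of 1] l_gt_1 by auto

lemma chi_0 [simp]: "\<psi> 0 = 0"
  by (simp add: eq_0_iff)

lemma chi_power: "\<psi> (n ^ i) = \<psi> n ^ i"
  by (induction i) (simp_all add: mult)

lemma chi_add_mult: "\<psi> (n + i * l) = \<psi> n"
  by (induction i) (simp_all add: periodic[of "n + _ * l", symmetric] add_ac)

lemma chi_mod: "\<psi> (n mod l) = \<psi> n"
  using chi_add_mult[of "n mod l" "n div l"] by (simp add: add.commute)

lemma chi_cong: "[m = n] (mod l) \<Longrightarrow> \<psi> m = \<psi> n"
  by (metis chi_mod cong_def)

lemma norm_chi: "norm (\<psi> n) = (if l dvd n then 0 else 1)"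
proof (cases "l dvd n")
  case False
  then have "[n ^ (l - 1) = 1] (mod l)"
    using fermat_theorem prime_l by blast
  then have "\<psi> n ^ (l - 1) = 1"
    by (metis chi_cong chi_power chi_1 One_nat_def)
  then have "norm (\<psi> n) ^ (l - 1) = 1"
    by (metis norm_power norm_one)
  then show ?thesis
    using False l_gt_1 power_eq_imp_eq_base[of "norm (\<psi> n)" "l - 1" 1] by simp
qed (use eq_0_iff in auto)

lemma norm_chi_le: "norm (\<psi> n) \<le> 1"
  by (simp add: norm_chi)

lemma mult_cnj: "\<not> l dvd n \<Longrightarrow> \<psi> n * cnj (\<psi> n) = 1"
  using norm_chi[of n] by (simp add: complex_norm_square[symmetric])

lemma dirichlet_char_cnj: "dirichlet_char l (\<lambda>n. cnj (\<psi> n))"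
  by unfold_locales (simp_all add: prime_l mult periodic eq_0_iff)

lemma sum_mult_argument:
  assumes "\<not> l dvd a" and h: "\<And>n. h (n mod l) = h n"
  shows "(\<Sum>n<l. h (a * n)) = (\<Sum>n<l. h n :: complex)"
proof -
  have "coprime a l"
    using assms(1) prime_l by (metis prime_imp_coprime coprime_commute)
  then have inj: "inj_on (\<lambda>n. a * n mod l) {..<l}"
    by (auto simp: inj_on_def cong_def[symmetric] cong_mult_lcancel_nat cong_less_modulus_unique_nat)
  moreover have "(\<lambda>n. a * n mod l) ` {..<l} \<subseteq> {..<l}"
    using l_gt_1 by auto
  ultimately have "(\<lambda>n. a * n mod l) ` {..<l} = {..<l}"
    by (intro endo_inj_surj) auto
  then have "(\<Sum>n<l. h n) = (\<Sum>n<l. h (a * n mod l))"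
    using inj by (metis sum.reindex_cong)
  then show ?thesis by (simp add: h)
qed

end

locale nontrivial_dirichlet_char = dirichlet_char +
  assumes nontrivial: "\<exists>a. \<not> l dvd a \<and> \<psi> a \<noteq> 1"
begin

lemma nontrivial_dirichlet_char_cnj: "nontrivial_dirichlet_char l (\<lambda>n. cnj (\<psi> n))"
proof -
  interpret c: dirichlet_char l "\<lambda>n. cnj (\<psi> n)" by (rule dirichlet_char_cnj)
  show ?thesis using nontrivial by unfold_locales (auto simp: complex_eq_iff)
qed

lemma sum_period: "(\<Sum>n<l. \<psi> n) = 0"
proof -
  obtain a where a: "\<not> l dvd a" "\<psi> a \<noteq> 1" using nontrivial by blast
  have "(\<Sum>n<l. \<psi> (a * n)) = (\<Sum>n<l. \<psi> n)"
    using a(1) by (rule sum_mult_argument) (rule chi_mod)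
  then have "\<psi> a * (\<Sum>n<l. \<psi> n) = (\<Sum>n<l. \<psi> n)"
    by (simp add: mult sum_distrib_left)
  then show ?thesis using a by simp
qed

lemma norm_sum_le: "norm (\<Sum>n<N. \<psi> (Suc n)) \<le> l"
proof -
  have mod: "(\<Sum>n<N. \<psi> n) = (\<Sum>n<N mod l. \<psi> n)" for N
  proof -
    have "(\<Sum>n<r + i * l. \<psi> n) = (\<Sum>n<r. \<psi> n)" if "r < l" for r i
    proof -
      have "(\<Sum>n<r + i * l. \<psi> n) = (\<Sum>n<i * l. \<psi> n) + (\<Sum>n<r. \<psi> (n + i * l))"
        using sum.shift_bounds_nat_ivl[of \<psi> 0 "i * l" r] sum.atLeastLessThan_concat[of 0 "i * l" "r + i * l" \<psi>]
        by (simp add: atLeast0LessThan)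
      moreover have "(\<Sum>n<i * l. \<psi> n) = 0"
      proof (induction i)
        case (Suc i)
        have "(\<Sum>n<Suc i * l. \<psi> n) = (\<Sum>n<i * l. \<psi> n) + (\<Sum>n<l. \<psi> (n + i * l))"
          using sum.shift_bounds_nat_ivl[of \<psi> 0 "i * l" l] sum.atLeastLessThan_concat[of 0 "i * l" "l + i * l" \<psi>]
          by (simp add: atLeast0LessThan)
        then show ?case using Suc by (simp add: chi_add_mult sum_period)
      qed simp
      ultimately show ?thesis by (simp add: chi_add_mult)
    qed
    from this[of "N mod l" "N div l"] show ?thesis using l_gt_1 by simp
  qed
  have "(\<Sum>n<N. \<psi> (Suc n)) = (\<Sum>n<Suc N. \<psi> n)"
    by (subst sum.lessThan_Suc_shift) simp
  also have "\<dots> = (\<Sum>n<Suc N mod l. \<psi> n)" by (rule mod)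
  also have "norm \<dots> \<le> (\<Sum>n<Suc N mod l. 1)"
    by (rule order.trans[OF norm_sum], intro sum_mono norm_chi_le)
  also have "\<dots> \<le> l"
    using l_gt_1 by (simp add: mod_less_divisor less_imp_le)
  finally show ?thesis by simp
qed

text \<open>The series converges only conditionally, so it is summed in the order of
  \<open>n\<close>.\<close>

definition L1 :: complex where
  "L1 = (\<Sum>n. \<psi> (Suc n) * of_real (1 / real (Suc n)))"

lemma decseq_inverse_Suc: "decseq (\<lambda>n. 1 / real (Suc n))"
  by (auto simp: decseq_def frac_le)

lemma L1_sums: "(\<lambda>n. \<psi> (Suc n) * of_real (1 / real (Suc n))) sums L1"
  unfolding L1_def
  by (intro summable_sums Dirichlet_summable[OF norm_sum_le decseq_inverse_Suc] lim_1_over_n[THEN LIMSEQ_Suc])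

lemma L1_tail: "norm (L1 - (\<Sum>n<M. \<psi> (Suc n) * of_real (1 / real (Suc n)))) \<le> 2 * l / Suc M"
  unfolding L1_def
  using Dirichlet_tail[OF norm_sum_le decseq_inverse_Suc lim_1_over_n[THEN LIMSEQ_Suc], of M] by simp

end

section \<open>Divisor sums and the Lambert series\<close>

lemma divisor_sum_prime_power:
  fixes f :: "nat \<Rightarrow> real"
  assumes p: "prime p" and M: "\<not> p dvd M" and f: "\<And>m n. f (m * n) = f m * f n" "f 1 = 1"
  shows "(\<Sum>d | d dvd p ^ a * M. f d) = (\<Sum>i\<le>a. f p ^ i) * (\<Sum>d | d dvd M. f d)"
proof -
  have M0: "M > 0" using M by (cases M) auto
  have fp: "f (p ^ i) = f p ^ i" for i
    using f by (induction i) simp_all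
  have "(\<Sum>d | d dvd p ^ a * M. f d) = (\<Sum>(i, e)\<in>{..a} \<times> {e. e dvd M}. f (p ^ i * e))"
  proof (rule sum.reindex_bij_witness[of _ "\<lambda>(i, e). p ^ i * e" "\<lambda>d. (multiplicity p d, d div p ^ multiplicity p d)"])
    fix d assume "d \<in> {d. d dvd p ^ a * M}"
    then have d: "d dvd p ^ a * M" by simp
    then have d0: "d \<noteq> 0" using M0 p by (intro notI) auto
    obtain e where e: "d = p ^ multiplicity p d * e" "\<not> p dvd e"
      using multiplicity_decompose'[of d p] d0 p by (metis not_prime_unit)
    have "multiplicity p d \<le> multiplicity p (p ^ a * M)"
      using d M0 p by (intro dvd_imp_multiplicity_le) (auto simp: prime_gt_0_nat)
    also have "\<dots> = a"
      using p M M0 by (simp add: prime_elem_multiplicity_mult_distrib not_dvd_imp_multiplicity_0)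
    finally have le: "multiplicity p d \<le> a" .
    have "d div p ^ multiplicity p d = e"
      using e(1) p by (metis nonzero_mult_div_cancel_left power_eq_0_iff not_prime_0)
    moreover have "e dvd M"
    proof -
      have "e dvd p ^ a * M" using d e(1) by (metis dvd_mult_right)
      moreover have "coprime e (p ^ a)"
        using e(2) p by (metis coprime_commute coprime_power_right_iff prime_imp_coprime)
      ultimately show ?thesis by (simp add: coprime_dvd_mult_right_iff)
    qed
    ultimately show "(multiplicity p d, d div p ^ multiplicity p d) \<in> {..a} \<times> {e. e dvd M}"
      using le by simp
    show "(case (multiplicity p d, d div p ^ multiplicity p d) of (i, e) \<Rightarrow> p ^ i * e) = d"
      by (simp add: multiplicity_dvd)
    then show "(case (multiplicity p d, d div p ^ multiplicity p d) of (i, e) \<Rightarrow> f (p ^ i * e)) = f d"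
      by simp
  next
    fix b assume "b \<in> {..a} \<times> {e. e dvd M}"
    then obtain i e where b: "b = (i, e)" "i \<le> a" "e dvd M" by auto
    have e: "\<not> p dvd e" "e \<noteq> 0" using b M M0 by auto
    have "multiplicity p (p ^ i * e) = i"
      using p e by (simp add: prime_elem_multiplicity_mult_distrib not_dvd_imp_multiplicity_0)
    then show "(\<lambda>d. (multiplicity p d, d div p ^ multiplicity p d)) (case b of (i, e) \<Rightarrow> p ^ i * e) = b"
      using p by (simp add: b(1))
    show "(case b of (i, e) \<Rightarrow> p ^ i * e) \<in> {d. d dvd p ^ a * M}"
      using b by (auto intro!: mult_dvd_mono le_imp_power_dvd)
  qed
  also have "\<dots> = (\<Sum>i\<le>a. \<Sum>e | e dvd M. f p ^ i * f e)"
    by (simp add: sum.cartesian_product f fp)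
  finally show ?thesis by (simp add: sum_product)
qed

text \<open>The divisor sum is multiplicative, and its factor at a prime power is a finite geometric
  sum with ratio \<open>f p\<close> in \<open>[-1, 1]\<close>, which is nonnegative even for
  negative ratios.\<close>

lemma divisor_sum_nonneg:
  fixes f :: "nat \<Rightarrow> real"
  assumes f: "\<And>m n. f (m * n) = f m * f n" "f 1 = 1" "\<And>n. \<bar>f n\<bar> \<le> 1" and "N > 0"
  shows "(\<Sum>d | d dvd N. f d) \<ge> 0"
  using \<open>N > 0\<close>
proof (induction N rule: less_induct)
  case (less N)
  show ?case
  proof (cases "N = 1")
    case False
    then obtain p where p: "prime p" "p dvd N"
      using prime_factor_nat by blast
    obtain M where M: "N = p ^ multiplicity p N * M" "\<not> p dvd M"
      using multiplicity_decompose'[of N p] less.prems p by (metis neq0_conv not_prime_unit)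
    have "multiplicity p N > 0"
      using p less.prems by (simp add: prime_multiplicity_gt_zero_iff)
    then have "p ^ multiplicity p N > 1"
      using p prime_gt_1_nat by (metis one_less_power)
    moreover have "M > 0" using M by (cases M) auto
    ultimately have "M < N"
      by (subst M(1)) simp
    have "(\<Sum>i\<le>a. f p ^ i) \<ge> 0" for a
    proof (cases "f p \<ge> 0")
      case False
      have "\<bar>f p ^ Suc a\<bar> \<le> 1"
        unfolding power_abs by (intro power_le_one f) auto
      then have "0 \<le> (1 - f p ^ Suc a) / (1 - f p)"
        using False by (intro divide_nonneg_pos) (auto simp: abs_le_iff)
      then show ?thesis
        using False by (simp add: sum_gp0)
    qed (auto intro: sum_nonneg)
    then show ?thesis
      using less.IH[OF \<open>M < N\<close> \<open>M > 0\<close>] divisor_sum_prime_power[OF p(1) M(2) f(1,2)]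
      by (subst M(1)) auto
  qed (use f in auto)
qed

text \<open>The exponents \<open>i\<close> and \<open>n - 1 - i\<close> are paired: every pair has
  geometric mean \<open>y ^ (n - 1)\<close>. Writing the ratio as a square avoids half-integral
  exponents.\<close>

lemma AM_GM_geometric_sum:
  fixes y :: real
  assumes "y \<ge> 0"
  shows "(\<Sum>i<n. (y\<^sup>2) ^ i) \<ge> real n * y ^ (n - 1)"
proof -
  have "2 * (\<Sum>i<n. (y\<^sup>2) ^ i) = (\<Sum>i<n. (y\<^sup>2) ^ i) + (\<Sum>i<n. (y\<^sup>2) ^ (n - Suc i))"
    by (simp only: sum.nat_diff_reindex mult_2)
  also have "\<dots> = (\<Sum>i<n. (y ^ i)\<^sup>2 + (y ^ (n - Suc i))\<^sup>2)"
    by (simp add: sum.distrib power_mult[symmetric] mult.commute)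
  also have "\<dots> \<ge> (\<Sum>i<n. 2 * y ^ (n - 1))"
  proof (rule sum_mono)
    fix i assume "i \<in> {..<n}"
    then have "y ^ (n - 1) = y ^ i * y ^ (n - Suc i)"
      by (simp add: power_add[symmetric])
    then show "2 * y ^ (n - 1) \<le> (y ^ i)\<^sup>2 + (y ^ (n - Suc i))\<^sup>2"
      using sum_squares_bound[of "y ^ i" "y ^ (n - Suc i)"] by (simp add: mult_ac)
  qed
  finally show ?thesis by simp
qed

text \<open>The weights \<open>1 / (n (1 - x)) - x\<^sup>n / (1 - x\<^sup>n)\<close> compare the Lambert series with \<open>L(1, \<psi>)\<close>.\<close>

lemma decseq_Lambert_weight:
  fixes x :: real
  assumes x: "0 < x" "x < 1"
  defines "b \<equiv> \<lambda>n. 1 / (real (Suc n) * (1 - x)) - x ^ Suc n / (1 - x ^ Suc n)"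
  shows "decseq b" "b n \<ge> 0" "b 0 = 1"
proof -
  define s where "s = (\<lambda>n. \<Sum>i<n. x ^ i)"
  have geom: "1 - x ^ n = (1 - x) * s n" for n
    using x by (simp add: s_def sum_gp_strict)
  have s: "s n > 0" if "n > 0" for n
    using that x by (auto simp: s_def intro!: sum_pos)
  have b: "(1 - x) * b n = 1 / real (Suc n) - x ^ Suc n / s (Suc n)" for n
  proof -
    have *: "c * (1 / (r * c) - y / (c * s)) = 1 / r - y / s" if "c \<noteq> 0" for c r y s :: real
      using that by (simp add: right_diff_distrib)
    show ?thesis unfolding b_def geom using x by (intro *) simp
  qed
  have "b (Suc n) \<le> b n" for n
  proof -
    define m where "m = Suc n"
    have m: "m > 0" by (simp add: m_def)
    define y where "y = sqrt x"
    have y: "y > 0" "y < 1" "y\<^sup>2 = x" using x by (auto simp: y_def)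
    \<comment> \<open>In terms of \<open>s\<close>, the decrease of \<open>b\<close> means
      \<open>x ^ m / (s m * s (Suc m)) \<le> 1 / (m * (m + 1))\<close>. The two geometric-mean
      bounds give \<open>y ^ (2 * m - 1)\<close>, which is at least
      \<open>y ^ (2 * m) = x ^ m\<close>.\<close>
    have "real m * real (Suc m) * x ^ m \<le> (real m * y ^ (m - 1)) * (real (Suc m) * y ^ m)"
    proof -
      have "x ^ m = y ^ (2 * m)" by (simp add: y power_mult)
      also have "\<dots> \<le> y ^ (m - 1 + m)" using y by (intro power_decreasing) auto
      finally show ?thesis by (simp add: power_add mult_ac mult_left_mono)
    qed
    also have "\<dots> \<le> s m * s (Suc m)"
      using AM_GM_geometric_sum[of y m] AM_GM_geometric_sum[of y "Suc m"] y s[of m] m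
      by (intro mult_mono) (auto simp: s_def)
    finally have ineq: "real m * real (Suc m) * x ^ m \<le> s m * s (Suc m)" .
    have s_Suc: "s (Suc m) = s m + x ^ m" by (simp add: s_def)
    have sm: "s m = (1 - x ^ m) / (1 - x)"
      unfolding geom using x by simp
    have "x ^ m / s m - x ^ Suc m / s (Suc m) = x ^ m / (s m * s (Suc m))"
    proof -
      have "s (Suc m) - x * s m = 1"
        unfolding s_Suc sm using x by (simp add: field_simps)
      then have "x ^ m * s (Suc m) - x ^ Suc m * s m = x ^ m"
        by (metis mult.assoc mult.commute power_Suc right_diff_distrib mult.right_neutral)
      then show ?thesis
        using s[of m] s[of "Suc m"] m by (simp add: field_simps)
    qed
    also have "\<dots> \<le> 1 / (real m * real (Suc m))"
    proof -
      have "y / A \<le> 1 / B" if "B * y \<le> A" "A > 0" "B > 0" for y A B :: real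
        using that by (simp add: field_simps)
      from this[OF ineq] show ?thesis using s[of m] s[of "Suc m"] m by simp
    qed
    also have "\<dots> = 1 / real m - 1 / real (Suc m)"
      using m by (simp add: field_simps)
    finally have "(1 - x) * b (Suc n) \<le> (1 - x) * b n"
      unfolding b by (simp add: m_def)
    then show ?thesis using x by simp
  qed
  then show "decseq b" by (simp add: decseq_Suc_iff)
  show "b n \<ge> 0"
  proof -
    have "real (Suc n) * x ^ Suc n \<le> s (Suc n)"
      unfolding s_def using sum_bounded_below[of "{..<Suc n}" "x ^ Suc n" "\<lambda>i. x ^ i"] x
      by (simp add: power_decreasing less_imp_le del: sum.lessThan_Suc power_Suc)
    then have "(1 - x) * b n \<ge> 0"
      unfolding b using s[of "Suc n"] by (simp add: field_simps)
    then show ?thesis using x by (simp add: zero_le_mult_iff)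
  qed
  show "b 0 = 1" using x by (simp add: b_def field_simps)
qed

context nontrivial_dirichlet_char
begin

text \<open>Abel summation against the decreasing weight costs at most \<open>l\<close>, whatever
  \<open>x\<close> is, since the weight starts at 1. What remains is a partial sum of
  \<open>L1\<close>, which tends to 0 if \<open>L1 = 0\<close>.\<close>

lemma norm_Lambert_sum_le:
  assumes L1: "L1 = 0" and x: "0 < x" "x < 1"
  shows "norm (\<Sum>n<N. \<psi> (Suc n) * of_real (x ^ Suc n / (1 - x ^ Suc n))) \<le>
    l + norm (\<Sum>n<N. \<psi> (Suc n) * of_real (1 / real (Suc n))) / (1 - x)"
proof -
  define S where "S = (\<Sum>n<N. \<psi> (Suc n) * of_real (1 / real (Suc n)))"
  define b where "b = (\<lambda>n. 1 / (real (Suc n) * (1 - x)) - x ^ Suc n / (1 - x ^ Suc n))"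
  have 1: "norm (\<Sum>n<N. \<psi> (Suc n) * of_real (b n)) \<le> l * b 0"
    unfolding b_def by (intro norm_sum_mult_le_Abel norm_sum_le decseq_Lambert_weight x)
  have 2: "b 0 = 1"
    unfolding b_def by (intro decseq_Lambert_weight x)
  have 3: "(\<Sum>n<N. \<psi> (Suc n) * of_real (x ^ Suc n / (1 - x ^ Suc n))) =
      S * of_real (1 / (1 - x)) - (\<Sum>n<N. \<psi> (Suc n) * of_real (b n))"
    unfolding S_def sum_distrib_right sum_subtractf[symmetric]
  proof (intro sum.cong refl)
    fix n
    have "x ^ Suc n / (1 - x ^ Suc n) = 1 / real (Suc n) * (1 / (1 - x)) - b n"
      by (simp add: b_def)
    then show "\<psi> (Suc n) * of_real (x ^ Suc n / (1 - x ^ Suc n)) =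
        \<psi> (Suc n) * of_real (1 / real (Suc n)) * of_real (1 / (1 - x)) -
        \<psi> (Suc n) * of_real (b n)"
      by (simp only: of_real_diff of_real_mult right_diff_distrib mult.assoc)
  qed
  have 4: "norm (S * of_real (1 / (1 - x))) = norm S / (1 - x)"
    unfolding norm_mult norm_of_real using x by simp
  have "norm (\<Sum>n<N. \<psi> (Suc n) * of_real (x ^ Suc n / (1 - x ^ Suc n))) \<le>
      norm (S * of_real (1 / (1 - x))) + norm (\<Sum>n<N. \<psi> (Suc n) * of_real (b n))"
    unfolding 3 by (rule norm_triangle_ineq4)
  also have "\<dots> \<le> norm S / (1 - x) + l"
    using 1 2 4 by (intro add_mono) auto
  finally show ?thesis by (simp only: S_def add.commute)
qed

text \<open>If \<open>L1 = 0\<close>, the Lambert series is at most \<open>l\<close> on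
  \<open>(0, 1)\<close>. Its power series coefficients, the divisor sums \<open>c N\<close>, are
  nonnegative, and \<open>c (l ^ i) = 1\<close> because only the divisor 1 is prime to
  \<open>l\<close>. So it dominates the sum of the \<open>x ^ (l ^ i)\<close>, which is unbounded as
  \<open>x\<close> approaches 1.\<close>

theorem L1_nonzero_real:
  assumes real: "\<And>n. \<psi> n \<in> \<real>"
  shows "L1 \<noteq> 0"
proof
  assume L1: "L1 = 0"
  define f where "f = (\<lambda>n. Re (\<psi> n))"
  have chi: "\<psi> n = of_real (f n)" for n
    using real[of n] by (simp add: f_def)
  have f_mult: "f (m * n) = f m * f n" for m n
    using real[of m] real[of n] by (simp add: f_def mult complex_is_Real_iff)
  have f_1: "f 1 = 1" by (simp add: f_def)
  have f_le: "\<bar>f n\<bar> \<le> 1" for n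
    using norm_chi_le[of n] unfolding chi by simp
  define c where "c = (\<lambda>N. \<Sum>d | d dvd N. f d)"
  have c_nonneg: "c N \<ge> 0" if "N > 0" for N
    unfolding c_def using that by (intro divisor_sum_nonneg f_mult f_1 f_le)
  have c_power: "c (l ^ i) = 1" for i
  proof -
    have "c (l ^ i) = (\<Sum>d\<in>{1}. f d)"
      unfolding c_def
    proof (rule sum.mono_neutral_right)
      show "\<forall>d\<in>{d. d dvd l ^ i} - {1}. f d = 0"
      proof
        fix d assume d: "d \<in> {d. d dvd l ^ i} - {1}"
        then obtain j where "d = l ^ j" using prime_l by (auto simp: divides_primepow_nat)
        with d have "l dvd d" by (cases j) auto
        then show "f d = 0" using eq_0_iff[of d] by (simp add: f_def)
      qed
    qed (use prime_l prime_gt_0_nat in auto)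
    then show ?thesis by (simp add: f_def)
  qed
  have bound: "(\<Sum>i<K. x ^ (l ^ i)) \<le> real l" if x: "0 < x" "x < 1" for x :: real and K :: nat
  proof -
    define T where "T = (\<lambda>M. \<Sum>n<M. f (Suc n) * (x ^ Suc n / (1 - x ^ Suc n)))"
    have T_le: "T M \<le> l + norm (\<Sum>n<M. \<psi> (Suc n) * of_real (1 / real (Suc n))) / (1 - x)" for M
    proof -
      have "T M \<le> norm (of_real (T M) :: complex)" by simp
      also have "(of_real (T M) :: complex) = (\<Sum>n<M. \<psi> (Suc n) * of_real (x ^ Suc n / (1 - x ^ Suc n)))"
        unfolding T_def chi of_real_sum of_real_mult by simp
      finally show ?thesis using norm_Lambert_sum_le[OF L1 x, of M] by linarith
    qed
    \<comment> \<open>Everything is truncated at \<open>M\<close>, so that the double sum can be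
      rearranged as a finite one. For each \<open>d \<le> M\<close> the multiples of
      \<open>d\<close> beyond \<open>M\<close> contribute at most
      \<open>x ^ M / (1 - x)\<close>.\<close>
    have T_ge: "(\<Sum>i<K. x ^ (l ^ i)) - M * (x ^ M / (1 - x)) \<le> T M" if M: "M \<ge> l ^ K" for M
    proof -
      have "(\<Sum>i<K. x ^ (l ^ i)) = (\<Sum>N\<in>(\<lambda>i. l ^ i) ` {..<K}. c N * x ^ N)"
        using l_gt_1 by (subst sum.reindex) (auto simp: inj_on_def c_power)
      also have "\<dots> \<le> (\<Sum>N\<in>{1..M}. c N * x ^ N)"
      proof (rule sum_mono2)
        show "(\<lambda>i. l ^ i) ` {..<K} \<subseteq> {1..M}"
        proof clarify
          fix i assume "i < K"
          then have "l ^ i \<le> l ^ K" using l_gt_1 by (intro power_increasing) auto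
          also note M
          finally show "l ^ i \<in> {1..M}" using l_gt_1 by simp
        qed
      qed (use c_nonneg x in auto)
      also have "\<dots> = (\<Sum>N\<in>{1..M}. \<Sum>d | d \<in> {1..M} \<and> d dvd N. f d * x ^ N)"
      proof (rule sum.cong[OF refl])
        fix N assume N: "N \<in> {1..M}"
        have "{d. d dvd N} = {d. d \<in> {1..M} \<and> d dvd N}"
          using N by (auto dest: dvd_imp_le intro: Suc_leI dvd_pos_nat)
        then show "c N * x ^ N = (\<Sum>d | d \<in> {1..M} \<and> d dvd N. f d * x ^ N)"
          by (simp add: c_def sum_distrib_right)
      qed
      also have "\<dots> = (\<Sum>d\<in>{1..M}. \<Sum>N | N \<in> {1..M} \<and> d dvd N. f d * x ^ N)"
        by (rule sum.swap_restrict) auto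
      also have "\<dots> \<le> (\<Sum>d\<in>{1..M}. f d * (x ^ d / (1 - x ^ d)) + x ^ M / (1 - x))"
      proof (rule sum_mono)
        fix d assume d: "d \<in> {1..M}"
        define q where "q = M div d"
        have xd: "0 < x ^ d" "x ^ d \<le> x" "x ^ d < 1"
          using x d power_decreasing[of 1 d x] by auto
        have xx: "x ^ (d * Suc m) = x ^ d * (x ^ d) ^ m" for m
          by (simp add: power_add flip: power_mult)
        have "{N. N \<in> {1..M} \<and> d dvd N} = (\<lambda>m. d * Suc m) ` {..<q}"
        proof (intro equalityI subsetI)
          fix N assume "N \<in> {N. N \<in> {1..M} \<and> d dvd N}"
          then obtain m where m: "N = d * m" "1 \<le> d * m" "d * m \<le> M" by auto
          then have "m > 0" "m \<le> q"
            using d by (auto simp: q_def less_eq_div_iff_mult_less_eq mult.commute intro: Nat.gr0I)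
          then show "N \<in> (\<lambda>m. d * Suc m) ` {..<q}"
            using m by (intro image_eqI[of _ _ "m - 1"]) auto
        next
          fix N assume "N \<in> (\<lambda>m. d * Suc m) ` {..<q}"
          then obtain m where m: "N = d * Suc m" "m < q" by auto
          then have "Suc m * d \<le> M"
            using d less_eq_div_iff_mult_less_eq[of d "Suc m" M] by (simp add: q_def)
          then show "N \<in> {N. N \<in> {1..M} \<and> d dvd N}" using m d by (auto simp: mult.commute)
        qed
        then have "(\<Sum>N | N \<in> {1..M} \<and> d dvd N. f d * x ^ N) = (\<Sum>m<q. f d * x ^ (d * Suc m))"
          using d by (simp add: sum.reindex inj_on_def)
        also have "\<dots> = f d * x ^ d * (\<Sum>m<q. (x ^ d) ^ m)"
          unfolding xx sum_distrib_left by (simp only: mult.assoc)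
        also have "\<dots> = f d * (x ^ d / (1 - x ^ d)) - f d * (x ^ (d * Suc q) / (1 - x ^ d))"
          unfolding xx using xd by (simp add: sum_gp_strict right_diff_distrib diff_divide_distrib)
        finally have eq: "(\<Sum>N | N \<in> {1..M} \<and> d dvd N. f d * x ^ N) =
            f d * (x ^ d / (1 - x ^ d)) - f d * (x ^ (d * Suc q) / (1 - x ^ d))" .
        have "- f d * (x ^ (d * Suc q) / (1 - x ^ d)) \<le> 1 * (x ^ M / (1 - x))"
        proof (rule mult_mono)
          show "- f d \<le> 1" using f_le[of d] by (simp add: abs_le_iff)
          have "M \<le> d * Suc q"
            using d dividend_less_times_div[of d M] by (simp add: q_def)
          then show "x ^ (d * Suc q) / (1 - x ^ d) \<le> x ^ M / (1 - x)"
            using x xd by (intro frac_le power_decreasing) auto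
        qed (use x xd in auto)
        then show "(\<Sum>N | N \<in> {1..M} \<and> d dvd N. f d * x ^ N) \<le> f d * (x ^ d / (1 - x ^ d)) + x ^ M / (1 - x)"
          unfolding eq by simp
      qed
      also have "\<dots> = T M + M * (x ^ M / (1 - x))"
        unfolding T_def sum.distrib
        using sum.shift_bounds_Suc_ivl[of "\<lambda>d. f d * (x ^ d / (1 - x ^ d))" 0 M]
        by (simp add: atLeastLessThanSuc_atLeastAtMost atLeast0LessThan)
      finally show ?thesis by linarith
    qed
    have "(\<lambda>M. (\<Sum>i<K. x ^ (l ^ i)) - M * (x ^ M / (1 - x)) -
          norm (\<Sum>n<M. \<psi> (Suc n) * of_real (1 / real (Suc n))) / (1 - x)) \<longlonglongrightarrow>
        (\<Sum>i<K. x ^ (l ^ i)) - 0 / (1 - x) - norm L1 / (1 - x)"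
      unfolding times_divide_eq_right using x L1_sums[unfolded sums_def]
      by (intro tendsto_intros powser_times_n_limit_0) auto
    then have "(\<Sum>i<K. x ^ (l ^ i)) - 0 / (1 - x) - norm L1 / (1 - x) \<le> l"
    proof (rule LIMSEQ_le_const2, intro exI allI impI)
      fix M assume "l ^ K \<le> M"
      then show "(\<Sum>i<K. x ^ (l ^ i)) - M * (x ^ M / (1 - x)) -
          norm (\<Sum>n<M. \<psi> (Suc n) * of_real (1 / real (Suc n))) / (1 - x) \<le> l"
        using T_ge[of M] T_le[of M] by linarith
    qed
    then show ?thesis by (simp add: L1)
  qed
  \<comment> \<open>These are \<open>l + 1\<close> terms, each tending to 1, against the bound
    \<open>l\<close>.\<close>
  have "((\<lambda>x. \<Sum>i<Suc l. x ^ (l ^ i)) \<longlongrightarrow> (\<Sum>i<Suc l. 1 ^ (l ^ i))) (at_left (1::real))"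
    by (intro tendsto_intros)
  moreover have "\<forall>\<^sub>F x in at_left (1::real). (\<Sum>i<Suc l. x ^ (l ^ i)) \<le> real l"
    by (rule eventually_mono[OF eventually_at_left_real[of 0 1]]) (auto intro: bound simp del: sum.lessThan_Suc)
  ultimately have "(\<Sum>i<Suc l. 1 ^ (l ^ i)) \<le> real l"
    by (intro tendsto_upperbound) (auto simp: trivial_limit_at_left_real)
  then show False by simp
qed

end

section \<open>Dirichlet series\<close>

lemma powr_minus_diff_bounds:
  fixes d :: real
  assumes d: "d > 0"
  shows "real (Suc n) powr - d - real (Suc (Suc n)) powr - d \<le> d * real (Suc n) powr - (1 + d)" (is ?A)
    and "d * real (Suc (Suc n)) powr - (1 + d) \<le> real (Suc n) powr - d - real (Suc (Suc n)) powr - d" (is ?B)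
proof -
  have "\<exists>z. real (Suc n) < z \<and> z < real (Suc (Suc n)) \<and>
      real (Suc (Suc n)) powr - d - real (Suc n) powr - d =
        (real (Suc (Suc n)) - real (Suc n)) * (- d * z powr (- d - 1))"
    by (rule MVT2) (auto intro!: derivative_eq_intros)
  moreover have "- d - 1 = - (1 + d)" by simp
  ultimately obtain z where z: "real (Suc n) < z" "z < real (Suc (Suc n))"
    "real (Suc n) powr - d - real (Suc (Suc n)) powr - d = d * z powr - (1 + d)"
    by (metis (no_types, lifting) add_diff_cancel_left' minus_diff_eq mult_1 mult_minus_left of_nat_Suc add.commute)
  show ?A unfolding z(3) using z d by (intro mult_left_mono powr_mono2') auto
  show ?B unfolding z(3) using z d by (intro mult_left_mono powr_mono2') auto
qed

lemma sum_powr_le: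
  fixes d :: real
  assumes d: "d > 0"
  shows "(\<Sum>n<N. real (Suc n) powr - (1 + d)) \<le> 1 + 1 / d"
proof (cases N)
  case (Suc M)
  have "(\<Sum>n<N. real (Suc n) powr - (1 + d)) = 1 + (\<Sum>n<M. real (Suc (Suc n)) powr - (1 + d))"
    unfolding Suc by (subst sum.lessThan_Suc_shift) simp
  also have "(\<Sum>n<M. real (Suc (Suc n)) powr - (1 + d)) \<le>
      (\<Sum>n<M. (real (Suc n) powr - d - real (Suc (Suc n)) powr - d) / d)"
    using powr_minus_diff_bounds(2)[OF d] d by (intro sum_mono) (simp add: field_simps)
  also have "\<dots> = (1 - real (Suc M) powr - d) / d"
    unfolding sum_divide_distrib[symmetric] by (subst sum_lessThan_telescope') simp
  also have "\<dots> \<le> 1 / d"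
    using d by (intro divide_right_mono) auto
  finally show ?thesis by simp
qed (use d in auto)

lemma summable_powr: "d > 0 \<Longrightarrow> summable (\<lambda>n. real (Suc n) powr - (1 + d))"
  by (rule summableI_nonneg_bounded[OF _ sum_powr_le]) auto

context dirichlet_char
begin

definition L :: "real \<Rightarrow> complex" where
  "L s = (\<Sum>n. \<psi> (Suc n) * of_real (real (Suc n) powr - s))"

lemma summable_norm_L: "d > 0 \<Longrightarrow> summable (\<lambda>n. norm (\<psi> (Suc n) * of_real (real (Suc n) powr - (1 + d))))"
  by (rule summable_comparison_test'[OF summable_powr, of d 0])
     (auto simp: norm_mult intro!: mult_left_le_one_le norm_chi_le)

lemma norm_L_le: "d > 0 \<Longrightarrow> norm (L (1 + d)) \<le> 1 + 1 / d"
proof -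
  assume d: "d > 0"
  have "norm (L (1 + d)) \<le> (\<Sum>n. norm (\<psi> (Suc n) * of_real (real (Suc n) powr - (1 + d))))"
    unfolding L_def by (rule summable_norm[OF summable_norm_L[OF d]])
  also have "\<dots> \<le> (\<Sum>n. real (Suc n) powr - (1 + d))"
    by (rule suminf_le[OF _ summable_norm_L[OF d] summable_powr[OF d]])
       (auto simp: norm_mult intro!: mult_left_le_one_le norm_chi_le)
  also have "\<dots> \<le> 1 + 1 / d"
    by (intro suminf_le_const summable_powr sum_powr_le d)
  finally show ?thesis .
qed

section \<open>Finite Euler products by sieving\<close>

definition rough :: "nat \<Rightarrow> nat set" where
  "rough P = {n. n > 0 \<and> (\<forall>p. prime p \<and> p \<le> P \<longrightarrow> \<not> p dvd n)}"

lemma rough_0: "rough 0 = {0<..}"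
  by (auto simp: rough_def)

lemma rough_Suc_prime:
  assumes "prime (Suc P)"
  shows "rough (Suc P) = rough P - (\<lambda>m. Suc P * m) ` rough P" "(\<lambda>m. Suc P * m) ` rough P \<subseteq> rough P"
proof -
  show sub: "(\<lambda>m. Suc P * m) ` rough P \<subseteq> rough P"
  proof (clarsimp simp: rough_def simp del: mult_Suc)
    fix m p assume *: "0 < m" "\<forall>p. prime p \<and> p \<le> P \<longrightarrow> \<not> p dvd m" "prime p" "p \<le> P" "p dvd Suc P * m"
    then have "p dvd Suc P" using prime_dvd_mult_iff by blast
    then have "p = Suc P" using * assms primes_dvd_imp_eq by blast
    then show False using * by simp
  qed
  show "rough (Suc P) = rough P - (\<lambda>m. Suc P * m) ` rough P"
  proof (intro equalityI subsetI)
    fix n assume n: "n \<in> rough (Suc P)"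
    then have "\<not> Suc P dvd n" using assms by (auto simp: rough_def)
    then show "n \<in> rough P - (\<lambda>m. Suc P * m) ` rough P"
      using n by (auto simp: rough_def simp del: mult_Suc)
  next
    fix n assume n: "n \<in> rough P - (\<lambda>m. Suc P * m) ` rough P"
    have "\<not> Suc P dvd n"
    proof
      assume "Suc P dvd n"
      then obtain m where m: "n = Suc P * m" by blast
      have "m \<in> rough P" using n unfolding m rough_def by (auto simp del: mult_Suc)
      with n m show False by blast
    qed
    then show "n \<in> rough (Suc P)"
      using n by (auto simp: rough_def le_Suc_eq)
  qed
qed

lemma rough_Suc_not_prime: "\<not> prime (Suc P) \<Longrightarrow> rough (Suc P) = rough P"
  by (auto simp: rough_def le_Suc_eq)

context
  fixes d :: real
  assumes d: "d > 0"
begin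

definition L_term :: "nat \<Rightarrow> complex" where
  "L_term n = \<psi> n * of_real (real n powr - (1 + d))"

lemma L_term_mult: "L_term (m * n) = L_term m * L_term n"
  by (simp add: L_term_def mult powr_mult)

lemma norm_L_term_le: "norm (L_term n) \<le> real n powr - (1 + d)"
  by (auto simp: L_term_def norm_mult intro!: mult_left_le_one_le norm_chi_le)

lemma summable_powr': "summable (\<lambda>n. real n powr - (1 + d))"
  using summable_powr[OF d] by (subst (asm) summable_Suc_iff)

lemma powr_summable_on: "(\<lambda>n. real n powr - (1 + d)) summable_on A"
proof -
  have "(\<lambda>n. real n powr - (1 + d)) summable_on UNIV"
    using summable_powr' by (subst summable_on_UNIV_nonneg_real_iff) auto
  then show ?thesis by (rule summable_on_subset_banach) simp
qed

lemma L_term_abs_summable_on: "(\<lambda>n. norm (L_term n)) summable_on A"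
  using norm_L_term_le by (intro Infinite_Sum.abs_summable_on_comparison_test'[OF powr_summable_on]) auto

lemma L_term_summable_on: "L_term summable_on A"
  using L_term_abs_summable_on by (rule abs_summable_summable)

lemma L_eq_infsum: "L (1 + d) = infsum L_term {0<..}"
proof -
  have "(L_term has_sum infsum L_term UNIV) UNIV"
    using L_term_summable_on by (rule has_sum_infsum)
  then have "L_term sums infsum L_term UNIV" by (rule has_sum_imp_sums)
  then have "(\<lambda>n. L_term (Suc n)) sums (infsum L_term UNIV - L_term 0)"
    by (simp add: sums_Suc_iff)
  then have "L (1 + d) = infsum L_term UNIV"
    unfolding L_def L_term_def by (simp add: sums_iff)
  also have "\<dots> = infsum L_term {0<..}"
    by (rule infsum_cong_neutral) (auto simp: L_term_def)
  finally show ?thesis .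
qed

text \<open>Multiplying by \<open>1 - L_term p\<close> subtracts the sum over the multiples of
  \<open>p\<close> among the remaining indices, as in the sieve of Eratosthenes.\<close>

lemma finite_Euler_product:
  "L (1 + d) * (\<Prod>p | prime p \<and> p \<le> P. 1 - L_term p) = infsum L_term (rough P)"
proof (induction P)
  case 0
  have "{p. prime p \<and> p \<le> 0} = ({} :: nat set)" by auto
  then show ?case by (simp only: L_eq_infsum rough_0 prod.empty mult_1_right)
next
  case (Suc P)
  show ?case
  proof (cases "prime (Suc P)")
    case True
    define I where "I = (\<lambda>m. Suc P * m) ` rough P"
    have "{p. prime p \<and> p \<le> Suc P} = insert (Suc P) {p. prime p \<and> p \<le> P}"
      using True by (auto simp: le_Suc_eq)
    then have "L (1 + d) * (\<Prod>p | prime p \<and> p \<le> Suc P. 1 - L_term p) =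
        infsum L_term (rough P) - L_term (Suc P) * infsum L_term (rough P)"
      unfolding Suc.IH[symmetric] by (simp add: algebra_simps)
    also have "L_term (Suc P) * infsum L_term (rough P) = infsum (\<lambda>m. L_term (Suc P * m)) (rough P)"
      unfolding L_term_mult by (rule infsum_cmult_right[symmetric]) (rule L_term_summable_on)
    also have "\<dots> = infsum L_term I"
      unfolding I_def by (subst infsum_reindex) (auto simp: inj_on_def o_def simp del: mult_Suc)
    also have "infsum L_term (rough P) - infsum L_term I = infsum L_term (rough P - I)"
      unfolding I_def by (rule infsum_Diff[symmetric]) (intro L_term_summable_on rough_Suc_prime(2) True)+
    also have "rough P - I = rough (Suc P)"
      unfolding I_def using rough_Suc_prime(1)[OF True] by simp
    finally show ?thesis .
  next
    case False
    then have "{p. prime p \<and> p \<le> Suc P} = {p. prime p \<and> p \<le> P}" by (auto simp: le_Suc_eq)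
    then show ?thesis using Suc.IH by (simp add: rough_Suc_not_prime[OF False])
  qed
qed

text \<open>Apart from 1, a number without prime factors up to \<open>P\<close> exceeds
  \<open>P\<close>, so the sum differs from its term at 1 by at most a tail of a convergent
  series.\<close>

lemma infsum_rough_tendsto: "(\<lambda>P. infsum L_term (rough P)) \<longlonglongrightarrow> 1"
proof -
  define g where "g = (\<lambda>n. real n powr - (1 + d))"
  have "(g has_sum infsum g UNIV) UNIV"
    unfolding g_def using powr_summable_on by (rule has_sum_infsum)
  then have "g sums infsum g UNIV" by (rule has_sum_imp_sums)
  then have "(\<lambda>P. infsum g UNIV - sum g {..<Suc P}) \<longlonglongrightarrow> infsum g UNIV - infsum g UNIV"
    unfolding sums_def by (intro tendsto_intros LIMSEQ_Suc)
  then have lim: "(\<lambda>P. infsum g UNIV - sum g {..<Suc P}) \<longlonglongrightarrow> 0" by simp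
  have "norm (infsum L_term (rough P) - 1) \<le> infsum g UNIV - sum g {..<Suc P}" for P
  proof -
    have "1 \<in> rough P" by (auto simp: rough_def)
    then have "infsum L_term (rough P) - infsum L_term {1} = infsum L_term (rough P - {1})"
      by (intro infsum_Diff[symmetric] L_term_summable_on) auto
    then have "infsum L_term (rough P) - 1 = infsum L_term (rough P - {1})"
      by (simp add: L_term_def)
    also have "norm \<dots> \<le> infsum (\<lambda>n. norm (L_term n)) (rough P - {1})"
      by (intro norm_infsum_bound L_term_abs_summable_on)
    also have "\<dots> \<le> infsum g (UNIV - {..<Suc P})"
    proof (rule infsum_mono_neutral)
      show "g summable_on UNIV - {..<Suc P}" unfolding g_def by (rule powr_summable_on)
      fix n assume n: "n \<in> rough P - {1} - (UNIV - {..<Suc P})"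
      then obtain p where p: "prime p" "p dvd n" using prime_factor_nat by auto
      with n have "p \<le> n" by (auto simp: rough_def dest: dvd_imp_le)
      with n p show "norm (L_term n) \<le> 0" by (auto simp: rough_def)
    qed (use L_term_abs_summable_on norm_L_term_le in \<open>auto simp: g_def\<close>)
    also have "\<dots> = infsum g UNIV - infsum g {..<Suc P}"
      unfolding g_def by (intro infsum_Diff powr_summable_on) auto
    finally show ?thesis by simp
  qed
  then have "(\<lambda>P. infsum L_term (rough P) - 1) \<longlonglongrightarrow> 0"
    by (intro Lim_null_comparison[OF _ lim] always_eventually) auto
  then show ?thesis by (simp add: LIM_zero_iff)
qed

end

end

context nontrivial_dirichlet_char
begin

text \<open>The cancellation in the character sums makes the bound uniform in \<open>d\<close>, in
  contrast to the pole of the trivial character.\<close>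

lemma norm_L_le_nontrivial:
  assumes "d > 0"
  shows "norm (L (1 + d)) \<le> l"
proof -
  define b where "b = (\<lambda>n. real (Suc n) powr - (1 + d))"
  have "decseq b" "b n \<ge> 0" for n
    unfolding b_def using assms by (auto simp: decseq_def intro!: powr_mono2')
  then have le: "norm (\<Sum>n<N. \<psi> (Suc n) * of_real (b n)) \<le> l * b 0" for N
    by (intro norm_sum_mult_le_Abel norm_sum_le)
  have "(\<lambda>N. \<Sum>n<N. \<psi> (Suc n) * of_real (b n)) \<longlonglongrightarrow> L (1 + d)"
    unfolding L_def b_def
    by (rule summable_LIMSEQ[OF summable_norm_cancel[OF summable_norm_L[OF assms]]])
  then have "norm (L (1 + d)) \<le> l * b 0"
    by (intro LIMSEQ_le_const2[OF tendsto_norm]) (use le in auto)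
  then show ?thesis by (simp add: b_def)
qed

text \<open>A quantitative zero of order one without derivatives. As \<open>L1 = 0\<close>, the
  partial sums of its series are at most \<open>2 l / (N + 1)\<close>; the weights
  \<open>n powr - d\<close> change by at most \<open>d / n\<close> per step. Summation by parts
  leaves \<open>2 l d\<close> times a telescoping sum of \<open>1 / (n (n + 1))\<close>.\<close>

lemma norm_L_le_if_L1_eq_0:
  fixes d :: real
  assumes L1: "L1 = 0" and d: "d > 0"
  shows "norm (L (1 + d)) \<le> 2 * l * d"
proof -
  define a where "a = (\<lambda>n. \<psi> (Suc n) * of_real (1 / real (Suc n)))"
  define b where "b = (\<lambda>n. real (Suc n) powr - d)"
  have A: "norm (sum a {..<N}) \<le> 2 * l / Suc N" for N
    using L1_tail[of N] unfolding a_def L1 by simp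
  have bdiff: "0 \<le> b n - b (Suc n)" "b n - b (Suc n) \<le> d * (1 / real (Suc n))" for n
  proof -
    have "b n - b (Suc n) \<le> d * real (Suc n) powr - (1 + d)"
      unfolding b_def using powr_minus_diff_bounds(1)[OF d] .
    also have "\<dots> \<le> d * real (Suc n) powr - 1"
      using d by (intro mult_left_mono powr_mono) auto
    finally show "b n - b (Suc n) \<le> d * (1 / real (Suc n))" by (simp add: powr_minus_divide)
    show "0 \<le> b n - b (Suc n)"
      unfolding b_def using d by (auto intro!: powr_mono2')
  qed
  have b_abs: "\<bar>b n - b (Suc n)\<bar> \<le> d * (1 / real (Suc n))" and b_le: "\<bar>b n\<bar> \<le> 1" for n
    using bdiff[of n] powr_mono[of "- d" 0 "real (Suc n)"] d by (auto simp: b_def)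
  have le: "norm (\<Sum>n<N. a n * of_real (b n)) \<le> 2 * l * d + 2 * l / Suc N * 1" for N
  proof -
    have "norm (\<Sum>n<N. a n * of_real (b n)) \<le>
        (\<Sum>n<N. norm (sum a {..<Suc n} * of_real (b n - b (Suc n)))) + norm (sum a {..<N} * of_real (b N))"
      by (subst sum_mult_by_parts) (intro norm_triangle_le add_right_mono norm_sum)
    also have "\<dots> \<le> (\<Sum>n<N. (2 * l / Suc (Suc n)) * (d * (1 / real (Suc n)))) + 2 * l / Suc N * 1"
      unfolding norm_mult norm_of_real
      by (intro add_mono sum_mono mult_mono A b_abs b_le) auto
    also have "(\<Sum>n<N. (2 * l / Suc (Suc n)) * (d * (1 / real (Suc n)))) =
        2 * l * d * (\<Sum>n<N. 1 / real (Suc n) - 1 / real (Suc (Suc n)))"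
      unfolding sum_distrib_left by (intro sum.cong refl) (simp add: field_simps)
    also have "(\<Sum>n<N. 1 / real (Suc n) - 1 / real (Suc (Suc n))) = 1 - 1 / real (Suc N)"
      by (subst sum_lessThan_telescope') simp
    also have "2 * l * d * (1 - 1 / real (Suc N)) \<le> 2 * l * d * 1"
      using d by (intro mult_left_mono) auto
    finally show ?thesis by simp
  qed
  have "a n * of_real (b n) = \<psi> (Suc n) * of_real (real (Suc n) powr - (1 + d))" for n
  proof -
    have "real (Suc n) powr - (1 + d) = real (Suc n) powr - 1 * real (Suc n) powr - d"
      by (subst powr_add[symmetric]) simp
    then show ?thesis by (simp add: a_def b_def powr_minus_divide)
  qed
  then have "(\<lambda>N. \<Sum>n<N. a n * of_real (b n)) \<longlonglongrightarrow> L (1 + d)"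
    unfolding L_def using summable_LIMSEQ[OF summable_norm_cancel[OF summable_norm_L[OF d]]]
    by (simp only:)
  moreover have "(\<lambda>N. 2 * l * d + 2 * l / Suc N * 1) \<longlonglongrightarrow> 2 * l * d + 0 * 1"
    by (intro tendsto_intros LIMSEQ_Suc[OF lim_const_over_n])
  ultimately have "norm (L (1 + d)) \<le> 2 * l * d + 0 * 1"
    by (intro LIMSEQ_le[OF tendsto_norm]) (use le in auto)
  then show ?thesis by simp
qed

end

section \<open>Even characters\<close>

lemma ee_of_nat_divide_eq_1_iff:
  assumes "N > 0"
  shows "ee (of_nat a / of_nat N) = 1 \<longleftrightarrow> N dvd a"
proof -
  have "ee (of_nat a / of_nat N) = 1 \<longleftrightarrow> real a / real N \<in> \<int>"
    using ee_of_real_eq_1_iff[of "real a / real N"] by simp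
  also have "\<dots> \<longleftrightarrow> N dvd a"
  proof
    assume "real a / real N \<in> \<int>"
    then obtain i where "real a / real N = of_int i" by (auto simp: Ints_def)
    then have "real_of_int (int a) = real_of_int (i * int N)"
      using assms by (simp add: field_simps)
    then have "int a = i * int N" by (simp only: of_int_eq_iff)
    then have "int N dvd int a" by simp
    then show "N dvd a" by simp
  qed (use assms in auto)
  finally show ?thesis .
qed

lemma ee_of_nat_divide_cong:
  assumes "[a = b] (mod N)"
  shows "ee (of_nat a / of_nat N) = ee (of_nat b / of_nat N)"
proof (cases "N = 0")
  case False
  have "ee (of_nat a / of_nat N) = ee (of_nat (a mod N) / of_nat N)" for a
  proof -
    have "(of_nat a :: complex) = of_nat (a mod N) + of_nat N * of_nat (a div N)"
      by (metis mod_mult_div_eq of_nat_add of_nat_mult)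
    then have "of_nat a / of_nat N = (of_nat (a mod N) / of_nat N + of_nat (a div N) :: complex)"
      using False by (simp only: add_divide_distrib) simp
    then show ?thesis by (simp add: ee_add)
  qed
  then show ?thesis using assms by (metis cong_def)
qed simp

lemma cnj_ee_of_real: "cnj (ee (of_real x)) = ee (of_real (- x))"
  by (simp add: ee_def exp_cnj)

lemma mult_cnj_ee_of_real: "ee (of_real x) * cnj (ee (of_real x)) = 1"
  unfolding cnj_ee_of_real ee_add[symmetric] by simp

lemma sum_ee_orthogonal:
  assumes N: "N > 0"
  shows "(\<Sum>r<N. ee (of_nat (r * a) / of_nat N) * cnj (ee (of_nat (r * b) / of_nat N))) =
    (if [a = b] (mod N) then of_nat N else 0)"
proof -
  define w where "w = ee (of_nat a / of_nat N) * cnj (ee (of_nat b / of_nat N))"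
  have pow: "ee (of_nat (r * c) / of_nat N) = ee (of_nat c / of_nat N) ^ r" for r c
    by (simp add: ee_power)
  have one: "ee (of_nat c / of_nat N) * cnj (ee (of_nat c / of_nat N)) = 1" for c
    using mult_cnj_ee_of_real[of "real c / real N"] by simp
  have sum: "(\<Sum>r<N. ee (of_nat (r * a) / of_nat N) * cnj (ee (of_nat (r * b) / of_nat N))) = (\<Sum>r<N. w ^ r)"
    unfolding pow complex_cnj_power w_def power_mult_distrib ..
  have "w ^ N = 1"
    using N by (simp add: w_def power_mult_distrib pow[symmetric] flip: complex_cnj_power)
  have "w = 1 \<longleftrightarrow> ee (of_nat a / of_nat N) = ee (of_nat b / of_nat N)"
  proof
    assume "w = 1"
    then have "w * ee (of_nat b / of_nat N) = ee (of_nat b / of_nat N)" by simp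
    then show "ee (of_nat a / of_nat N) = ee (of_nat b / of_nat N)"
      using one[of b] by (simp add: w_def mult.assoc mult.commute[of "cnj _"])
  qed (simp add: w_def one)
  also have "\<dots> \<longleftrightarrow> [a = b] (mod N)"
  proof
    assume eq: "ee (of_nat a / of_nat N) = ee (of_nat b / of_nat N)"
    have *: "[a = b] (mod N)" if "ee (of_nat a / of_nat N) = ee (of_nat b / of_nat N)" "b \<le> a" for a b
    proof -
      have "ee (of_nat (a - b) / of_nat N) = 1"
        using that by (simp add: of_nat_diff diff_divide_distrib ee_diff)
      then have "N dvd a - b" using N by (simp add: ee_of_nat_divide_eq_1_iff)
      then show ?thesis using that(2) by (simp add: cong_altdef_nat)
    qed
    show "[a = b] (mod N)"
      using *[of a b] *[of b a] eq by (cases "b \<le> a") (auto simp: cong_sym_eq)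
  qed (rule ee_of_nat_divide_cong)
  finally have iff: "w = 1 \<longleftrightarrow> [a = b] (mod N)" .
  show ?thesis
  proof (cases "w = 1")
    case False
    have "(1 - w) * (\<Sum>r<N. w ^ r) = 0"
      using \<open>w ^ N = 1\<close> by (simp add: one_diff_power_eq[symmetric])
    then show ?thesis using False iff unfolding sum by simp
  qed (use iff sum in auto)
qed

text \<open>The logarithm of the product is minus the sum of \<open>T ^ n / n\<close> times the sum
  of the \<open>n\<close>-th powers of the roots of unity, and the latter is \<open>k\<close> or 0
  by orthogonality. For \<open>T = p powr - (1 + d)\<close> the product collects the Euler factors
  at \<open>p\<close> of all characters.\<close>

lemma prod_norm_one_minus_root_le:
  assumes k: "k > 0" and T: "0 \<le> T" "T < 1"
  shows "(\<Prod>r<k. norm (1 - ee (of_nat (r * a) / of_nat k) * of_real T)) \<le> 1"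
proof -
  define w where "w = (\<lambda>r. ee (of_nat (r * a) / of_nat k) * of_real T)"
  have norm_w: "norm (w r) < 1" for r
    using T norm_ee[of "of_real (real (r * a) / real k)"] by (simp add: w_def norm_mult)
  \<comment> \<open>The term at \<open>n = 0\<close> is 0 because division by 0 gives 0.\<close>
  have ser: "(\<lambda>n. - (w r ^ n) / of_nat n) sums Ln (1 - w r)" for r
    using Ln_series'[of "- w r"] norm_w[of r] by simp
  have "(\<lambda>n. \<Sum>r<k. - (w r ^ n) / of_nat n) sums (\<Sum>r<k. Ln (1 - w r))"
    by (intro sums_sum ser)
  then have S: "(\<lambda>n. Re (\<Sum>r<k. - (w r ^ n) / of_nat n)) sums Re (\<Sum>r<k. Ln (1 - w r))"
    by (rule sums_Re)
  have nonpos: "Re (\<Sum>r<k. - (w r ^ n) / of_nat n) \<le> 0" for n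
  proof -
    have "(\<Sum>r<k. w r ^ n) = (\<Sum>r<k. ee (of_nat (r * (a * n)) / of_nat k) * cnj (ee (of_nat (r * 0) / of_nat k))) * of_real T ^ n"
      unfolding w_def power_mult_distrib sum_distrib_right by (simp add: ee_power mult_ac)
    also have "\<dots> = of_real ((if [a * n = 0] (mod k) then real k else 0) * T ^ n)"
      unfolding sum_ee_orthogonal[OF k] by simp
    finally have "(\<Sum>r<k. - (w r ^ n) / of_nat n) = of_real (- ((if [a * n = 0] (mod k) then real k else 0) * T ^ n / real n))"
      unfolding sum_divide_distrib[symmetric] sum_negf by simp
    then show ?thesis using T by simp
  qed
  have le: "Re (\<Sum>r<k. Ln (1 - w r)) \<le> 0"
    by (rule sums_le[OF nonpos S sums_zero])
  have "norm (1 - w r) = exp (Re (Ln (1 - w r)))" for r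
  proof -
    have "1 - w r \<noteq> 0" using norm_w[of r] by auto
    then show ?thesis by simp
  qed
  then have "(\<Prod>r<k. norm (1 - w r)) = exp (Re (\<Sum>r<k. Ln (1 - w r)))"
    by (simp add: exp_sum)
  also have "\<dots> \<le> 1" using le by simp
  finally show ?thesis by (simp add: w_def)
qed

text \<open>A logarithm on \<open>(\<int>/l)\<^sup>\<times>/{1,-1}\<close>, which is cyclic of order
  \<open>k\<close>; only residues modulo \<open>k\<close> are meaningful. Halving the modulus
  \<open>l - 1\<close> makes all characters built from it even.\<close>

locale discrete_log =
  fixes l k :: nat and ind :: "nat \<Rightarrow> nat"
  assumes l_prime: "prime l" and l_eq: "l = 2 * k + 1" and k_pos: "k > 0"
    and ind_mult: "\<not> l dvd m \<Longrightarrow> \<not> l dvd n \<Longrightarrow> [ind (m * n) = ind m + ind n] (mod k)"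
    and ind_cong_iff: "\<not> l dvd m \<Longrightarrow> \<not> l dvd n \<Longrightarrow> [ind m = ind n] (mod k) \<longleftrightarrow> l dvd m + n \<or> [m = n] (mod l)"
    and ind_surj: "\<exists>g. \<not> l dvd g \<and> [ind g = 1] (mod k)"

lemma discrete_log_exists:
  assumes l: "prime l" "l = 2 * k + 1" and k: "k > 0"
  shows "\<exists>ind. discrete_log l k ind"
proof -
  have l1: "l > 1" using l(1) by (rule prime_gt_1_nat)
  obtain g where g: "residue_primroot l g"
    using prime_primitive_root_exists[of l] l l1 by auto
  have tot: "totient l = 2 * k" using l by (simp add: totient_prime)
  have cop: "coprime l g" and ord: "ord l g = 2 * k"
    using g tot by (auto simp: residue_primroot_def)
  have ex: "\<exists>i. [g ^ i = n] (mod l)" if "\<not> l dvd n" for n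
  proof -
    have "coprime (n mod l) l"
      using that l by (metis prime_imp_coprime coprime_commute coprime_mod_left_iff l1 not_less_zero neq0_conv)
    moreover have "n mod l > 0" "n mod l \<le> l"
      using that l1 by (auto simp: dvd_eq_mod_eq_0 less_imp_le)
    ultimately have "n mod l \<in> totatives l" by (simp add: totatives_def)
    then have "n mod l \<in> (\<lambda>i. g ^ i mod l) ` {..<totient l}"
      using residue_primroot_is_generator[OF l1 g] by (simp add: bij_betw_def)
    then show ?thesis by (auto simp: cong_def)
  qed
  define ind where "ind = (\<lambda>n. SOME i. [g ^ i = n] (mod l))"
  have ind: "[g ^ ind n = n] (mod l)" if "\<not> l dvd n" for n
    unfolding ind_def using ex[OF that] by (rule someI_ex)
  have pow: "[g ^ i = g ^ j] (mod l) \<longleftrightarrow> [i = j] (mod 2 * k)" for i j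
    using order_divides_expdiff[OF cop, of i j] ord by simp
  have "discrete_log l k ind"
  proof
    fix m n assume mn: "\<not> l dvd m" "\<not> l dvd n"
    have "\<not> l dvd m * n" using mn l by (simp add: prime_dvd_mult_iff)
    then have "[g ^ ind (m * n) = m * n] (mod l)" by (rule ind)
    also have "[m * n = g ^ ind m * g ^ ind n] (mod l)"
      using ind mn by (intro cong_mult cong_sym[of _ m] cong_sym[of _ n]) (auto simp: cong_sym_eq)
    finally have "[ind (m * n) = ind m + ind n] (mod 2 * k)"
      unfolding power_add[symmetric] pow .
    then show "[ind (m * n) = ind m + ind n] (mod k)"
      by (rule cong_dvd_modulus_nat) simp
    \<comment> \<open>Doubling the exponents of the primitive root turns congruence modulo
      \<open>k\<close> into equality of squares modulo \<open>l\<close>, that is, equality up to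
      sign.\<close>
    have "[ind m = ind n] (mod k) \<longleftrightarrow> [2 * ind m = 2 * ind n] (mod 2 * k)"
      unfolding cong_def mult_mod_right[symmetric] by simp
    also have "\<dots> \<longleftrightarrow> [g ^ (2 * ind m) = g ^ (2 * ind n)] (mod l)"
      by (rule pow[symmetric])
    also have "\<dots> \<longleftrightarrow> [m ^ 2 = n ^ 2] (mod l)"
    proof -
      have "[g ^ (2 * ind n) = n ^ 2] (mod l)" if "\<not> l dvd n" for n
        unfolding mult.commute[of 2] power_mult using ind[OF that] by (rule cong_pow)
      from this[OF mn(1)] this[OF mn(2)] show ?thesis
        by (auto simp: cong_def)
    qed
    also have "\<dots> \<longleftrightarrow> [int m ^ 2 = int n ^ 2] (mod int l)"
      by (metis cong_int_iff of_nat_power)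
    also have "\<dots> \<longleftrightarrow> int l dvd (int m + int n) * (int m - int n)"
      by (simp add: cong_iff_dvd_diff power2_eq_square algebra_simps)
    also have "\<dots> \<longleftrightarrow> int l dvd int m + int n \<or> int l dvd int m - int n"
      using l(1) by (intro prime_dvd_mult_iff) simp
    also have "\<dots> \<longleftrightarrow> l dvd m + n \<or> [m = n] (mod l)"
      unfolding cong_int_iff[symmetric] cong_iff_dvd_diff
      by (simp only: of_nat_add[symmetric] of_nat_dvd_iff)
    finally show "[ind m = ind n] (mod k) \<longleftrightarrow> l dvd m + n \<or> [m = n] (mod l)" .
  next
    have "\<not> l dvd g"
      using cop l1 coprime_absorb_left[of l g] by auto
    moreover from this have "[g ^ ind g = g ^ 1] (mod l)" using ind by simp
    then have "[ind g = 1] (mod k)"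
      unfolding pow by (rule cong_dvd_modulus_nat) simp
    ultimately show "\<exists>g. \<not> l dvd g \<and> [ind g = 1] (mod k)" by blast
  qed (use l k in auto)
  then show ?thesis by blast
qed

context discrete_log
begin

text \<open>For \<open>r < k\<close> these are all even characters modulo \<open>l\<close>,
  \<open>chr 0\<close> being the principal one.\<close>

definition chr :: "nat \<Rightarrow> nat \<Rightarrow> complex" where
  "chr r n = (if l dvd n then 0 else ee (of_nat (r * ind n) / of_nat k))"

lemma chr_ind_cong:
  assumes "\<not> l dvd m" "\<not> l dvd n" "[ind m = ind n] (mod k)"
  shows "chr r m = chr r n"
proof -
  have "[r * ind m = r * ind n] (mod k)" using assms(3) by (rule cong_scalar_left)
  then show ?thesis using assms(1,2) ee_of_nat_divide_cong by (simp add: chr_def del: of_nat_mult)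
qed

lemma dirichlet_char_chr: "dirichlet_char l (chr r)"
proof
  show "prime l" by (rule l_prime)
  fix m n
  show "chr r (m * n) = chr r m * chr r n"
  proof (cases "l dvd m \<or> l dvd n")
    case True
    then show ?thesis by (auto simp: chr_def)
  next
    case False
    then have "[r * ind (m * n) = r * (ind m + ind n)] (mod k)"
      using ind_mult[of m n] by (intro cong_scalar_left) auto
    then have "ee (of_nat (r * ind (m * n)) / of_nat k) = ee (of_nat (r * (ind m + ind n)) / of_nat k)"
      by (rule ee_of_nat_divide_cong)
    also have "\<dots> = ee (of_nat (r * ind m) / of_nat k) * ee (of_nat (r * ind n) / of_nat k)"
      unfolding ee_add[symmetric] by (rule arg_cong[of _ _ ee]) (simp add: ring_distribs add_divide_distrib)
    finally show ?thesis using False l_prime by (simp add: chr_def prime_dvd_mult_iff del: of_nat_mult)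
  qed
  show "chr r (n + l) = chr r n"
  proof (cases "l dvd n")
    case False
    then have "[ind (n + l) = ind n] (mod k)"
      by (subst ind_cong_iff) (auto simp: cong_def)
    then show ?thesis using False by (intro chr_ind_cong) auto
  qed (simp add: chr_def)
  show "chr r n = 0 \<longleftrightarrow> l dvd n" by (simp add: chr_def)
qed

lemma nontrivial_dirichlet_char_chr:
  assumes "0 < r" "r < k"
  shows "nontrivial_dirichlet_char l (chr r)"
proof -
  interpret dirichlet_char l "chr r" by (rule dirichlet_char_chr)
  obtain g where g: "\<not> l dvd g" "[ind g = 1] (mod k)" using ind_surj by blast
  have "\<not> k dvd r * ind g"
  proof
    assume "k dvd r * ind g"
    moreover have "[r * ind g = r * 1] (mod k)" using g(2) by (rule cong_scalar_left)
    ultimately have "k dvd r" by (simp add: cong_dvd_iff)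
    then show False using assms by (auto dest: dvd_imp_le)
  qed
  then have "chr r g \<noteq> 1"
    using g k_pos by (simp add: chr_def ee_of_nat_divide_eq_1_iff del: of_nat_mult)
  with g show ?thesis by unfold_locales blast
qed

lemma chr_even: "0 < n \<Longrightarrow> n < l \<Longrightarrow> chr r (l - n) = chr r n"
  by (intro chr_ind_cong) (auto simp: ind_cong_iff nat_dvd_not_less)

lemma cnj_chr: "r \<le> k \<Longrightarrow> cnj (chr r n) = chr (k - r) n"
proof (cases "l dvd n")
  case False
  assume r: "r \<le> k"
  have "chr r n * chr (k - r) n = ee (of_nat (r * ind n) / of_nat k + of_nat ((k - r) * ind n) / of_nat k)"
    using False by (simp add: chr_def ee_add)
  also have "of_nat (r * ind n) / of_nat k + of_nat ((k - r) * ind n) / of_nat k = (of_nat (ind n) :: complex)"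
    using r k_pos by (simp add: of_nat_diff field_simps)
  finally have 1: "chr r n * chr (k - r) n = 1" by simp
  interpret dirichlet_char l "chr r" by (rule dirichlet_char_chr)
  have 2: "chr r n * cnj (chr r n) = 1" using False by (rule mult_cnj)
  have "chr r n \<noteq> 0" using False by (simp add: chr_def)
  then show ?thesis using 1 2 by (metis mult_left_cancel)
qed (simp add: chr_def)

lemma chr_orthogonal:
  assumes "\<not> l dvd u" "\<not> l dvd v"
  shows "(\<Sum>r<k. chr r u * cnj (chr r v)) = (if [ind u = ind v] (mod k) then of_nat k else 0)"
  using sum_ee_orthogonal[OF k_pos, of "ind u" "ind v"] assms by (simp add: chr_def)

text \<open>Each L-value times its inverse Euler factors up to \<open>P\<close> tends to 1.
  Multiplied over all characters, the inverse factors at every single prime have absolute value at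
  most 1, so the L-values must make up for it.\<close>

lemma prod_L_ge_1:
  assumes d: "d > 0"
  shows "(\<Prod>r<k. norm (dirichlet_char.L (chr r) (1 + d))) \<ge> 1"
proof -
  define t where "t = (\<lambda>r. dirichlet_char.L_term (chr r) d)"
  define E where "E = (\<lambda>P r. \<Prod>p | prime p \<and> p \<le> P. norm (1 - t r p))"
  have lim: "(\<lambda>P. norm (dirichlet_char.L (chr r) (1 + d)) * E P r) \<longlonglongrightarrow> norm (1 :: complex)" for r
  proof -
    interpret dirichlet_char l "chr r" by (rule dirichlet_char_chr)
    have "(\<lambda>P. norm (L (1 + d) * (\<Prod>p | prime p \<and> p \<le> P. 1 - L_term d p))) \<longlonglongrightarrow> norm (1 :: complex)"
      unfolding finite_Euler_product[OF d] by (intro tendsto_norm infsum_rough_tendsto d)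
    then show ?thesis by (simp add: norm_mult prod_norm[symmetric] E_def t_def)
  qed
  have E_le: "(\<Prod>r<k. E P r) \<le> 1" for P
  proof -
    have "(\<Prod>r<k. E P r) = (\<Prod>p | prime p \<and> p \<le> P. \<Prod>r<k. norm (1 - t r p))"
      unfolding E_def by (rule prod.swap)
    also have "\<dots> \<le> 1"
    proof (rule prod_le_1, safe)
      fix p :: nat assume p: "prime p"
      show "(\<Prod>r<k. norm (1 - t r p)) \<le> 1"
      proof (cases "l dvd p")
        case True
        have "t r p = 0" for r
        proof -
          interpret dirichlet_char l "chr r" by (rule dirichlet_char_chr)
          show ?thesis using True by (simp add: t_def L_term_def[OF d] chr_def)
        qed
        then show ?thesis by simp
      next
        case False
        have "t r p = ee (of_nat (r * ind p) / of_nat k) * of_real (real p powr - (1 + d))" for r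
        proof -
          interpret dirichlet_char l "chr r" by (rule dirichlet_char_chr)
          show ?thesis using False by (simp add: t_def L_term_def[OF d] chr_def)
        qed
        moreover have "real p powr - (1 + d) < 1"
          using d prime_gt_1_nat[OF p] powr_less_mono[of "- (1 + d)" 0 "real p"] by simp
        ultimately show ?thesis
          using prod_norm_one_minus_root_le[OF k_pos] by simp
      qed
    qed (auto intro: prod_nonneg)
    finally show ?thesis .
  qed
  have "(\<lambda>P. \<Prod>r<k. norm (dirichlet_char.L (chr r) (1 + d)) * E P r) \<longlonglongrightarrow> (\<Prod>r<k. norm (1 :: complex))"
    by (intro tendsto_prod lim)
  moreover have "(\<Prod>r<k. norm (dirichlet_char.L (chr r) (1 + d)) * E P r) \<le> (\<Prod>r<k. norm (dirichlet_char.L (chr r) (1 + d)))" for P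
    unfolding prod.distrib using E_le by (intro mult_left_le) (auto intro: prod_nonneg)
  ultimately have "(\<Prod>r<k. norm (1 :: complex)) \<le> (\<Prod>r<k. norm (dirichlet_char.L (chr r) (1 + d)))"
    by (intro LIMSEQ_le_const2) auto
  then show ?thesis by simp
qed

text \<open>A zero of \<open>L(s, \<psi>)\<close> at \<open>s = 1\<close> for a non-real \<open>\<psi>\<close> comes with another one for the
  conjugate, and two zeros outweigh the pole of \<open>L(s, 1)\<close> in the product over all even characters.\<close>

theorem L1_chr_nonzero:
  assumes r: "0 < r" "r < k"
  shows "nontrivial_dirichlet_char.L1 (chr r) \<noteq> 0"
\<comment> \<open>Since conjugation sends \<open>chr r\<close> to \<open>chr (k - r)\<close>, this
  is the case of a real character.\<close>
proof (cases "2 * r = k")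
  case True
  interpret nontrivial_dirichlet_char l "chr r" by (rule nontrivial_dirichlet_char_chr[OF r])
  have "k - r = r" using True by simp
  then have "cnj (chr r n) = chr r n" for n
    using cnj_chr[of r n] r by simp
  then show ?thesis by (intro L1_nonzero_real) (simp add: Reals_cnj_iff)
next
  case False
  define q where "q = k - r"
  have q: "0 < q" "q < k" "q \<noteq> r" using r False by (auto simp: q_def)
  interpret R: nontrivial_dirichlet_char l "chr r" by (rule nontrivial_dirichlet_char_chr[OF r])
  interpret Q: nontrivial_dirichlet_char l "chr q" by (rule nontrivial_dirichlet_char_chr[OF q(1,2)])
  show ?thesis
  proof
    assume R0: "R.L1 = 0"
    have "(\<lambda>n. cnj (chr r (Suc n) * of_real (1 / real (Suc n)))) sums cnj 0"
      unfolding sums_cnj using R.L1_sums R0 by simp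
    then have "(\<lambda>n. chr q (Suc n) * of_real (1 / real (Suc n))) sums 0"
      using cnj_chr[of r] r by (simp add: q_def)
    then have Q0: "Q.L1 = 0" using Q.L1_sums sums_unique2 by blast
    \<comment> \<open>One pole, two zeros and the uniform bound for the rest give \<open>(2 / d) *
      (2 * l * d) * (2 * l * d) * l ^ k = 8 * l ^ (k + 2) * d\<close>; this \<open>d\<close> makes
      it \<open>1 / 2\<close>.\<close>
    define d where "d = 1 / (16 * real l ^ (k + 2))"
    have l1: "real l \<ge> 1" using R.l_gt_1 by simp
    have d: "d > 0" using l1 by (simp add: d_def)
    have d1: "d \<le> 1"
    proof -
      have "1 \<le> real l ^ (k + 2)" using l1 by (rule one_le_power)
      then show ?thesis by (simp add: d_def)
    qed
    define N where "N = (\<lambda>i. norm (dirichlet_char.L (chr i) (1 + d)))"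
    have "(\<Prod>i<k. N i) = N 0 * N r * N q * (\<Prod>i\<in>{..<k} - {0} - {r} - {q}. N i)"
      using r q k_pos by (simp add: prod.remove[of "{..<k}" 0] prod.remove[of "{..<k} - {0}" r]
          prod.remove[of "{..<k} - {0} - {r}" q])
    also have "\<dots> \<le> (2 / d) * (2 * l * d) * (2 * l * d) * real l ^ k"
    proof (intro mult_mono)
      interpret Z: dirichlet_char l "chr 0" by (rule dirichlet_char_chr)
      show "N 0 \<le> 2 / d"
        using Z.norm_L_le[OF d] d d1 by (simp add: N_def field_simps)
      show "N r \<le> 2 * l * d" unfolding N_def by (rule R.norm_L_le_if_L1_eq_0[OF R0 d])
      show "N q \<le> 2 * l * d" unfolding N_def by (rule Q.norm_L_le_if_L1_eq_0[OF Q0 d])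
      have "(\<Prod>i\<in>{..<k} - {0} - {r} - {q}. N i) \<le> (\<Prod>i\<in>{..<k} - {0} - {r} - {q}. real l)"
      proof (rule prod_mono)
        fix i assume "i \<in> {..<k} - {0} - {r} - {q}"
        then interpret I: nontrivial_dirichlet_char l "chr i"
          by (intro nontrivial_dirichlet_char_chr) auto
        show "0 \<le> N i \<and> N i \<le> real l" unfolding N_def using I.norm_L_le_nontrivial[OF d] by simp
      qed
      also have "\<dots> = real l ^ card ({..<k} - {0} - {r} - {q})" by simp
      also have "\<dots> \<le> real l ^ k"
      proof (rule power_increasing[OF _ l1])
        have "card ({..<k} - {0} - {r} - {q}) \<le> card {..<k}" by (rule card_mono) auto
        then show "card ({..<k} - {0} - {r} - {q}) \<le> k" by simp
      qed
      finally show "(\<Prod>i\<in>{..<k} - {0} - {r} - {q}. N i) \<le> real l ^ k" .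
    qed (use d in \<open>auto simp: N_def intro!: prod_nonneg\<close>)
    also have "\<dots> = 8 * real l ^ (k + 2) * d"
      using d by (simp add: power_add power2_eq_square)
    also have "\<dots> = 1 / 2" using l1 by (simp add: d_def)
    finally show False using prod_L_ge_1[OF d] by (simp add: N_def)
  qed
qed

end

section \<open>Gauss sums and logarithms of cyclotomic numbers\<close>

lemma eq_inverse_mult:
  fixes p :: "'a :: comm_monoid_mult"
  assumes "p * c = 1" "p * x = y"
  shows "x = c * y"
proof -
  have "c * y = (p * c) * x"
    unfolding assms(2)[symmetric] by (simp only: mult_ac)
  then show ?thesis using assms(1) by simp
qed

context nontrivial_dirichlet_char
begin

definition gauss_sum :: complex where
  "gauss_sum = (\<Sum>v<l. \<psi> v * ee (of_nat v / of_nat l))"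

lemma ee_mod: "ee (of_nat (n mod l) / of_nat l) = ee (of_nat n / of_nat l)"
  by (rule ee_of_nat_divide_cong) (simp add: cong_def)

lemma twisted_gauss_sum: "(\<Sum>v<l. \<psi> v * ee (of_nat (n * v) / of_nat l)) = cnj (\<psi> n) * gauss_sum"
proof (cases "l dvd n")
  case True
  then have "ee (of_nat (n * v) / of_nat l) = 1" for v
    using l_gt_1 by (subst ee_of_nat_divide_eq_1_iff) auto
  then show ?thesis using True sum_period by (simp add: eq_0_iff[THEN iffD2] del: of_nat_mult)
next
  case False
  have "(\<Sum>v<l. \<psi> (n * v) * ee (of_nat (n * v) / of_nat l)) = gauss_sum"
    unfolding gauss_sum_def using False
    by (rule sum_mult_argument[where h = "\<lambda>v. \<psi> v * ee (of_nat v / of_nat l)"]) (simp add: chi_mod ee_mod)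
  then have "\<psi> n * (\<Sum>v<l. \<psi> v * ee (of_nat (n * v) / of_nat l)) = gauss_sum"
    by (simp add: mult sum_distrib_left mult_ac del: of_nat_mult)
  with mult_cnj[OF False] show ?thesis by (rule eq_inverse_mult)
qed

text \<open>The twisted sums are the Fourier transform of \<open>\<psi>\<close>. If they all
  vanished, so would \<open>\<psi>\<close> at 1, by Fourier inversion.\<close>

lemma gauss_sum_nonzero: "gauss_sum \<noteq> 0"
proof
  assume "gauss_sum = 0"
  then have "0 = (\<Sum>n<l. cnj (ee (of_nat (n * 1) / of_nat l)) * (\<Sum>v<l. \<psi> v * ee (of_nat (n * v) / of_nat l)))"
    unfolding twisted_gauss_sum by simp
  also have "\<dots> = (\<Sum>v<l. \<psi> v * (\<Sum>n<l. ee (of_nat (n * v) / of_nat l) * cnj (ee (of_nat (n * 1) / of_nat l))))"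
    unfolding sum_distrib_left by (subst sum.swap) (simp add: mult_ac del: of_nat_mult)
  also have "\<dots> = (\<Sum>v<l. \<psi> v * (if [v = 1] (mod l) then of_nat l else 0))"
    using l_gt_1 by (subst sum_ee_orthogonal) auto
  also have "\<dots> = (\<Sum>v<l. if v = 1 then \<psi> v * of_nat l else 0)"
    using l_gt_1 by (intro sum.cong refl) (auto simp: cong_def)
  also have "\<dots> = of_nat l"
    using l_gt_1 by (simp add: sum.delta)
  finally show False using l_gt_1 by simp
qed

definition log_poly :: "real \<Rightarrow> complex" where
  "log_poly x = (\<Sum>n. cnj (\<psi> (Suc n)) * of_real (x ^ Suc n / real (Suc n)))"

text \<open>Abel's limit theorem: the tail bound of Dirichlet's test, with weights
  \<open>x ^ n / n\<close>, is uniform on \<open>[0, 1]\<close>.\<close>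

lemma log_poly_continuous: "continuous_on {0..1} log_poly"
  and log_poly_1: "log_poly 1 = nontrivial_dirichlet_char.L1 (\<lambda>n. cnj (\<psi> n))"
proof -
  interpret c: nontrivial_dirichlet_char l "\<lambda>n. cnj (\<psi> n)" by (rule nontrivial_dirichlet_char_cnj)
  show "log_poly 1 = c.L1" by (simp add: log_poly_def c.L1_def)
  define P where "P = (\<lambda>M x. \<Sum>n<M. cnj (\<psi> (Suc n)) * complex_of_real (x ^ Suc n / real (Suc n)))"
  have "uniform_limit {0..1} P log_poly sequentially"
  proof (rule uniform_limitI)
    fix e :: real assume "e > 0"
    have "(\<lambda>M. 2 * real l / real (Suc M)) \<longlonglongrightarrow> 0"
      by (intro LIMSEQ_Suc[OF lim_const_over_n])
    then have "\<forall>\<^sub>F M in sequentially. 2 * real l / real (Suc M) < e"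
      using \<open>e > 0\<close> by (rule order_tendstoD)
    then show "\<forall>\<^sub>F M in sequentially. \<forall>x\<in>{0..1}. dist (P M x) (log_poly x) < e"
    proof eventually_elim
      case (elim M)
      show ?case
      proof
        fix x :: real assume x: "x \<in> {0..1}"
        have pow: "x ^ Suc n / real (Suc n) \<le> 1 / real (Suc n)" for n
          using x by (intro divide_right_mono power_le_one) auto
        have "decseq (\<lambda>n. x ^ Suc n / real (Suc n))"
          using x by (intro decseq_SucI frac_le power_decreasing) auto
        moreover have "(\<lambda>n. x ^ Suc n / real (Suc n)) \<longlonglongrightarrow> 0"
          using x pow by (intro tendsto_sandwich[OF _ _ tendsto_const LIMSEQ_Suc[OF lim_1_over_n]] always_eventually) auto
        ultimately have "norm (log_poly x - P M x) \<le> 2 * real l * (x ^ Suc M / real (Suc M))"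
          unfolding log_poly_def P_def by (intro Dirichlet_tail c.norm_sum_le)
        also have "\<dots> \<le> 2 * real l * (1 / real (Suc M))"
          using pow by (intro mult_left_mono) auto
        finally show "dist (P M x) (log_poly x) < e"
          using elim by (simp add: dist_norm norm_minus_commute)
      qed
    qed
  qed
  then show "continuous_on {0..1} log_poly"
    by (rule uniform_limit_theorem[rotated])
       (auto simp: P_def simp del: of_real_divide of_nat_Suc power_Suc intro!: always_eventually continuous_intros)
qed

text \<open>Keeps the radial path to the root of unity off the branch cut of \<open>Ln\<close>, up
  to and including its end point.\<close>

lemma one_minus_ee_notin_nonpos_Reals:
  assumes "0 < v" "v < l" "0 \<le> x" "x \<le> 1"
  shows "1 - of_real x * ee (of_nat v / of_nat l) \<notin> \<real>\<^sub>\<le>\<^sub>0"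
proof -
  define z where "z = ee (of_nat v / of_nat l)"
  have "z \<noteq> 1"
    using assms by (auto simp: z_def ee_of_nat_divide_eq_1_iff dest: dvd_imp_le)
  have "norm z = 1"
    using norm_ee[of "of_real (real v / real l)"] by (simp add: z_def)
  have "Re z < 1"
  proof (rule ccontr)
    assume "\<not> Re z < 1"
    then have "Re z = 1" using complex_Re_le_cmod[of z] \<open>norm z = 1\<close> by simp
    moreover have "(Re z)\<^sup>2 + (Im z)\<^sup>2 = 1" using \<open>norm z = 1\<close> by (simp add: cmod_power2[symmetric])
    ultimately have "z = 1" by (simp add: complex_eq_iff)
    with \<open>z \<noteq> 1\<close> show False by simp
  qed
  then have "x * Re z < 1"
    using assms by (smt (verit) mult_le_cancel_left1 mult_left_le)
  then show ?thesis by (simp add: complex_nonpos_Reals_iff z_def[symmetric])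
qed

text \<open>For radius \<open>x < 1\<close> the logarithms are expanded and the sum over
  \<open>v\<close> becomes a twisted Gauss sum, which factors out of the series; then
  \<open>x\<close> tends to 1.\<close>

lemma sum_Ln_eq:
  "(\<Sum>v\<in>{1..<l}. \<psi> v * Ln (1 - ee (of_nat v / of_nat l))) =
    - (gauss_sum * nontrivial_dirichlet_char.L1 (\<lambda>n. cnj (\<psi> n)))"
proof -
  define F where "F = (\<lambda>x::real. \<Sum>v\<in>{1..<l}. \<psi> v * Ln (1 - of_real x * ee (of_nat v / of_nat l)))"
  have range: "{..<l} = insert 0 {1..<l}" using l_gt_1 by auto
  have F_eq: "F x = - (gauss_sum * log_poly x)" if x: "0 \<le> x" "x < 1" for x
  proof -
    define w where "w = (\<lambda>v. of_real x * ee (of_nat v / of_nat l))"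
    have norm_w: "norm (w v) < 1" for v
      using x norm_ee[of "of_real (real v / real l)"] by (simp add: w_def norm_mult)
    have "(\<lambda>n. - (w v ^ n) / of_nat n) sums Ln (1 - w v)" for v
      using Ln_series'[of "- w v"] norm_w[of v] by simp
    then have "(\<lambda>n. - (w v ^ Suc n) / of_nat (Suc n)) sums Ln (1 - w v)" for v
      by (subst sums_Suc_iff) simp
    then have "(\<lambda>n. \<Sum>v\<in>{1..<l}. \<psi> v * (- (w v ^ Suc n) / of_nat (Suc n))) sums F x"
      unfolding F_def w_def by (intro sums_sum sums_mult)
    moreover have "(\<Sum>v\<in>{1..<l}. \<psi> v * (- (w v ^ Suc n) / of_nat (Suc n))) =
        - gauss_sum * (cnj (\<psi> (Suc n)) * of_real (x ^ Suc n / real (Suc n)))" for n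
    proof -
      have "w v ^ Suc n = of_real x ^ Suc n * ee (of_nat (Suc n * v) / of_nat l)" for v
        unfolding w_def power_mult_distrib ee_power by (simp add: ring_distribs)
      then have "(\<Sum>v\<in>{1..<l}. \<psi> v * (- (w v ^ Suc n) / of_nat (Suc n))) =
          (\<Sum>v\<in>{1..<l}. \<psi> v * ee (of_nat (Suc n * v) / of_nat l) * - (of_real x ^ Suc n / of_nat (Suc n)))"
        by (intro sum.cong refl) (simp del: of_nat_mult power_Suc of_nat_Suc mult_Suc)
      also have "\<dots> = - (\<Sum>v<l. \<psi> v * ee (of_nat (Suc n * v) / of_nat l)) * (of_real x ^ Suc n / of_nat (Suc n))"
        unfolding range sum_distrib_right[symmetric] by (simp del: of_nat_mult power_Suc of_nat_Suc mult_Suc)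
      finally have "(\<Sum>v\<in>{1..<l}. \<psi> v * (- (w v ^ Suc n) / of_nat (Suc n))) =
          - (\<Sum>v<l. \<psi> v * ee (of_nat (Suc n * v) / of_nat l)) * (of_real x ^ Suc n / of_nat (Suc n))" .
      then show ?thesis
        unfolding twisted_gauss_sum by (simp add: mult_ac del: power_Suc of_nat_Suc)
    qed
    ultimately have sums: "(\<lambda>n. - gauss_sum * (cnj (\<psi> (Suc n)) * of_real (x ^ Suc n / real (Suc n)))) sums F x"
      by simp
    have "(\<lambda>n. cnj (\<psi> (Suc n)) * of_real (x ^ Suc n / real (Suc n))) sums (F x / - gauss_sum)"
      using sums_divide[OF sums, of "- gauss_sum"] gauss_sum_nonzero by simp
    then have "log_poly x = F x / - gauss_sum"
      unfolding log_poly_def by (rule sums_unique[symmetric])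
    then show ?thesis using gauss_sum_nonzero by simp
  qed
  have "continuous_on {0..1} F"
    unfolding F_def using one_minus_ee_notin_nonpos_Reals
    by (intro continuous_intros) auto
  then have "(F \<longlongrightarrow> F 1) (at_left 1)"
    by (rule continuous_on_Icc_at_leftD) simp
  moreover have "(log_poly \<longlongrightarrow> log_poly 1) (at_left 1)"
    using log_poly_continuous by (rule continuous_on_Icc_at_leftD) simp
  then have "((\<lambda>x. - (gauss_sum * log_poly x)) \<longlongrightarrow> - (gauss_sum * log_poly 1)) (at_left 1)"
    by (intro tendsto_intros)
  moreover have "\<forall>\<^sub>F x in at_left 1. - (gauss_sum * log_poly x) = F x"
    by (rule eventually_mono[OF eventually_at_left_real[of 0 1]]) (auto simp: F_eq)
  ultimately have "F 1 = - (gauss_sum * log_poly 1)"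
    using tendsto_unique[OF trivial_limit_at_left_real] Lim_transform_eventually by blast
  then show ?thesis by (simp add: F_def log_poly_1)
qed

text \<open>The substitution of \<open>l - v\<close> for \<open>v\<close> conjugates the logarithms
  and fixes an even character, so the arguments cancel and only absolute values remain. The index 0,
  where \<open>ln 0\<close> appears, has coefficient \<open>\<psi> 0 = 0\<close>.\<close>

lemma sum_ln_norm_eq:
  assumes even: "\<And>v. 0 < v \<Longrightarrow> v < l \<Longrightarrow> \<psi> (l - v) = \<psi> v"
  shows "(\<Sum>v<l. \<psi> v * of_real (ln (norm (1 - ee (of_nat v / of_nat l))))) =
    - (gauss_sum * nontrivial_dirichlet_char.L1 (\<lambda>n. cnj (\<psi> n)))"
proof -
  define w where "w = (\<lambda>v. 1 - ee (of_nat v / of_nat l))"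
  have w: "w v \<notin> \<real>\<^sub>\<le>\<^sub>0" if "v \<in> {1..<l}" for v
    using one_minus_ee_notin_nonpos_Reals[of v 1] that by (simp add: w_def)
  have refl: "w (l - v) = cnj (w v)" if "v \<in> {1..<l}" for v
  proof -
    have "of_nat (l - v) / of_nat l = (1 - of_real (real v / real l) :: complex)"
      using that by (simp add: of_nat_diff diff_divide_distrib)
    then show ?thesis
      using cnj_ee_of_real[of "real v / real l"] by (simp add: w_def ee_diff ee_minus divide_inverse)
  qed
  have "(\<Sum>v\<in>{1..<l}. \<psi> v * Ln (w v)) = (\<Sum>v\<in>{1..<l}. \<psi> (l - v) * Ln (w (l - v)))"
    by (rule sum.reindex_bij_witness[of _ "\<lambda>v. l - v" "\<lambda>v. l - v"]) auto
  also have "\<dots> = (\<Sum>v\<in>{1..<l}. \<psi> v * cnj (Ln (w v)))"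
    using even refl w by (intro sum.cong refl) (auto simp: cnj_Ln)
  finally have "2 * (\<Sum>v\<in>{1..<l}. \<psi> v * Ln (w v)) = (\<Sum>v\<in>{1..<l}. \<psi> v * (Ln (w v) + cnj (Ln (w v))))"
    by (simp add: sum.distrib ring_distribs)
  also have "\<dots> = (\<Sum>v\<in>{1..<l}. 2 * (\<psi> v * of_real (ln (norm (w v)))))"
  proof (intro sum.cong HOL.refl)
    fix v assume "v \<in> {1..<l}"
    then have "w v \<noteq> 0" using w[of v] by auto
    then show "\<psi> v * (Ln (w v) + cnj (Ln (w v))) = 2 * (\<psi> v * of_real (ln (norm (w v))))"
      by (simp add: complex_add_cnj)
  qed
  finally have "(\<Sum>v\<in>{1..<l}. \<psi> v * of_real (ln (norm (w v)))) = (\<Sum>v\<in>{1..<l}. \<psi> v * Ln (w v))"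
    by (simp add: sum_distrib_left[symmetric])
  moreover have "{..<l} = insert 0 {1..<l}" using l_gt_1 by auto
  ultimately show ?thesis unfolding sum_Ln_eq[symmetric] by (simp add: w_def)
qed

end

context discrete_log
begin

text \<open>The hypothesis is a convolution over \<open>(\<int>/l)\<^sup>\<times>/{1,-1}\<close> of
  the exponents with the logarithms \<open>\<Lambda>\<close>. Characters turn it into a product; the
  transform \<open>S\<close> of \<open>\<Lambda>\<close> is nonzero at nontrivial characters, so the
  transform of the exponents vanishes.\<close>

lemma log_relation_trivial:
  fixes b :: "nat \<Rightarrow> real" and J :: "nat set"
  defines "\<Lambda> \<equiv> \<lambda>n. ln (norm (1 - ee (of_nat n / of_nat l)))"
  assumes J: "finite J" "\<And>j. j \<in> J \<Longrightarrow> \<not> l dvd j"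
    and rel: "\<And>a. \<not> l dvd a \<Longrightarrow> (\<Sum>j\<in>J. b j * (\<Lambda> (2 * j * a) - \<Lambda> (j * a))) = 0"
    and v: "\<not> l dvd v"
  shows "(\<Sum>j\<in>J. b j * (of_bool ([ind (2 * j) = ind v] (mod k)) - of_bool ([ind j = ind v] (mod k)))) = 0"
proof -
  have l2: "\<not> l dvd 2"
    using l_eq k_pos by (auto dest: dvd_imp_le)
  then have J2: "\<not> l dvd 2 * j" if "j \<in> J" for j
    using J(2)[OF that] l_prime by (simp add: prime_dvd_mult_iff)
  have eq: "(\<Sum>j\<in>J. of_real (b j) * (cnj (chr r (2 * j)) - cnj (chr r j))) = 0" if "r < k" for r
  \<comment> \<open>The trivial character is 1 at both \<open>2 * j\<close> and \<open>j\<close>, so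
    the differences vanish by themselves; nonvanishing of \<open>L1\<close> is available only for
    the others.\<close>
  proof (cases "r = 0")
    case True
    then show ?thesis using J(2) J2 by (simp add: chr_def)
  next
    case False
    then interpret nontrivial_dirichlet_char l "chr r"
      using that by (intro nontrivial_dirichlet_char_chr) auto
    define S where "S = (\<Sum>a<l. chr r a * of_real (\<Lambda> a))"
    have "S = - (gauss_sum * nontrivial_dirichlet_char.L1 (\<lambda>n. cnj (chr r n)))"
      unfolding S_def \<Lambda>_def by (rule sum_ln_norm_eq) (rule chr_even)
    also have "(\<lambda>n. cnj (chr r n)) = chr (k - r)"
      using that by (auto simp: cnj_chr)
    finally have "S \<noteq> 0"
      using L1_chr_nonzero[of "k - r"] False that gauss_sum_nonzero by simp
    have tw: "(\<Sum>a<l. chr r a * of_real (\<Lambda> (j * a))) = cnj (chr r j) * S" if "\<not> l dvd j" for j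
    proof -
      have "(\<Sum>a<l. chr r (j * a) * of_real (\<Lambda> (j * a))) = S"
        unfolding S_def using that
        by (rule sum_mult_argument[where h = "\<lambda>a. chr r a * of_real (\<Lambda> a)"]) (simp add: chi_mod ee_mod \<Lambda>_def)
      then have "chr r j * (\<Sum>a<l. chr r a * of_real (\<Lambda> (j * a))) = S"
        by (simp add: mult sum_distrib_left mult_ac)
      with mult_cnj[OF that] show ?thesis by (rule eq_inverse_mult)
    qed
    have "0 = (\<Sum>a<l. chr r a * of_real (\<Sum>j\<in>J. b j * (\<Lambda> (2 * j * a) - \<Lambda> (j * a))))"
    proof (rule sum.neutral[symmetric], rule ballI)
      fix a
      show "chr r a * of_real (\<Sum>j\<in>J. b j * (\<Lambda> (2 * j * a) - \<Lambda> (j * a))) = 0"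
      proof (cases "l dvd a")
        case False
        show ?thesis unfolding rel[OF False] by simp
      qed (simp add: chr_def)
    qed
    also have "\<dots> = (\<Sum>j\<in>J. of_real (b j) * ((\<Sum>a<l. chr r a * of_real (\<Lambda> (2 * j * a))) - (\<Sum>a<l. chr r a * of_real (\<Lambda> (j * a)))))"
      unfolding of_real_sum sum_distrib_left sum_subtractf[symmetric]
      by (subst sum.swap) (simp add: algebra_simps)
    also have "\<dots> = (\<Sum>j\<in>J. of_real (b j) * (cnj (chr r (2 * j)) - cnj (chr r j))) * S"
      unfolding sum_distrib_right
    proof (intro sum.cong refl)
      fix j assume j: "j \<in> J"
      show "of_real (b j) * ((\<Sum>a<l. chr r a * of_real (\<Lambda> (2 * j * a))) - (\<Sum>a<l. chr r a * of_real (\<Lambda> (j * a)))) =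
          of_real (b j) * (cnj (chr r (2 * j)) - cnj (chr r j)) * S"
        unfolding tw[OF J(2)[OF j]] tw[OF J2[OF j]] by (simp add: algebra_simps)
    qed
    finally show ?thesis using \<open>S \<noteq> 0\<close> by simp
  qed
  \<comment> \<open>Fourier inversion: orthogonality over all \<open>r < k\<close> picks out the
    class of \<open>v\<close>.\<close>
  have "0 = (\<Sum>r<k. chr r v * (\<Sum>j\<in>J. of_real (b j) * (cnj (chr r (2 * j)) - cnj (chr r j))))"
    by (rule sum.neutral[symmetric]) (use eq in auto)
  also have "\<dots> = (\<Sum>j\<in>J. of_real (b j) * ((\<Sum>r<k. chr r v * cnj (chr r (2 * j))) - (\<Sum>r<k. chr r v * cnj (chr r j))))"
    unfolding sum_distrib_left sum_subtractf[symmetric]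
    by (subst sum.swap) (simp add: algebra_simps)
  also have "\<dots> = of_real (real k * (\<Sum>j\<in>J. b j * (of_bool ([ind (2 * j) = ind v] (mod k)) - of_bool ([ind j = ind v] (mod k)))))"
    unfolding sum_distrib_left of_real_sum
  proof (intro sum.cong refl)
    fix j assume j: "j \<in> J"
    have orth: "(\<Sum>r<k. chr r v * cnj (chr r u)) = of_real (real k * of_bool ([ind u = ind v] (mod k)))"
      if "\<not> l dvd u" for u
      unfolding chr_orthogonal[OF v that] cong_sym_eq[of "ind v" "ind u"] by simp
    show "of_real (b j) * ((\<Sum>r<k. chr r v * cnj (chr r (2 * j))) - (\<Sum>r<k. chr r v * cnj (chr r j))) =
        (of_real (real k * (b j * (of_bool ([ind (2 * j) = ind v] (mod k)) - of_bool ([ind j = ind v] (mod k))))) :: complex)"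
      unfolding orth[OF J(2)[OF j]] orth[OF J2[OF j]] by (simp only: of_real_mult of_real_diff algebra_simps)
  qed
  finally have "real k * (\<Sum>j\<in>J. b j * (of_bool ([ind (2 * j) = ind v] (mod k)) - of_bool ([ind j = ind v] (mod k)))) = 0"
    by (subst (asm) eq_commute) (simp only: of_real_eq_0_iff)
  then show ?thesis using k_pos by simp
qed

end

section \<open>Ranks of abelian groups\<close>

context comm_group
begin

definition lincomb :: "('i \<Rightarrow> 'a) \<Rightarrow> 'i set \<Rightarrow> ('i \<Rightarrow> int) \<Rightarrow> 'a" where
  "lincomb s I c = (\<Otimes>i\<in>I. s i [^] c i)"

context
  fixes s :: "'i \<Rightarrow> 'a" and I :: "'i set"
  assumes fin: "finite I" and s: "s \<in> I \<rightarrow> carrier G"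
begin

lemma s_closed [simp]: "i \<in> I \<Longrightarrow> s i \<in> carrier G"
  using s by auto

lemma lincomb_closed [simp]: "lincomb s I c \<in> carrier G"
  unfolding lincomb_def by (intro finprod_closed) auto

lemma lincomb_0: "lincomb s I (\<lambda>i. 0) = \<one>"
  unfolding lincomb_def by (simp add: finprod_one_eqI)

lemma lincomb_add: "lincomb s I (\<lambda>i. c i + d i) = lincomb s I c \<otimes> lincomb s I d"
proof -
  have "lincomb s I (\<lambda>i. c i + d i) = (\<Otimes>i\<in>I. s i [^] c i \<otimes> s i [^] d i)"
    unfolding lincomb_def by (intro finprod_cong') (auto simp: int_pow_mult)
  also have "\<dots> = lincomb s I c \<otimes> lincomb s I d"
    unfolding lincomb_def by (intro finprod_multf) auto
  finally show ?thesis .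
qed

lemma lincomb_int_pow: "lincomb s I c [^] (n :: int) = lincomb s I (\<lambda>i. n * c i)"
proof -
  have "(\<Otimes>i\<in>J. s i [^] c i) [^] n = (\<Otimes>i\<in>J. s i [^] (n * c i))" if "J \<subseteq> I" for J
    using finite_subset[OF that fin] that
  proof (induction J rule: finite_induct)
    case (insert i J)
    then have "(\<Otimes>i\<in>J. s i [^] c i) \<in> carrier G" by (intro finprod_closed) auto
    with insert show ?case
      by (simp add: Pi_def int_pow_distrib int_pow_pow subset_iff mult.commute)
  qed (simp add: int_pow_one)
  then show ?thesis by (simp add: lincomb_def)
qed

lemma lincomb_diff_eq_one_iff: "lincomb s I (\<lambda>i. c i - d i) = \<one> \<longleftrightarrow> lincomb s I c = lincomb s I d"
proof -
  have "lincomb s I c = lincomb s I (\<lambda>i. c i - d i) \<otimes> lincomb s I d"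
    using lincomb_add[of "\<lambda>i. c i - d i" d] by simp
  then show ?thesis by (metis l_one lincomb_closed r_cancel_one')
qed

lemma lincomb_indicator: "i \<in> I \<Longrightarrow> lincomb s I (\<lambda>j. if j = i then n else 0) = s i [^] n"
  unfolding lincomb_def using fin
  by (subst finprod_singleton[of i I "\<lambda>i. s i [^] n", symmetric])
     (auto intro!: finprod_cong' simp: Pi_def)

lemma finprod_lincomb_int_pow:
  assumes "finite X"
  shows "(\<Otimes>x\<in>X. lincomb s I (c x) [^] (d x :: int)) = lincomb s I (\<lambda>i. \<Sum>x\<in>X. d x * c x i)"
  using assms
proof (induction X rule: finite_induct)
  case (insert x X)
  have "(\<Otimes>x\<in>insert x X. lincomb s I (c x) [^] d x) = lincomb s I (c x) [^] d x \<otimes> (\<Otimes>x\<in>X. lincomb s I (c x) [^] d x)"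
    using insert by (intro finprod_insert) auto
  then show ?case using insert by (simp add: lincomb_int_pow lincomb_add)
qed (simp add: lincomb_0)

lemma generate_subset_lincomb: "generate G (s ` I) \<subseteq> range (lincomb s I)"
proof
  fix x assume "x \<in> generate G (s ` I)"
  then show "x \<in> range (lincomb s I)"
  proof induction
    case one
    then show ?case using lincomb_0 by (metis rangeI)
  next
    case (incl h)
    then obtain i where "i \<in> I" "h = s i" by auto
    then show ?case using lincomb_indicator[of i 1] by (metis int_pow_1 rangeI s_closed)
  next
    case (inv h)
    then obtain i where "i \<in> I" "h = s i" by auto
    then show ?case using lincomb_indicator[of i "- 1"] by (metis int_pow_1 int_pow_neg rangeI s_closed)
  next
    case (eng h1 h2)
    then obtain c d where "h1 = lincomb s I c" "h2 = lincomb s I d" by auto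
    then show ?case by (simp flip: lincomb_add)
  qed
qed

end

end

text \<open>An independent set of \<open>G\<close> is carried to \<open>H\<close> by writing its
  elements in the generators \<open>a\<close> and using the same coefficients with \<open>b\<close>.
  The coefficients need not be unique; that \<open>b\<close> satisfies no further relations makes
  the images distinct and independent.\<close>

lemma abelian_rank_le_if_same_relations:
  fixes a :: "'i \<Rightarrow> 'a" and b :: "'i \<Rightarrow> 'b"
  assumes G: "comm_group G" and H: "comm_group H" and I: "finite I"
    and a: "a \<in> I \<rightarrow> carrier G" and b: "b \<in> I \<rightarrow> carrier H"
    and span: "carrier G \<subseteq> range (comm_group.lincomb G a I)"
    and rel: "\<And>c. comm_group.lincomb G a I c = \<one>\<^bsub>G\<^esub> \<longleftrightarrow> comm_group.lincomb H b I c = \<one>\<^bsub>H\<^esub>"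
  shows "abelian_rank G \<le> abelian_rank H"
  unfolding abelian_rank_def
proof (rule SUP_least)
  interpret G: comm_group G by fact
  interpret H: comm_group H by fact
  fix S assume "S \<in> {S. finite S \<and> S \<subseteq> carrier G \<and> int_independent G S}"
  then have S: "finite S" "S \<subseteq> carrier G" "int_independent G S" by auto
  have "\<forall>x\<in>S. \<exists>c. x = G.lincomb a I c" using S(2) span by blast
  then obtain c where c: "\<And>x. x \<in> S \<Longrightarrow> x = G.lincomb a I (c x)" by metis
  define y where "y = (\<lambda>x. H.lincomb b I (c x))"
  have inj: "inj_on y S"
  proof (rule inj_onI)
    fix u v assume uv: "u \<in> S" "v \<in> S" "y u = y v"
    then have "H.lincomb b I (\<lambda>i. c u i - c v i) = \<one>\<^bsub>H\<^esub>"
      by (simp add: y_def H.lincomb_diff_eq_one_iff[OF I b])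
    then have "G.lincomb a I (c u) = G.lincomb a I (c v)"
      by (simp add: rel[symmetric] G.lincomb_diff_eq_one_iff[OF I a])
    then show "u = v" using c uv by metis
  qed
  have closed: "y ` S \<subseteq> carrier H"
    by (auto simp: y_def H.lincomb_closed[OF I b])
  have "int_independent H (y ` S)"
    unfolding int_independent_def
  proof (intro allI impI)
    fix d :: "'b \<Rightarrow> int"
    assume "(\<Otimes>\<^bsub>H\<^esub>x\<in>y ` S. x [^]\<^bsub>H\<^esub> d x) = \<one>\<^bsub>H\<^esub>"
    also have "(\<Otimes>\<^bsub>H\<^esub>x\<in>y ` S. x [^]\<^bsub>H\<^esub> d x) = (\<Otimes>\<^bsub>H\<^esub>x\<in>S. y x [^]\<^bsub>H\<^esub> d (y x))"
      using closed inj by (intro H.finprod_reindex) auto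
    also have "\<dots> = H.lincomb b I (\<lambda>i. \<Sum>x\<in>S. d (y x) * c x i)"
      unfolding y_def using S(1) by (rule H.finprod_lincomb_int_pow[OF I b])
    finally have "G.lincomb a I (\<lambda>i. \<Sum>x\<in>S. d (y x) * c x i) = \<one>\<^bsub>G\<^esub>"
      by (simp add: rel)
    then have "(\<Otimes>\<^bsub>G\<^esub>x\<in>S. G.lincomb a I (c x) [^]\<^bsub>G\<^esub> d (y x)) = \<one>\<^bsub>G\<^esub>"
      using G.finprod_lincomb_int_pow[OF I a S(1), of c "\<lambda>x. d (y x)"] by simp
    moreover have "(\<Otimes>\<^bsub>G\<^esub>x\<in>S. G.lincomb a I (c x) [^]\<^bsub>G\<^esub> d (y x)) = (\<Otimes>\<^bsub>G\<^esub>x\<in>S. x [^]\<^bsub>G\<^esub> d (y x))"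
      using S(2) by (intro G.finprod_cong') (auto simp flip: c)
    ultimately show "\<forall>t\<in>y ` S. d t = 0"
      using S(3)[unfolded int_independent_def, rule_format, of "\<lambda>x. d (y x)"] by auto
  qed
  then have "y ` S \<in> {S. finite S \<and> S \<subseteq> carrier H \<and> int_independent H S}"
    using S(1) closed by simp
  then have "enat (card (y ` S)) \<le> (SUP S \<in> {S. finite S \<and> S \<subseteq> carrier H \<and> int_independent H S}. enat (card S))"
    by (rule SUP_upper)
  then show "enat (card S) \<le> (SUP S \<in> {S. finite S \<and> S \<subseteq> carrier H \<and> int_independent H S}. enat (card S))"
    by (simp add: card_image[OF inj])
qed

context comm_group
begin

text \<open>Products in a subgroup are formed with its own operations; their agreement with the
  ambient ones lets relations be tested in the large group.\<close>

lemma lincomb_subgroup_generated: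
  assumes fin: "finite I" and s: "s \<in> I \<rightarrow> carrier (subgroup_generated G S)"
  shows "comm_group.lincomb (subgroup_generated G S) s I c = lincomb s I c"
proof -
  interpret H: comm_group "subgroup_generated G S"
    using comm_group_axioms by (rule abelian_subgroup_generated)
  have sub: "x \<in> carrier G" if "x \<in> carrier (subgroup_generated G S)" for x
    using that carrier_subgroup_generated_subset by blast
  have "(\<Otimes>\<^bsub>subgroup_generated G S\<^esub>i\<in>J. s i [^]\<^bsub>subgroup_generated G S\<^esub> c i) = (\<Otimes>i\<in>J. s i [^] c i)"
    if "J \<subseteq> I" for J
    using finite_subset[OF that fin] that
  proof (induction J rule: finite_induct)
    case (insert i J)
    then have 1: "s j \<in> carrier (subgroup_generated G S)" if "j \<in> insert i J" for j
      using s that by auto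
    then have "s i [^]\<^bsub>subgroup_generated G S\<^esub> c i = s i [^] c i"
      by (simp add: int_pow_subgroup_generated)
    moreover have "(\<Otimes>\<^bsub>subgroup_generated G S\<^esub>i\<in>insert i J. s i [^]\<^bsub>subgroup_generated G S\<^esub> c i) =
        s i [^]\<^bsub>subgroup_generated G S\<^esub> c i \<otimes>\<^bsub>subgroup_generated G S\<^esub>
          (\<Otimes>\<^bsub>subgroup_generated G S\<^esub>i\<in>J. s i [^]\<^bsub>subgroup_generated G S\<^esub> c i)"
      using insert 1 by (intro H.finprod_insert) auto
    moreover have "(\<Otimes>i\<in>insert i J. s i [^] c i) = s i [^] c i \<otimes> (\<Otimes>i\<in>J. s i [^] c i)"
      using insert 1 sub by (intro finprod_insert) auto
    ultimately show ?case using insert by simp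
  qed simp
  then show ?thesis by (simp add: lincomb_def H.lincomb_def)
qed

lemma carrier_subgroup_generated_lincomb:
  assumes fin: "finite I" and s: "s \<in> I \<rightarrow> carrier G"
  shows "carrier (subgroup_generated G (s ` I)) \<subseteq> range (comm_group.lincomb (subgroup_generated G (s ` I)) s I)"
    and "s \<in> I \<rightarrow> carrier (subgroup_generated G (s ` I))"
proof -
  show closed: "s \<in> I \<rightarrow> carrier (subgroup_generated G (s ` I))"
    using s by (auto simp: carrier_subgroup_generated intro: generate.incl)
  have "carrier G \<inter> s ` I = s ` I" using s by auto
  then show "carrier (subgroup_generated G (s ` I)) \<subseteq> range (comm_group.lincomb (subgroup_generated G (s ` I)) s I)"
    using generate_subset_lincomb[OF fin s]
    unfolding carrier_subgroup_generated lincomb_subgroup_generated[OF fin closed, abs_def] by simp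
qed

end

lemma abelian_rank_subgroup_generated_eq:
  fixes a :: "'i \<Rightarrow> 'a" and b :: "'i \<Rightarrow> 'b"
  assumes G: "comm_group G" and H: "comm_group H" and I: "finite I"
    and a: "a \<in> I \<rightarrow> carrier G" and b: "b \<in> I \<rightarrow> carrier H"
    and rel: "\<And>c. comm_group.lincomb G a I c = \<one>\<^bsub>G\<^esub> \<longleftrightarrow> comm_group.lincomb H b I c = \<one>\<^bsub>H\<^esub>"
  shows "abelian_rank (subgroup_generated G (a ` I)) = abelian_rank (subgroup_generated H (b ` I))"
proof -
  interpret G: comm_group G by fact
  interpret H: comm_group H by fact
  have G': "comm_group (subgroup_generated G (a ` I))" and H': "comm_group (subgroup_generated H (b ` I))"
    using G.abelian_subgroup_generated H.abelian_subgroup_generated G H by blast+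
  note lin = G.lincomb_subgroup_generated[OF I G.carrier_subgroup_generated_lincomb(2)[OF I a]]
    H.lincomb_subgroup_generated[OF I H.carrier_subgroup_generated_lincomb(2)[OF I b]]
  note span = G.carrier_subgroup_generated_lincomb[OF I a] H.carrier_subgroup_generated_lincomb[OF I b]
  show ?thesis
  proof (rule antisym)
    show "abelian_rank (subgroup_generated G (a ` I)) \<le> abelian_rank (subgroup_generated H (b ` I))"
      by (rule abelian_rank_le_if_same_relations[OF G' H' I span(2,4,1)]) (simp add: lin rel)
    show "abelian_rank (subgroup_generated H (b ` I)) \<le> abelian_rank (subgroup_generated G (a ` I))"
      by (rule abelian_rank_le_if_same_relations[OF H' G' I span(4,2,3)]) (simp add: lin rel)
  qed
qed

section \<open>Combinations of complex numbers and of functions\<close>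

lemma mult_complex_mult_group: "x \<otimes>\<^bsub>complex_mult_group\<^esub> y = x * y"
  and one_complex_mult_group: "\<one>\<^bsub>complex_mult_group\<^esub> = 1"
  by (simp_all add: complex_mult_group_def)

lemma int_pow_complex_mult_group:
  assumes "x \<noteq> 0"
  shows "x [^]\<^bsub>complex_mult_group\<^esub> (n :: int) = x powi n"
proof -
  interpret comm_group complex_mult_group by (rule comm_group_complex_mult_group)
  have nat: "x [^]\<^bsub>complex_mult_group\<^esub> (m :: nat) = x ^ m" for m
    by (induction m) (simp_all add: complex_mult_group_def)
  have "inv\<^bsub>complex_mult_group\<^esub> (x ^ m) = inverse (x ^ m)" for m
    using assms by (intro inv_equality) (auto simp: complex_mult_group_def)
  then show ?thesis
    by (auto simp: int_pow_def2 nat power_int_def power_inverse)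
qed

lemma lincomb_complex_mult_group:
  assumes "finite I" "\<And>i. i \<in> I \<Longrightarrow> s i \<noteq> 0"
  shows "comm_group.lincomb complex_mult_group s I c = (\<Prod>i\<in>I. s i powi c i)"
proof -
  interpret comm_group complex_mult_group by (rule comm_group_complex_mult_group)
  have closed: "s i [^]\<^bsub>complex_mult_group\<^esub> c i \<in> carrier complex_mult_group" if "i \<in> I" for i
    using assms(2)[OF that] by (intro int_pow_closed) (simp add: complex_mult_group_def)
  show ?thesis
    unfolding lincomb_def using assms closed
  proof (induction I rule: finite_induct)
    case (insert i I)
    then show ?case
      by (subst finprod_insert) (auto simp: int_pow_complex_mult_group mult_complex_mult_group)
  qed (simp add: one_complex_mult_group)
qed

text \<open>Evaluation at \<open>t\<close> is a homomorphism, so relations between functions can be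
  tested pointwise.\<close>

lemma lincomb_function_group:
  assumes I: "finite I" and s: "s \<in> I \<rightarrow> carrier function_group" and t: "t \<in> upper_half_plane"
  shows "comm_group.lincomb function_group s I c t = (\<Prod>i\<in>I. s i t powi c i)"
proof -
  interpret C: comm_group complex_mult_group by (rule comm_group_complex_mult_group)
  interpret F: comm_group function_group by (rule comm_group_function_group)
  have hom: "(\<lambda>f. f t) \<in> hom function_group complex_mult_group"
    using t by (auto simp: hom_def function_group_def)
  interpret group_hom function_group complex_mult_group "\<lambda>f. f t"
    by unfold_locales (rule hom)
  have "(\<lambda>f. f t) (F.lincomb s I c) = C.lincomb (\<lambda>i. s i t) I c"
    unfolding F.lincomb_def C.lincomb_def using I s
  proof (induction I rule: finite_induct)
    case (insert i I)
    then have s: "s j \<in> carrier function_group" if "j \<in> insert i I" for j using that by auto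
    have "(\<Otimes>\<^bsub>function_group\<^esub>i\<in>insert i I. s i [^]\<^bsub>function_group\<^esub> c i) =
        s i [^]\<^bsub>function_group\<^esub> c i \<otimes>\<^bsub>function_group\<^esub> (\<Otimes>\<^bsub>function_group\<^esub>i\<in>I. s i [^]\<^bsub>function_group\<^esub> c i)"
      using insert(1,2) s by (intro F.finprod_insert) auto
    moreover have "(\<Otimes>\<^bsub>complex_mult_group\<^esub>i\<in>insert i I. s i t [^]\<^bsub>complex_mult_group\<^esub> c i) =
        s i t [^]\<^bsub>complex_mult_group\<^esub> c i \<otimes>\<^bsub>complex_mult_group\<^esub> (\<Otimes>\<^bsub>complex_mult_group\<^esub>i\<in>I. s i t [^]\<^bsub>complex_mult_group\<^esub> c i)"
      using insert(1,2) s by (intro C.finprod_insert) auto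
    moreover have "(\<Otimes>\<^bsub>function_group\<^esub>i\<in>I. s i [^]\<^bsub>function_group\<^esub> c i) t = (\<Otimes>\<^bsub>complex_mult_group\<^esub>i\<in>I. s i t [^]\<^bsub>complex_mult_group\<^esub> c i)"
      using insert by auto
    ultimately show ?case
      using s by (simp add: hom_mult hom_int_pow F.finprod_closed Pi_def)
  qed (use hom_one in simp)
  also have "\<dots> = (\<Prod>i\<in>I. s i t powi c i)"
    using I s t by (intro lincomb_complex_mult_group) (auto simp: function_group_def complex_mult_group_def Pi_def PiE_def)
  finally show ?thesis .
qed

section \<open>Multiplicative relations\<close>

lemma power_int_sum:
  fixes x :: "'a :: field"
  assumes "x \<noteq> 0"
  shows "x powi (\<Sum>i\<in>A. f i) = (\<Prod>i\<in>A. x powi f i)"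
  by (induction A rule: infinite_finite_induct) (auto simp: power_int_add assms)

lemma power_int_prod:
  fixes f :: "'i \<Rightarrow> 'a :: field"
  shows "(\<Prod>i\<in>A. f i) powi n = (\<Prod>i\<in>A. f i powi n)"
  by (induction A rule: infinite_finite_induct) (auto simp: power_int_mult_distrib)

text \<open>Factor \<open>j\<close> occurs in the partial products with \<open>m \<ge> j\<close>.
  This passes from the exponents of the \<open>s_fun l m\<close> to those of the single quotients
  \<open>g(2j)/g(j)\<close>.\<close>

lemma prod_partial_products_power_int:
  fixes f :: "nat \<Rightarrow> 'a :: field"
  assumes "\<And>j. j \<in> {1..K} \<Longrightarrow> f j \<noteq> 0"
  shows "(\<Prod>m=1..K. (\<Prod>j=1..m. f j) powi c m) = (\<Prod>j=1..K. f j powi (\<Sum>m=j..K. c m))"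
proof -
  have "(\<Prod>m=1..K. (\<Prod>j=1..m. f j) powi c m) = (\<Prod>m=1..K. \<Prod>j | j \<in> {1..K} \<and> j \<le> m. f j powi c m)"
    unfolding power_int_prod by (intro prod.cong refl) auto
  also have "\<dots> = (\<Prod>j=1..K. \<Prod>m | m \<in> {1..K} \<and> j \<le> m. f j powi c m)"
    by (rule prod.swap_restrict) auto
  also have "\<dots> = (\<Prod>j=1..K. f j powi (\<Sum>m=j..K. c m))"
  proof (intro prod.cong refl)
    fix j assume j: "j \<in> {1..K}"
    then have eq: "{m. m \<in> {1..K} \<and> j \<le> m} = {j..K}" by auto
    show "(\<Prod>m | m \<in> {1..K} \<and> j \<le> m. f j powi c m) = f j powi (\<Sum>m=j..K. c m)"
      unfolding eq power_int_sum[OF assms[OF j]] ..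
  qed
  finally show ?thesis .
qed

text \<open>Clearing denominators turns a multiplicative relation into an integer polynomial relation.\<close>

lemma prod_quotient_power_int_eq_1_iff:
  fixes x y :: "'i \<Rightarrow> complex"
  assumes "finite J" "\<And>j. j \<in> J \<Longrightarrow> x j \<noteq> 0" "\<And>j. j \<in> J \<Longrightarrow> y j \<noteq> 0"
  shows "(\<Prod>j\<in>J. ((y j / x j) ^ N) powi b j) = 1 \<longleftrightarrow>
    (\<Prod>j\<in>J. y j ^ (N * nat (b j)) * x j ^ (N * nat (- b j))) =
    (\<Prod>j\<in>J. x j ^ (N * nat (b j)) * y j ^ (N * nat (- b j)))"
proof -
  have "((y j / x j) ^ N) powi b j =
      (y j ^ (N * nat (b j)) * x j ^ (N * nat (- b j))) / (x j ^ (N * nat (b j)) * y j ^ (N * nat (- b j)))"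
    if "j \<in> J" for j
    using assms(2,3)[OF that]
    by (cases "b j \<ge> 0") (auto simp: power_int_def power_divide power_mult field_simps)
  then have "(\<Prod>j\<in>J. ((y j / x j) ^ N) powi b j) =
      (\<Prod>j\<in>J. y j ^ (N * nat (b j)) * x j ^ (N * nat (- b j))) /
      (\<Prod>j\<in>J. x j ^ (N * nat (b j)) * y j ^ (N * nat (- b j)))"
    by (simp add: prod_dividef)
  moreover have "(\<Prod>j\<in>J. x j ^ (N * nat (b j)) * y j ^ (N * nat (- b j))) \<noteq> 0"
    using assms by auto
  ultimately show ?thesis by simp
qed

lemma ln_prod_power_int:
  fixes z :: "'i \<Rightarrow> complex"
  assumes "finite J" "\<And>j. j \<in> J \<Longrightarrow> z j \<noteq> 0"
  shows "ln (norm (\<Prod>j\<in>J. z j powi b j)) = (\<Sum>j\<in>J. of_int (b j) * ln (norm (z j)))"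
  using assms
proof (induction J rule: finite_induct)
  case (insert i J)
  then have "(\<Prod>j\<in>J. z j powi b j) \<noteq> 0" by simp
  moreover have "ln (norm (z i) powi b i) = of_int (b i) * ln (norm (z i))"
    using insert.prems[of i] by (cases "b i \<ge> 0") (auto simp: power_int_def ln_realpow ln_inverse)
  ultimately show ?case
    using insert by (simp add: norm_mult norm_power_int ln_mult)
qed simp

context discrete_log
begin

lemma not_dvd_if_less: "0 < j \<Longrightarrow> j < l \<Longrightarrow> \<not> l dvd j"
  by (auto dest: dvd_imp_le)

lemma not_dvd_double: "\<not> l dvd j \<Longrightarrow> \<not> l dvd 2 * j"
proof -
  assume "\<not> l dvd j"
  moreover have "\<not> l dvd 2" using l_eq k_pos by (intro not_dvd_if_less) auto
  ultimately show ?thesis using l_prime by (simp add: prime_dvd_mult_iff)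
qed

lemma one_minus_ee_nonzero: "\<not> l dvd j \<Longrightarrow> 1 - ee (of_nat j / of_nat l) \<noteq> 0"
  using ee_of_nat_divide_eq_1_iff[of l j] l_eq by (auto simp del: of_nat_mult)

text \<open>A power of the relation, cleared of denominators, is an integer polynomial relation for
  a primitive \<open>l\<close>-th root of unity, so it also holds for its \<open>a\<close>-th power.
  Taking the power forgets a root of unity, which logarithms of absolute values do not see.\<close>

lemma value_relation_log:
  fixes b :: "nat \<Rightarrow> int"
  assumes J: "finite J" "\<And>j. j \<in> J \<Longrightarrow> \<not> l dvd j"
    and rel: "(\<Prod>j\<in>J. (zeta_pow l (- real j / 2) *
        ((1 - zeta_pow l (2 * real j)) / (1 - zeta_pow l (real j)))) powi b j) = 1"
    and a: "\<not> l dvd a"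
  shows "(\<Sum>j\<in>J. of_int (b j) * (ln (norm (1 - ee (of_nat (2 * j * a) / of_nat l))) -
    ln (norm (1 - ee (of_nat (j * a) / of_nat l))))) = 0"
proof -
  have l0: "l > 0" using l_eq by simp
  \<comment> \<open>The exponent \<open>2 * l\<close> removes the half-integral powers of the root
    of unity, which are not polynomials in it.\<close>
  define N where "N = 2 * l"
  define x where "x = (\<lambda>a j. 1 - ee (of_nat a / of_nat l) ^ j)"
  define y where "y = (\<lambda>a j. 1 - ee (of_nat a / of_nat l) ^ (2 * j))"
  have x_eq: "x a j = 1 - ee (of_nat (j * a) / of_nat l)" for a j
    by (simp add: x_def ee_power)
  have y_eq: "y a j = 1 - ee (of_nat (2 * j * a) / of_nat l)" for a j
    by (simp add: y_def ee_power)
  have x0: "x a j \<noteq> 0" and y0: "y a j \<noteq> 0" if "j \<in> J" "\<not> l dvd a" for a j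
  proof -
    have 1: "\<not> l dvd j * a" using J(2)[OF that(1)] that(2) l_prime by (simp add: prime_dvd_mult_iff)
    then have 2: "\<not> l dvd 2 * j * a" using not_dvd_double[of "j * a"] by (simp add: mult.assoc)
    show "x a j \<noteq> 0" unfolding x_eq using 1 by (rule one_minus_ee_nonzero)
    show "y a j \<noteq> 0" unfolding y_eq using 2 by (rule one_minus_ee_nonzero)
  qed
  have l1: "\<not> l dvd 1" using l_prime by (auto dest: prime_gt_1_nat)
  define f where "f = (\<lambda>j. zeta_pow l (- real j / 2) *
        ((1 - zeta_pow l (2 * real j)) / (1 - zeta_pow l (real j))))"
  have f_N: "f j ^ N = (y 1 j / x 1 j) ^ N" for j
  proof -
    have "zeta_pow l (- real j / 2) ^ N = ee (of_int (- int j))"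
      unfolding zeta_pow_conv_ee ee_power using l0
      by (intro arg_cong[of _ _ ee]) (simp add: N_def field_simps)
    then have "zeta_pow l (- real j / 2) ^ N = 1" by (simp only: ee_of_int)
    moreover have "1 - zeta_pow l (2 * real j) = y 1 j" "1 - zeta_pow l (real j) = x 1 j"
      by (simp_all add: zeta_pow_conv_ee x_eq y_eq)
    ultimately show ?thesis by (simp only: f_def power_mult_distrib mult_1)
  qed
  have "(\<Prod>j\<in>J. ((y 1 j / x 1 j) ^ N) powi b j) = (\<Prod>j\<in>J. f j powi b j) powi int N"
    unfolding f_N[symmetric] power_int_prod by (simp add: power_int_mult[symmetric] mult.commute flip: power_int_of_nat)
  also have "\<dots> = 1" using rel by (simp add: f_def)
  finally have 1: "(\<Prod>j\<in>J. y 1 j ^ (N * nat (b j)) * x 1 j ^ (N * nat (- b j))) =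
      (\<Prod>j\<in>J. x 1 j ^ (N * nat (b j)) * y 1 j ^ (N * nat (- b j)))"
    using x0 y0 l1 by (subst (asm) prod_quotient_power_int_eq_1_iff[OF J(1)]) auto
  define X Y :: "nat \<Rightarrow> int poly" where "X = (\<lambda>j. 1 - Polynomial.monom 1 j)" and "Y = (\<lambda>j. 1 - Polynomial.monom 1 (2 * j))"
  define P where "P = (\<Prod>j\<in>J. Y j ^ (N * nat (b j)) * X j ^ (N * nat (- b j))) -
      (\<Prod>j\<in>J. X j ^ (N * nat (b j)) * Y j ^ (N * nat (- b j)))"
  have P: "eval_int_poly (ee (of_nat a / of_nat l)) P = (\<Prod>j\<in>J. y a j ^ (N * nat (b j)) * x a j ^ (N * nat (- b j))) -
      (\<Prod>j\<in>J. x a j ^ (N * nat (b j)) * y a j ^ (N * nat (- b j)))" for a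
    by (simp add: P_def X_def Y_def x_def y_def)
  have root: "ee (of_nat a / of_nat l) ^ l = 1" "ee (of_nat a / of_nat l) \<noteq> 1" if "\<not> l dvd a" for a
    using one_minus_ee_nonzero[OF that] l0 by (auto simp: ee_power)
  have "eval_int_poly (ee (of_nat a / of_nat l)) P = 0"
    using conjugate_root_of_unity[OF l_prime root[OF l1] root[OF a], of P] 1 P[of 1] by simp
  then have "(\<Prod>j\<in>J. ((y a j / x a j) ^ N) powi b j) = 1"
    using x0 y0 a by (subst prod_quotient_power_int_eq_1_iff[OF J(1)]) (auto simp: P)
  then have "(\<Sum>j\<in>J. of_int (b j) * ln (norm ((y a j / x a j) ^ N))) = 0"
    using x0 y0 a by (subst ln_prod_power_int[OF J(1), symmetric]) auto
  moreover have "ln (norm ((y a j / x a j) ^ N)) = real N * (ln (norm (y a j)) - ln (norm (x a j)))" if "j \<in> J" for j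
    using x0[OF that a] y0[OF that a] by (simp add: norm_power norm_divide ln_realpow ln_div)
  ultimately have "(\<Sum>j\<in>J. of_int (b j) * (real N * (ln (norm (y a j)) - ln (norm (x a j))))) = 0"
    by simp
  also have "(\<Sum>j\<in>J. of_int (b j) * (real N * (ln (norm (y a j)) - ln (norm (x a j))))) =
      real N * (\<Sum>j\<in>J. of_int (b j) * (ln (norm (y a j)) - ln (norm (x a j))))"
    unfolding sum_distrib_left by (simp only: mult_ac)
  finally show ?thesis using l0 by (simp add: N_def x_eq y_eq)
qed

text \<open>Up to the symmetry \<open>a \<mapsto> 1 - a\<close> of the Siegel functions, the index \<open>v\<close> only matters through
  its class in \<open>(\<int>/l)\<^sup>\<times> / {1, -1}\<close>, which the discrete logarithm modulo \<open>k\<close> identifies.\<close>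

lemma siegel_ind_cong:
  assumes u: "0 < u" "u < l" and v: "0 < v" "v < l" and ind: "[ind u = ind v] (mod k)" and t: "Im t > 0"
  shows "siegel (real u / real l) t = siegel (real v / real l) t"
proof -
  have "l dvd u + v \<or> [u = v] (mod l)"
    using ind ind_cong_iff[OF not_dvd_if_less[OF u] not_dvd_if_less[OF v]] by simp
  then show ?thesis
  proof
    assume "l dvd u + v"
    then obtain i where i: "u + v = l * i" by blast
    have "0 < l * i" "l * i < l * 2" using u v unfolding i[symmetric] by auto
    then have "i = 1" by auto
    then have "real u + real v = real l" using i by (simp flip: of_nat_add)
    then have "real u / real l = 1 - real v / real l"
      using l_eq by (simp add: field_simps)
    then show ?thesis using siegel_one_minus[OF t] by simp
  next
    assume "[u = v] (mod l)"
    then have "u = v" using u(2) v(2) by (rule cong_less_modulus_unique_nat)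
    then show ?thesis by simp
  qed
qed

text \<open>Every Siegel function is replaced by that of a chosen representative of its class modulo
  sign. The exponents then add up class by class, and the hypothesis says that each sum is
  0.\<close>

lemma siegel_relation:
  fixes b :: "nat \<Rightarrow> int"
  assumes J: "finite J" "\<And>j. j \<in> J \<Longrightarrow> 0 < j \<and> 2 * j < l"
    and rel: "\<And>v. \<not> l dvd v \<Longrightarrow>
      (\<Sum>j\<in>J. b j * (of_bool ([ind (2 * j) = ind v] (mod k)) - of_bool ([ind j = ind v] (mod k)))) = 0"
    and t: "Im t > 0"
  shows "(\<Prod>j\<in>J. (siegel (2 * real j / real l) t / siegel (real j / real l) t) powi b j) = 1"
proof -
  define \<gamma> where "\<gamma> = (\<lambda>v::nat. siegel (real v / real l) t)"
  define cls where "cls = (\<lambda>v. ind v mod k)"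
  define C where "C = cls ` {1..<l}"
  define rep where "rep = inv_into {1..<l} cls"
  have rep: "rep c \<in> {1..<l}" "cls (rep c) = c" if "c \<in> C" for c
    using that inv_into_into[of c cls "{1..<l}"] f_inv_into_f[of c cls "{1..<l}"]
    unfolding C_def rep_def by blast+
  have \<gamma>_nz: "\<gamma> v \<noteq> 0" if "v \<in> {1..<l}" for v
    unfolding \<gamma>_def using that t by (intro siegel_nonzero) auto
  have cls_rep: "\<gamma> v powi n = (\<Prod>c\<in>C. \<gamma> (rep c) powi (n * of_bool (cls v = c)))" if v: "v \<in> {1..<l}" for v n
  proof -
    have c: "cls v \<in> C" using v by (simp add: C_def)
    have "\<gamma> v = \<gamma> (rep (cls v))"
      unfolding \<gamma>_def using v rep[OF c] t by (intro siegel_ind_cong) (auto simp: cls_def cong_def)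
    then have "\<gamma> v powi n = (\<Prod>c\<in>C. if c = cls v then \<gamma> (rep c) powi n else 1)"
      using c by (simp add: C_def prod.delta)
    also have "\<dots> = (\<Prod>c\<in>C. \<gamma> (rep c) powi (n * of_bool (cls v = c)))"
      by (intro prod.cong refl) auto
    finally show ?thesis .
  qed
  have "(\<Prod>j\<in>J. (siegel (2 * real j / real l) t / siegel (real j / real l) t) powi b j) =
      (\<Prod>j\<in>J. \<Prod>c\<in>C. \<gamma> (rep c) powi (b j * (of_bool (cls (2 * j) = c) - of_bool (cls j = c))))"
  proof (intro prod.cong refl)
    fix j assume "j \<in> J"
    then have j: "2 * j \<in> {1..<l}" "j \<in> {1..<l}" using J(2)[of j] by auto
    have "(siegel (2 * real j / real l) t / siegel (real j / real l) t) powi b j = \<gamma> (2 * j) powi b j / \<gamma> j powi b j"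
      by (simp add: \<gamma>_def power_int_divide_distrib)
    also have "\<dots> = (\<Prod>c\<in>C. \<gamma> (rep c) powi (b j * of_bool (cls (2 * j) = c)) / \<gamma> (rep c) powi (b j * of_bool (cls j = c)))"
      unfolding cls_rep[OF j(1)] cls_rep[OF j(2)] by (rule prod_dividef[symmetric])
    also have "\<dots> = (\<Prod>c\<in>C. \<gamma> (rep c) powi (b j * (of_bool (cls (2 * j) = c) - of_bool (cls j = c))))"
      unfolding right_diff_distrib using \<gamma>_nz rep(1) by (intro prod.cong refl power_int_diff[symmetric]) auto
    finally show "(siegel (2 * real j / real l) t / siegel (real j / real l) t) powi b j =
      (\<Prod>c\<in>C. \<gamma> (rep c) powi (b j * (of_bool (cls (2 * j) = c) - of_bool (cls j = c))))" .
  qed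
  also have "\<dots> = (\<Prod>c\<in>C. \<gamma> (rep c) powi (\<Sum>j\<in>J. b j * (of_bool (cls (2 * j) = c) - of_bool (cls j = c))))"
    using \<gamma>_nz rep(1) by (subst prod.swap) (simp add: power_int_sum)
  also have "\<dots> = 1"
  proof (rule prod.neutral, rule ballI)
    fix c assume c: "c \<in> C"
    have "\<not> l dvd rep c" using rep(1)[OF c] by (intro not_dvd_if_less) auto
    from rel[OF this] have "(\<Sum>j\<in>J. b j * (of_bool (cls (2 * j) = c) - of_bool (cls j = c))) = 0"
      using rep(2)[OF c] by (simp add: cls_def cong_def)
    then show "\<gamma> (rep c) powi (\<Sum>j\<in>J. b j * (of_bool (cls (2 * j) = c) - of_bool (cls j = c))) = 1"
      by simp
  qed
  finally show ?thesis .
qed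

lemma s_fun_relation_iff:
  "(\<Prod>m=1..k-1. s_value l m powi c m) = 1 \<longleftrightarrow>
    (\<forall>t. Im t > 0 \<longrightarrow> (\<Prod>m=1..k-1. s_fun l m t powi c m) = 1)"
proof
  assume fun_rel: "\<forall>t. Im t > 0 \<longrightarrow> (\<Prod>m=1..k-1. s_fun l m t powi c m) = 1"
  have "s_value l m \<noteq> 0" if "m \<in> {1..k-1}" for m
    unfolding s_value_def using that l_eq zeta_pow_of_nat_neq_1[of "2 * _" l] zeta_pow_of_nat_neq_1[of _ l]
    by auto
  then have "((\<lambda>t. \<Prod>m=1..k-1. s_fun l m t powi c m) \<longlongrightarrow> (\<Prod>m=1..k-1. s_value l m powi c m)) at_cusp_zero"
    using l_eq by (intro tendsto_prod tendsto_power_int s_fun_tendsto) auto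
  moreover have "((\<lambda>t. \<Prod>m=1..k-1. s_fun l m t powi c m) \<longlongrightarrow> 1) at_cusp_zero"
    by (rule tendsto_eventually) (rule eventually_mono[OF eventually_at_cusp_zero_Im_pos], use fun_rel in auto)
  ultimately show "(\<Prod>m=1..k-1. s_value l m powi c m) = 1"
    using tendsto_unique at_cusp_zero_neq_bot by blast
next
  assume val_rel: "(\<Prod>m=1..k-1. s_value l m powi c m) = 1"
  define b where "b = (\<lambda>j. \<Sum>m=j..k-1. c m)"
  have J: "\<not> l dvd j" "0 < j" "2 * j < l" if "j \<in> {1..k-1}" for j
  proof -
    show "0 < j" "2 * j < l" using that l_eq by auto
    then show "\<not> l dvd j" by (intro not_dvd_if_less) auto
  qed
  have "zeta_pow l (- real j / 2) * ((1 - zeta_pow l (2 * real j)) / (1 - zeta_pow l (real j))) \<noteq> 0"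
    if "j \<in> {1..k-1}" for j
    using zeta_pow_of_nat_neq_1[of "2 * j" l] zeta_pow_of_nat_neq_1[of j l] J[OF that] by simp
  then have "(\<Prod>j=1..k-1. (zeta_pow l (- real j / 2) *
      ((1 - zeta_pow l (2 * real j)) / (1 - zeta_pow l (real j)))) powi b j) = 1"
    using val_rel unfolding s_value_def b_def by (subst (asm) prod_partial_products_power_int) auto
  then have log_rel: "(\<Sum>j=1..k-1. of_int (b j) * (ln (norm (1 - ee (of_nat (2 * j * a) / of_nat l))) -
      ln (norm (1 - ee (of_nat (j * a) / of_nat l))))) = 0" if "\<not> l dvd a" for a
    using that J by (intro value_relation_log) auto
  have rel: "(\<Sum>j=1..k-1. b j * (of_bool ([ind (2 * j) = ind v] (mod k)) - of_bool ([ind j = ind v] (mod k)))) = 0"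
    if "\<not> l dvd v" for v
  proof -
    have "(\<Sum>j=1..k-1. of_int (b j) * (of_bool ([ind (2 * j) = ind v] (mod k)) - of_bool ([ind j = ind v] (mod k)))) = (0 :: real)"
      using J log_rel that by (intro log_relation_trivial) auto
    also have "(\<Sum>j=1..k-1. of_int (b j) * (of_bool ([ind (2 * j) = ind v] (mod k)) - of_bool ([ind j = ind v] (mod k)))) =
        real_of_int (\<Sum>j=1..k-1. b j * (of_bool ([ind (2 * j) = ind v] (mod k)) - of_bool ([ind j = ind v] (mod k))))"
      by simp
    finally show ?thesis by (simp only: of_int_eq_0_iff)
  qed
  show "\<forall>t. Im t > 0 \<longrightarrow> (\<Prod>m=1..k-1. s_fun l m t powi c m) = 1"
  proof (intro allI impI)
    fix t :: complex assume "Im t > 0"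
    then have t: "Im (of_nat l * t) > 0" using l_eq by simp
    have "siegel (2 * real j / real l) (of_nat l * t) / siegel (real j / real l) (of_nat l * t) \<noteq> 0"
      if "j \<in> {1..k-1}" for j
      using J[OF that] t siegel_nonzero[of "2 * real j / real l" "of_nat l * t"]
        siegel_nonzero[of "real j / real l" "of_nat l * t"] by simp
    then have "(\<Prod>m=1..k-1. s_fun l m t powi c m) =
        (\<Prod>j=1..k-1. (siegel (2 * real j / real l) (of_nat l * t) / siegel (real j / real l) (of_nat l * t)) powi b j)"
      unfolding s_fun_def b_def by (rule prod_partial_products_power_int)
    also have "\<dots> = 1"
      using J rel t by (intro siegel_relation) auto
    finally show "(\<Prod>m=1..k-1. s_fun l m t powi c m) = 1" .
  qed
qed

end

theorem theorem1p4:
  fixes l k :: nat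
  assumes "prime l" and "l = 2 * k + 1" and "l \<ge> 5"
  shows "(\<forall>m\<in>{1..k - 1}.
            (s_fun l m \<longlongrightarrow> s_value l m) at_cusp_zero \<and>
            s_value l m \<in> carrier (cyclotomic_unit_group l)) \<and>
         abelian_rank (subgroup_generated (cyclotomic_unit_group l) (s_value l ` {1..k - 1}))
           = abelian_rank (U_R l k)"
proof (intro conjI ballI)
  have units: "s_value l m \<in> carrier (cyclotomic_unit_group l)" if "m \<in> {1..k - 1}" for m
    using that assms by (intro s_value_in_cyclotomic_unit_group) auto
  then show "s_value l m \<in> carrier (cyclotomic_unit_group l)" if "m \<in> {1..k - 1}" for m
    using that .
  show "(s_fun l m \<longlongrightarrow> s_value l m) at_cusp_zero" if "m \<in> {1..k - 1}" for m
    using that assms by (intro s_fun_tendsto) auto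
  obtain ind where "discrete_log l k ind"
    using discrete_log_exists[of l k] assms by auto
  then interpret discrete_log l k ind .
  interpret C: comm_group complex_mult_group by (rule comm_group_complex_mult_group)
  interpret U: comm_group "cyclotomic_unit_group l"
    unfolding cyclotomic_unit_group_def
    using comm_group_complex_mult_group by (rule C.abelian_subgroup_generated)
  interpret F: comm_group function_group by (rule comm_group_function_group)
  define S where "S = (\<lambda>m. restrict (s_fun l m) upper_half_plane)"
  have S: "S \<in> {1..k - 1} \<rightarrow> carrier function_group"
    unfolding S_def using assms by (intro Pi_I s_fun_in_function_group) auto
  have units': "s_value l \<in> {1..k - 1} \<rightarrow> carrier (cyclotomic_unit_group l)"
    using units by blast
  \<comment> \<open>Members of \<open>function_group\<close> take the default value off the upper
    half-plane, so only the values on it are compared.\<close>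
  have one: "x \<in> carrier function_group \<Longrightarrow> x = \<one>\<^bsub>function_group\<^esub> \<longleftrightarrow> (\<forall>t\<in>upper_half_plane. x t = 1)" for x
    by (auto simp: function_group_def complex_mult_group_def PiE_def extensional_def fun_eq_iff)
  have "U.lincomb (s_value l) {1..k - 1} c = \<one>\<^bsub>cyclotomic_unit_group l\<^esub> \<longleftrightarrow>
      F.lincomb S {1..k - 1} c = \<one>\<^bsub>function_group\<^esub>" for c
  proof -
    have "s_value l m \<noteq> 0" if "m \<in> {1..k - 1}" for m
      using units[OF that] C.carrier_subgroup_generated_subset
      by (auto simp: cyclotomic_unit_group_def complex_mult_group_def)
    then have "C.lincomb (s_value l) {1..k - 1} c = (\<Prod>m=1..k - 1. s_value l m powi c m)"
      by (intro lincomb_complex_mult_group) auto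
    moreover have "U.lincomb (s_value l) {1..k - 1} c = C.lincomb (s_value l) {1..k - 1} c"
      unfolding cyclotomic_unit_group_def
      by (rule C.lincomb_subgroup_generated[OF _ units'[unfolded cyclotomic_unit_group_def]]) simp
    moreover have "\<one>\<^bsub>cyclotomic_unit_group l\<^esub> = 1"
      by (simp add: cyclotomic_unit_group_def complex_mult_group_def)
    moreover have "F.lincomb S {1..k - 1} c = \<one>\<^bsub>function_group\<^esub> \<longleftrightarrow>
        (\<forall>t. Im t > 0 \<longrightarrow> (\<Prod>m=1..k-1. s_fun l m t powi c m) = 1)"
    proof -
      have "F.lincomb S {1..k - 1} c = \<one>\<^bsub>function_group\<^esub> \<longleftrightarrow>
          (\<forall>t\<in>upper_half_plane. F.lincomb S {1..k - 1} c t = 1)"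
        using S by (intro one F.lincomb_closed) auto
      also have "\<dots> \<longleftrightarrow> (\<forall>t\<in>upper_half_plane. (\<Prod>m=1..k - 1. S m t powi c m) = 1)"
        using S by (simp add: lincomb_function_group)
      also have "\<dots> \<longleftrightarrow> (\<forall>t. Im t > 0 \<longrightarrow> (\<Prod>m=1..k-1. s_fun l m t powi c m) = 1)"
        by (auto simp: S_def upper_half_plane_def)
      finally show ?thesis .
    qed
    ultimately show ?thesis using s_fun_relation_iff[of c] by simp
  qed
  then show "abelian_rank (subgroup_generated (cyclotomic_unit_group l) (s_value l ` {1..k - 1})) =
      abelian_rank (U_R l k)"
    unfolding U_R_def S_def[symmetric]
    by (intro abelian_rank_subgroup_generated_eq U.comm_group_axioms F.comm_group_axioms S units') auto
qed

end
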